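(* Let $Q$ be a nonnegative and symmetric trace class operator on $U$ and let $(W_t)_{t\ge0}$ be a $U$-valued $Q$-Wiener process. Let $\Phi\in L(U,H)_{U_0}$ and $\Psi\in L(H,L(U,H)_{U_0})$. Then there is a constant $C_Q>0$ such that for all $h>0$ and $t$ with $t,t+h\in[0,T]$, all $D,K\in\mathbb N$, and all $\mathcal J_K\subset\mathcal J$ with $|\mathcal J_K|=K$, $$\bigg(\mathrm E\bigg[\Big\|\int_t^{t+h}\Psi\Big(\int_t^s\Phi\,\mathrm dW^K_r\Big)\mathrm dW^K_s-\sum_{i,j\in\mathcal J_K}\bar I^{Q,(D)}_{(i,j)}(h)\,\Psi\big(\Phi\tilde e_i,\tilde e_j\big)\Big\|_H^2\bigg]\bigg)^{1/2}\le C_Q\frac{h}{\pi\sqrt D},$$ where $W^K_t=\sum_{j\in\mathcal J_K}\langle W_t,\tilde e_j\rangle_U\,\tilde e_j$ and $\bar I^{Q,(D)}_{(i,j)}(h)$ denotes the Algorithm 1 approximation (defined in the context) of $\int_t^{t+h}\int_t^s\langle\mathrm dW_r,\tilde e_i\rangle_U\langle\mathrm dW_s,\tilde e_j\rangle_U$.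
   Context: **Setting.** $H,U$ are separable real Hilbert spaces, $T>0$ is fixed, $(\Omega,\mathcal F,P,(\mathcal F_t)_{t\ge0})$ is a filtered probability space and $W$ is a $Q$-Wiener process with respect to $(\mathcal F_t)$. $Q$ has eigenvalues $\eta_j\ge0$ and eigenvectors $\tilde e_j$, $j\in\mathcal J$ ($\mathcal J$ countable), the $\tilde e_j$ forming an orthonormal basis of $U$; $W_t=\sum_{j\in\mathcal J}\sqrt{\eta_j}\,\beta^j_t\,\tilde e_j$ with independent real Brownian motions $\beta^j$. $U_0:=Q^{1/2}U$, and $L(U,H)_{U_0}:=\{S|_{U_0}: S\in L(U,H)\}$. The condition $\Psi\in L(H,L(U,H)_{U_0})$ means that $\Psi$ is a bounded linear map from $H$ into (restrictions to $U_0$ of) bounded operators in $L(U,H)$. Notation: $\Psi(x,u):=\Psi(x)u$. For finite $\mathcal J_K\subset\mathcal J$ with $|\mathcal J_K|=K$ it is assumed that $\eta_j\ne0$ for $j\in\mathcal J_K$ and, after relabelling, $\mathcal J_K=\{1,\dots,K\}$. The constant $C_Q$ may depend on $Q,\Phi,\Psi,T$ but not on $h,t,D,K,\mathcal J_K$. **Algorithm 1.** Fix $t,h$. For $j\in\mathcal J_K$ and $s\in[0,h]$ let $w^j_s:=\langle W_{t+s}-W_t,\tilde e_j\rangle_U$, $\Delta w^j_h:=w^j_h$, and for $r\in\mathbb N$ $$a^j_r=\frac2h\int_0^h\Big(w^j_u-\frac uh w^j_h\Big)\cos\Big(\frac{2r\pi u}{h}\Big)\mathrm du,\qquad b^j_r=\frac2h\int_0^h\Big(w^j_u-\frac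 uh w^j_h\Big)\sin\Big(\frac{2r\pi u}{h}\Big)\mathrm du .$$ These are independent of each other and of the $\Delta w_h^j$, with $a^j_r,b^j_r\sim N(0,\eta_jh/(2\pi^2r^2))$. For $D\in\mathbb N$ the truncated Lévy area is $$A^{Q,(D)}_{(i,j)}(h)=\pi\sum_{r=1}^{D}r\Big(a^i_r\big(b^j_r-\tfrac1{\pi r}\Delta w^j_h\big)-\big(b^i_r-\tfrac1{\pi r}\Delta w^i_h\big)a^j_r\Big),$$ and the approximation is $$\bar I^{Q,(D)}_{(i,j)}(h)=\frac{\Delta w^i_h\,\Delta w^j_h-h\,\eta_i\,\delta_{ij}}{2}+A^{Q,(D)}_{(i,j)}(h),\qquad i,j\in\mathcal J_K .$$ *)

theory Defs
  imports "HOL-Probability.Probability"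
begin

section \<open>Operators on Hilbert spaces\<close>

text \<open>A separable real Hilbert space is a type of the classes \<open>real_inner\<close>, \<open>banach\<close> and
  \<open>second_countable_topology\<close>. Definitions that do not need completeness or separability
  are stated for \<open>real_inner\<close> or \<open>real_normed_vector\<close> only.\<close>

definition nonneg_symmetric :: "('u::real_inner \<Rightarrow> 'u) \<Rightarrow> bool" where
  "nonneg_symmetric Q \<longleftrightarrow>
     bounded_linear Q \<and> (\<forall>x y. Q x \<bullet> y = x \<bullet> Q y) \<and> (\<forall>x. 0 \<le> Q x \<bullet> x)"

definition trace_class :: "('u::real_inner \<Rightarrow> 'u) \<Rightarrow> bool" where
  "trace_class Q \<longleftrightarrow>
     (\<exists>a b :: nat \<Rightarrow> 'u. summable (\<lambda>n. norm (a n) * norm (b n)) \<and>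
        (\<forall>x. (\<lambda>n. (b n \<bullet> x) *\<^sub>R a n) sums Q x))"

text \<open>The square root is the unique nonnegative symmetric operator with square \<open>Q\<close>; this is
  meant for nonnegative symmetric \<open>Q\<close>.\<close>

definition op_sqrt :: "('u::real_inner \<Rightarrow> 'u) \<Rightarrow> 'u \<Rightarrow> 'u" where
  "op_sqrt Q = (THE R. nonneg_symmetric R \<and> R \<circ> R = Q)"

definition orthonormal_basis :: "'j set \<Rightarrow> ('j \<Rightarrow> 'u::real_inner) \<Rightarrow> bool" where
  "orthonormal_basis J e \<longleftrightarrow>
     (\<forall>i\<in>J. \<forall>j\<in>J. e i \<bullet> e j = (if i = j then 1 else 0)) \<and> closure (span (e ` J)) = UNIV"

text \<open>The square of the Hilbert-Schmidt norm of \<open>L\<close>, computed in the orthonormal basis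
  \<open>(e j)\<close>, \<open>j \<in> J\<close> (for linear \<open>L\<close> it does not depend on the basis).\<close>

definition hs_norm_sq ::
  "'j set \<Rightarrow> ('j \<Rightarrow> 'u) \<Rightarrow> ('u \<Rightarrow> 'h::real_normed_vector) \<Rightarrow> ennreal" where
  "hs_norm_sq J e L = (\<integral>\<^sup>+ j. ennreal ((norm (L (e j)))\<^sup>2) \<partial>count_space J)"

definition U0_space :: "('u::real_inner \<Rightarrow> 'u) \<Rightarrow> 'u set" where
  "U0_space Q = range (op_sqrt Q)"

text \<open>\<open>L(U,H)\<close> restricted to a subspace \<open>V\<close> of \<open>U\<close>. A restriction to \<open>V\<close> is a function that
  is \<open>undefined\<close> outside \<open>V\<close>.\<close>

definition restricted_ops ::
  "'u::real_normed_vector set \<Rightarrow> ('u \<Rightarrow> 'h::real_normed_vector) set" where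
  "restricted_ops V = {restrict S V | S. bounded_linear S}"

text \<open>Bounded linear maps from \<open>H\<close> into \<open>restricted_ops V\<close>. The linear structure of
  \<open>restricted_ops V\<close> is the pointwise one on \<open>V\<close>, and its norm is the operator norm with
  respect to the norm of \<open>U\<close>.\<close>

definition bounded_linear_into_restricted ::
  "'u::real_normed_vector set \<Rightarrow> ('h::real_normed_vector \<Rightarrow> 'u \<Rightarrow> 'h) \<Rightarrow> bool" where
  "bounded_linear_into_restricted V \<Psi> \<longleftrightarrow>
     (\<forall>x. \<Psi> x \<in> restricted_ops V) \<and>
     (\<forall>x y. \<forall>u\<in>V. \<Psi> (x + y) u = \<Psi> x u + \<Psi> y u) \<and>
     (\<forall>c x. \<forall>u\<in>V. \<Psi> (c *\<^sub>R x) u = c *\<^sub>R \<Psi> x u) \<and>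
     (\<exists>B. \<forall>x. \<forall>u\<in>V. norm (\<Psi> x u) \<le> B * norm x * norm u)"


section \<open>Wiener processes\<close>

definition filtered_prob_space :: "'a measure \<Rightarrow> (real \<Rightarrow> 'a measure) \<Rightarrow> bool" where
  "filtered_prob_space M F \<longleftrightarrow>
     prob_space M \<and> (\<forall>t\<ge>0. subalgebra M (F t)) \<and> (\<forall>s t. 0 \<le> s \<and> s \<le> t \<longrightarrow> subalgebra (F t) (F s))"

text \<open>The normal distribution with mean \<open>m\<close> and variance \<open>v \<ge> 0\<close>; for \<open>v = 0\<close> it is the
  point mass in \<open>m\<close>.\<close>

definition normal_law :: "real \<Rightarrow> real \<Rightarrow> real measure" where
  "normal_law m v =
     (if v = 0 then return borel m else density lborel (\<lambda>x. ennreal (normal_density m (sqrt v) x)))"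

text \<open>The law of \<open>X\<close> is the centred Gaussian measure \<open>N(0, c Q)\<close> on \<open>U\<close>.\<close>

definition centred_gaussian ::
  "'a measure \<Rightarrow> ('u::real_inner \<Rightarrow> 'u) \<Rightarrow> real \<Rightarrow> ('a \<Rightarrow> 'u) \<Rightarrow> bool" where
  "centred_gaussian M Q c X \<longleftrightarrow>
     X \<in> borel_measurable M \<and>
     (\<forall>v. distr M borel (\<lambda>\<omega>. X \<omega> \<bullet> v) = normal_law 0 (c * (Q v \<bullet> v)))"

definition Q_Wiener_process ::
  "'a measure \<Rightarrow> ('u::real_inner \<Rightarrow> 'u) \<Rightarrow> (real \<Rightarrow> 'a \<Rightarrow> 'u) \<Rightarrow> bool" where
  "Q_Wiener_process M Q W \<longleftrightarrow>
     (\<forall>t\<ge>0. W t \<in> borel_measurable M) \<and>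
     (AE \<omega> in M. W 0 \<omega> = 0) \<and>
     (AE \<omega> in M. continuous_on {0..} (\<lambda>t. W t \<omega>)) \<and>
     (\<forall>n \<tau>. 0 \<le> \<tau> 0 \<and> (\<forall>k<n. \<tau> k < \<tau> (Suc k)) \<longrightarrow>
        prob_space.indep_vars M (\<lambda>_. borel) (\<lambda>k \<omega>. W (\<tau> (Suc k)) \<omega> - W (\<tau> k) \<omega>) {..<n::nat}) \<and>
     (\<forall>s t. 0 \<le> s \<and> s \<le> t \<longrightarrow> centred_gaussian M Q (t - s) (\<lambda>\<omega>. W t \<omega> - W s \<omega>))"

definition Q_Wiener_process_wrt ::
  "'a measure \<Rightarrow> (real \<Rightarrow> 'a measure) \<Rightarrow> ('u::real_inner \<Rightarrow> 'u) \<Rightarrow> (real \<Rightarrow> 'a \<Rightarrow> 'u) \<Rightarrow> bool" where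
  "Q_Wiener_process_wrt M F Q W \<longleftrightarrow>
     Q_Wiener_process M Q W \<and>
     (\<forall>t\<ge>0. W t \<in> borel_measurable (F t)) \<and>
     (\<forall>s t. 0 \<le> s \<and> s \<le> t \<longrightarrow>
        prob_space.indep_set M (sets (F s))
          (sets (vimage_algebra (space M) (\<lambda>\<omega>. W t \<omega> - W s \<omega>) borel)))"

text \<open>The projected process \<open>W\<^sup>K\<close> for \<open>K\<close> (the set of indices) and its covariance operator.\<close>

definition proj_process ::
  "('j \<Rightarrow> 'u::real_inner) \<Rightarrow> 'j set \<Rightarrow> (real \<Rightarrow> 'a \<Rightarrow> 'u) \<Rightarrow> real \<Rightarrow> 'a \<Rightarrow> 'u" where
  "proj_process e K W t \<omega> = (\<Sum>j\<in>K. (W t \<omega> \<bullet> e j) *\<^sub>R e j)"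

definition proj_cov ::
  "('j \<Rightarrow> 'u::real_inner) \<Rightarrow> ('j \<Rightarrow> real) \<Rightarrow> 'j set \<Rightarrow> 'u \<Rightarrow> 'u" where
  "proj_cov e \<eta> K x = (\<Sum>j\<in>K. (\<eta> j * (x \<bullet> e j)) *\<^sub>R e j)"


section \<open>The stochastic integral\<close>

text \<open>Elementary integrands on \<open>[a, b]\<close>: on \<open>]\<tau> m, \<tau> (m + 1)]\<close>, \<open>m < n\<close>, the value is
  \<open>L m\<close>, an \<open>F (\<tau> m)\<close>-measurable random variable with finitely many values in \<open>L(U,H)\<close>.\<close>

definition elementary_integrand ::
  "(real \<Rightarrow> 'a measure) \<Rightarrow> real \<Rightarrow> real \<Rightarrow> nat \<Rightarrow> (nat \<Rightarrow> real) \<Rightarrow>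
     (nat \<Rightarrow> 'a \<Rightarrow> ('u::real_normed_vector \<Rightarrow>\<^sub>L 'h::real_normed_vector)) \<Rightarrow> bool" where
  "elementary_integrand F a b n \<tau> L \<longleftrightarrow>
     \<tau> 0 = a \<and> \<tau> n = b \<and> (\<forall>m<n. \<tau> m < \<tau> (Suc m) \<and> simple_function (F (\<tau> m)) (L m))"

definition elementary_value ::
  "nat \<Rightarrow> (nat \<Rightarrow> real) \<Rightarrow> (nat \<Rightarrow> 'a \<Rightarrow> ('u::real_normed_vector \<Rightarrow>\<^sub>L 'h::real_normed_vector)) \<Rightarrow>
     real \<Rightarrow> 'a \<Rightarrow> 'u \<Rightarrow> 'h" where
  "elementary_value n \<tau> L s \<omega> u =
     (\<Sum>m<n. indicator {\<tau> m<..\<tau> (Suc m)} s *\<^sub>R blinfun_apply (L m \<omega>) u)"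

definition elementary_integral ::
  "(real \<Rightarrow> 'a \<Rightarrow> 'u) \<Rightarrow> nat \<Rightarrow> (nat \<Rightarrow> real) \<Rightarrow>
     (nat \<Rightarrow> 'a \<Rightarrow> ('u::real_normed_vector \<Rightarrow>\<^sub>L 'h::real_normed_vector)) \<Rightarrow> 'a \<Rightarrow> 'h" where
  "elementary_integral W n \<tau> L \<omega> =
     (\<Sum>m<n. blinfun_apply (L m \<omega>) (W (\<tau> (Suc m)) \<omega> - W (\<tau> m) \<omega>))"

text \<open>\<open>E \<parallel>(X s - Y s) Q\<^sup>1\<^sup>/\<^sup>2\<parallel>\<^sup>2\<close> with the Hilbert-Schmidt norm, for operator-valued processes
  \<open>X\<close> and \<open>Y\<close>. Only the values of the operators on the range of \<open>Q\<^sup>1\<^sup>/\<^sup>2\<close> enter.\<close>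

definition hs_mean_square_dist ::
  "'a measure \<Rightarrow> ('u::real_inner \<Rightarrow> 'u) \<Rightarrow> 'j set \<Rightarrow> ('j \<Rightarrow> 'u) \<Rightarrow>
     (real \<Rightarrow> 'a \<Rightarrow> 'u \<Rightarrow> 'h::real_normed_vector) \<Rightarrow> (real \<Rightarrow> 'a \<Rightarrow> 'u \<Rightarrow> 'h) \<Rightarrow> real \<Rightarrow> ennreal" where
  "hs_mean_square_dist M Q J e X Y s =
     (\<integral>\<^sup>+ \<omega>. hs_norm_sq J e (\<lambda>u. X s \<omega> (op_sqrt Q u) - Y s \<omega> (op_sqrt Q u)) \<partial>M)"

text \<open>\<open>I\<close> is a version of \<open>\<integral>\<^sub>a\<^sup>b X dW\<close>, where \<open>W\<close> has covariance operator \<open>Q\<close>: the limit in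
  mean square of the integrals of elementary integrands which converge to the adapted process
  \<open>X\<close> in \<open>L\<^sup>2(ds \<times> P)\<close> with respect to the Hilbert-Schmidt norm of \<open>\<cdot> Q\<^sup>1\<^sup>/\<^sup>2\<close>. The expectation
  is taken before the integral over \<open>s\<close>, so that the notion does not change if \<open>X s\<close> is
  modified on a null set that depends on \<open>s\<close>; hence an iterated integral may use an arbitrary
  version of the inner integral for every \<open>s\<close>. The measurability in \<open>s\<close> is demanded because
  the nonnegative integral of a nonmeasurable function is only a lower integral.\<close>

definition is_stoch_integral ::
  "'a measure \<Rightarrow> (real \<Rightarrow> 'a measure) \<Rightarrow> ('u::real_inner \<Rightarrow> 'u) \<Rightarrow> 'j set \<Rightarrow> ('j \<Rightarrow> 'u) \<Rightarrow>
     (real \<Rightarrow> 'a \<Rightarrow> 'u) \<Rightarrow> real \<Rightarrow> real \<Rightarrow>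
     (real \<Rightarrow> 'a \<Rightarrow> 'u \<Rightarrow> 'h::real_normed_vector) \<Rightarrow> ('a \<Rightarrow> 'h) \<Rightarrow> bool" where
  "is_stoch_integral M F Q J e W a b X I \<longleftrightarrow>
     I \<in> borel_measurable (F b) \<and>
     (\<forall>s\<in>{a..b}. \<forall>u. (\<lambda>\<omega>. X s \<omega> (op_sqrt Q u)) \<in> borel_measurable (F s)) \<and>
     (\<exists>(n :: nat \<Rightarrow> nat) (\<tau> :: nat \<Rightarrow> nat \<Rightarrow> real) (L :: nat \<Rightarrow> nat \<Rightarrow> 'a \<Rightarrow> ('u \<Rightarrow>\<^sub>L 'h)).
        (\<forall>k. elementary_integrand F a b (n k) (\<tau> k) (L k)) \<and>
        (\<forall>k. hs_mean_square_dist M Q J e X (elementary_value (n k) (\<tau> k) (L k))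
               \<in> borel_measurable (restrict_space borel {a..b})) \<and>
        (\<lambda>k. \<integral>\<^sup>+ s\<in>{a..b}. hs_mean_square_dist M Q J e X (elementary_value (n k) (\<tau> k) (L k)) s
               \<partial>lborel) \<longlonglongrightarrow> 0 \<and>
        (\<lambda>k. \<integral>\<^sup>+ \<omega>. ennreal ((norm (elementary_integral W (n k) (\<tau> k) (L k) \<omega> - I \<omega>))\<^sup>2) \<partial>M)
          \<longlonglongrightarrow> 0)"

definition stoch_integral ::
  "'a measure \<Rightarrow> (real \<Rightarrow> 'a measure) \<Rightarrow> ('u::real_inner \<Rightarrow> 'u) \<Rightarrow> 'j set \<Rightarrow> ('j \<Rightarrow> 'u) \<Rightarrow>
     (real \<Rightarrow> 'a \<Rightarrow> 'u) \<Rightarrow> real \<Rightarrow> real \<Rightarrow>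
     (real \<Rightarrow> 'a \<Rightarrow> 'u \<Rightarrow> 'h::real_normed_vector) \<Rightarrow> 'a \<Rightarrow> 'h" where
  "stoch_integral M F Q J e W a b X = (SOME I. is_stoch_integral M F Q J e W a b X I)"


section \<open>The truncated Fourier approximation of the iterated integrals\<close>

text \<open>In the following, \<open>w s \<omega>\<close> stands for the increment \<open>\<langle>W\<^bsub>t+s\<^esub> - W\<^bsub>t\<^esub>, e j\<rangle>\<close>,
  \<open>0 \<le> s \<le> h\<close>.\<close>

definition increment_coord ::
  "(real \<Rightarrow> 'a \<Rightarrow> 'u::real_inner) \<Rightarrow> ('j \<Rightarrow> 'u) \<Rightarrow> real \<Rightarrow> 'j \<Rightarrow> real \<Rightarrow> 'a \<Rightarrow> real" where
  "increment_coord W e t j s \<omega> = (W (t + s) \<omega> - W t \<omega>) \<bullet> e j"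

definition fourier_a :: "(real \<Rightarrow> 'a \<Rightarrow> real) \<Rightarrow> real \<Rightarrow> nat \<Rightarrow> 'a \<Rightarrow> real" where
  "fourier_a w h r \<omega> =
     2 / h * (LINT u:{0..h}|lborel. (w u \<omega> - u / h * w h \<omega>) * cos (2 * real r * pi * u / h))"

definition fourier_b :: "(real \<Rightarrow> 'a \<Rightarrow> real) \<Rightarrow> real \<Rightarrow> nat \<Rightarrow> 'a \<Rightarrow> real" where
  "fourier_b w h r \<omega> =
     2 / h * (LINT u:{0..h}|lborel. (w u \<omega> - u / h * w h \<omega>) * sin (2 * real r * pi * u / h))"

definition levy_area_trunc ::
  "(real \<Rightarrow> 'a \<Rightarrow> real) \<Rightarrow> (real \<Rightarrow> 'a \<Rightarrow> real) \<Rightarrow> real \<Rightarrow> nat \<Rightarrow> 'a \<Rightarrow> real" where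
  "levy_area_trunc w v h D \<omega> =
     pi * (\<Sum>r=1..D. real r *
       (fourier_a w h r \<omega> * (fourier_b v h r \<omega> - 1 / (pi * real r) * v h \<omega>)
        - (fourier_b w h r \<omega> - 1 / (pi * real r) * w h \<omega>) * fourier_a v h r \<omega>))"

definition iter_integral_approx ::
  "(real \<Rightarrow> 'a \<Rightarrow> 'u::real_inner) \<Rightarrow> ('j \<Rightarrow> 'u) \<Rightarrow> ('j \<Rightarrow> real) \<Rightarrow> real \<Rightarrow> real \<Rightarrow> nat \<Rightarrow>
     'j \<Rightarrow> 'j \<Rightarrow> 'a \<Rightarrow> real" where
  "iter_integral_approx W e \<eta> t h D i j \<omega> =
     (increment_coord W e t i h \<omega> * increment_coord W e t j h \<omega>
        - h * \<eta> i * (if i = j then 1 else 0)) / 2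
     + levy_area_trunc (increment_coord W e t i) (increment_coord W e t j) h D \<omega>"

end

theory Submission
  imports Defs
begin

text \<open>Put \<open>\<psi> i j = \<Psi> (\<Phi> (e i)) (e j)\<close>. On a uniform grid of \<open>n\<close> steps, the outer integral is
  approximated in mean square by the left point sums of \<open>\<psi> i j\<close> times products of increments of
  the coordinates \<open>i\<close> and \<open>j\<close> over an earlier and a later cell, and the Fourier coefficients are the
  pathwise limits of sums over the same increments, because integration by parts turns \<open>a\<^sub>r\<close> and
  \<open>b\<^sub>r\<close> into \<open>- (1 / (\<pi> r)) \<integral> sin dw\<close> and \<open>(1 / (\<pi> r)) \<integral> cos dw\<close>. The discrete error is then a
  quadratic form in the increments. Its diagonal is a quadratic variation error, which vanishes as
  \<open>n \<rightarrow> \<infinity>\<close>. Its off-diagonal part has the coefficients \<open>\<psi> i j - \<psi> j i\<close> and a kernel that is the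
  remainder of the Fourier series of the sign function, a combination of three values of the remainder
  of the sawtooth series. Two applications of the Ito isometry bound the second moment by the
  mean square of that remainder, which is at most \<open>1 / (2 D)\<close> by \<open>\<Sum> 1 / r\<^sup>2 = \<pi>\<^sup>2 / 6\<close>, times
  \<open>\<Sum> \<eta> i * \<eta> j * \<parallel>\<psi> i j - \<psi> j i\<parallel>\<^sup>2\<close>. The isometry yields the weights \<open>\<eta>\<close> and not their
  square roots, so the trace of \<open>Q\<close> bounds this sum uniformly in the index set. Fatou's lemma carries
  the bound to the limit.\<close>

section \<open>Riemann--Stieltjes sums and the sawtooth series\<close>

text \<open>\<open>stoch_integral\<close> chooses an arbitrary version, and the inner integral is
  chosen anew for every \<open>s\<close>. So nothing is known about the integrand as a function of
  \<open>s\<close> along a path, and a version must first be shown to exist. Both difficulties are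
  met by working at fixed \<open>s\<close> in mean square, where the isometry controls the distance
  of any version to a step process. The coefficients of the error are antisymmetric because the
  symmetric part is reproduced exactly: the integrals for (i,j) and (j,i) add up to the product of
  the two increments, less the quadratic variation when i = j, and the approximation has the same
  property. What is left is half the sign function of the time difference, whose Fourier series is
  cut off at \<open>D\<close>. Fatou's lemma is forced by two modes of convergence: the Fourier
  coefficients converge path by path, the integrals in mean square. Dyadic grids make the second
  almost sure. The final factor 9 is 2 * 3 * 3 / 2: separating the diagonal gives 2, squaring three
  sawtooth values 3, their three double sums another 3, and the mean square of the remainder the
  last 1/2.\<close>

lemma stieltjes_sum_tendsto:
  fixes f f' g :: "real \<Rightarrow> real"
  assumes g: "continuous_on {0..1} g"
    and f: "\<And>x. (f has_real_derivative f' x) (at x)" and f': "continuous_on UNIV f'"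
    and p: "\<And>n m. m < n \<Longrightarrow> real m / real n \<le> p n m \<and> p n m \<le> real (Suc m) / real n"
  shows "(\<lambda>n. \<Sum>m<n. g (p n m) * (f (real (Suc m) / real n) - f (real m / real n)))
           \<longlonglongrightarrow> integral {0..1} (\<lambda>x. g x * f' x)"
proof -
  have f'01: "continuous_on {a..b} f'" for a b
    using f' continuous_on_subset by blast
  obtain B where B: "B > 0" "\<And>x. x \<in> {0..1} \<Longrightarrow> norm (f' x) \<le> B"
  proof -
    have "bounded (f' ` {0..1})"
      using f'01 compact_Icc compact_continuous_image compact_imp_bounded by blast
    then show thesis using that by (auto simp: bounded_pos)
  qed
  have unif: "uniformly_continuous_on {0..1} g"
    using g compact_uniformly_continuous by blast
  show ?thesis
  proof (rule LIMSEQ_I)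
    fix \<epsilon> :: real assume eps: "\<epsilon> > 0"
    \<comment> \<open>The oscillation of \<open>g\<close> is measured against the bound
      \<open>B\<close> of \<open>f'\<close>, so that the errors of all cells add up to at most
      \<open>\<epsilon> / 2\<close>.\<close>
    obtain d where d: "d > 0"
      "\<And>x x'. x \<in> {0..1} \<Longrightarrow> x' \<in> {0..1} \<Longrightarrow> dist x' x < d \<Longrightarrow> dist (g x') (g x) < \<epsilon> / (2 * B)"
      proof -
      have "\<epsilon> / (2 * B) > 0" using eps B(1) by simp
      then show thesis using unif that unfolding uniformly_continuous_on_def by metis
    qed
    obtain N where N: "1 / real (Suc N) < d" using d(1) nat_approx_posE by blast
    show "\<exists>no. \<forall>n\<ge>no. norm ((\<Sum>m<n. g (p n m) * (f (real (Suc m) / real n) - f (real m / real n)))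
            - integral {0..1} (\<lambda>x. g x * f' x)) < \<epsilon>"
    proof (intro exI[of _ "Suc N"] allI impI)
      fix n assume n: "Suc N \<le> n"
      then have n0: "n > 0" by simp
      have nd: "1 / real n < d"
        using N n by (smt (verit) frac_le of_nat_0_less_iff of_nat_le_iff zero_less_Suc)
      define c where "c m = real m / real n" for m
      have c_mono: "c m \<le> c (Suc m)" for m unfolding c_def by (simp add: divide_right_mono)
      have cS: "c (Suc m) = c m + 1 / real n" for m by (simp add: c_def add_divide_distrib)
      have c01: "c 0 = 0" "c n = 1" using n0 by (auto simp: c_def)
      have c_le: "0 \<le> c m" "m \<le> n \<Longrightarrow> c m \<le> 1" for m using n0 by (auto simp: c_def)
      have int: "(\<lambda>x. g x * f' x) integrable_on {a..b}" if "0 \<le> a" "b \<le> 1" for a b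
        by (intro integrable_continuous_real continuous_on_mult f'01 continuous_on_subset[OF g]) (use that in auto)
      have intf: "f' integrable_on {a..b}" for a b by (rule integrable_continuous_real[OF f'01])
      have split: "integral {0..c k} (\<lambda>x. g x * f' x) = (\<Sum>m<k. integral {c m..c (Suc m)} (\<lambda>x. g x * f' x))"
        if "k \<le> n" for k using that
      proof (induction k)
        case 0 then show ?case by (simp add: c01)
      next
        case (Suc k)
        have "integral {0..c k} (\<lambda>x. g x * f' x) + integral {c k..c (Suc k)} (\<lambda>x. g x * f' x)
                = integral {0..c (Suc k)} (\<lambda>x. g x * f' x)"
          by (rule Henstock_Kurzweil_Integration.integral_combine)
            (use c_mono c_le[of "Suc k"] c_le(1) Suc.prems int in auto)
        then show ?case using Suc by simp
      qed
      have ftc: "integral {c m..c (Suc m)} f' = f (c (Suc m)) - f (c m)" for m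
        by (intro integral_unique fundamental_theorem_of_calculus c_mono)
          (meson f has_field_derivative_at_within has_real_derivative_iff_has_vector_derivative)
      \<comment> \<open>The increment of \<open>f\<close> is the integral of \<open>f'\<close> over
        the cell, so the error is the integral of \<open>(g (p n m) - g x) * f' x\<close>. Any tag
        \<open>p n m\<close> in the cell will do; left and right endpoints both occur later.\<close>
      have cell: "norm (g (p n m) * (f (c (Suc m)) - f (c m)) - integral {c m..c (Suc m)} (\<lambda>x. g x * f' x))
            \<le> \<epsilon> / 2 * (1 / real n)" if m: "m < n" for m
      proof -
        have sub: "{c m..c (Suc m)} \<subseteq> {0..1}" using c_le(1)[of m] c_le(2)[of "Suc m"] m by auto
        have pm: "p n m \<in> {c m..c (Suc m)}" using p[OF m] by (simp add: c_def)
        have i1: "(\<lambda>x. g (p n m) * f' x) integrable_on {c m..c (Suc m)}"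
          using intf by (rule integrable_on_mult_right)
        have i2: "(\<lambda>x. g x * f' x) integrable_on {c m..c (Suc m)}"
          using int sub c_mono[of m] by auto
        have "g (p n m) * (f (c (Suc m)) - f (c m)) - integral {c m..c (Suc m)} (\<lambda>x. g x * f' x)
            = integral {c m..c (Suc m)} (\<lambda>x. g (p n m) * f' x - g x * f' x)"
          using ftc[of m] by (simp add: Henstock_Kurzweil_Integration.integral_diff[OF i1 i2])
        also have "norm \<dots> \<le> \<epsilon> / (2 * B) * B * measure lborel (cbox (c m) (c (Suc m)))"
        proof (rule has_integral_bound)
          show "0 \<le> \<epsilon> / (2 * B) * B" using eps B by simp
          show "((\<lambda>x. g (p n m) * f' x - g x * f' x) has_integral
              integral {c m..c (Suc m)} (\<lambda>x. g (p n m) * f' x - g x * f' x)) (cbox (c m) (c (Suc m)))"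
            using integrable_integral[OF integrable_diff[OF i1 i2]] by simp
          fix x assume x: "x \<in> cbox (c m) (c (Suc m))"
          then have x': "x \<in> {0..1}" using sub by auto
          have "dist (p n m) x \<le> 1 / real n" using pm x cS[of m] by (auto simp: dist_real_def)
          then have "dist (g (p n m)) (g x) < \<epsilon> / (2 * B)" using d(2)[OF x'] pm sub nd by auto
          then have "\<bar>g (p n m) - g x\<bar> * \<bar>f' x\<bar> \<le> \<epsilon> / (2 * B) * B"
            using B(2)[OF x'] by (intro mult_mono) (auto simp: dist_real_def)
          then show "norm (g (p n m) * f' x - g x * f' x) \<le> \<epsilon> / (2 * B) * B"
            by (simp add: abs_mult flip: left_diff_distrib)
        qed
        also have "\<dots> = \<epsilon> / 2 * (1 / real n)" using B(1) c_mono[of m] cS[of m] by (simp add: content_real)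
        finally show ?thesis .
      qed
      have "(\<Sum>m<n. g (p n m) * (f (c (Suc m)) - f (c m))) - integral {0..1} (\<lambda>x. g x * f' x)
          = (\<Sum>m<n. g (p n m) * (f (c (Suc m)) - f (c m)) - integral {c m..c (Suc m)} (\<lambda>x. g x * f' x))"
        using split[of n] by (simp add: c01 sum_subtractf)
      also have "norm \<dots> \<le> (\<Sum>m<n. \<epsilon> / 2 * (1 / real n))"
        using cell by (intro order_trans[OF norm_sum] sum_mono) blast
      also have "\<dots> < \<epsilon>" using n0 eps by simp
      finally show "norm ((\<Sum>m<n. g (p n m) * (f (real (Suc m) / real n) - f (real m / real n)))
            - integral {0..1} (\<lambda>x. g x * f' x)) < \<epsilon>" by (simp add: c_def)
    qed
  qed
qed

lemma sum_by_parts: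
  fixes f g :: "nat \<Rightarrow> real"
  shows "(\<Sum>m<n. f m * (g (Suc m) - g m)) = f n * g n - f 0 * g 0 - (\<Sum>m<n. g (Suc m) * (f (Suc m) - f m))"
  by (induction n) (auto simp: algebra_simps)

text \<open>\<open>pi * (1/2 - x)\<close> is the sum of the full sine series for
  \<open>0 < x < 1\<close>. No periodic extension is built in, and the value at \<open>x = 0\<close>
  is \<open>pi / 2\<close>; a single point does not affect the integrals over the unit
  interval.\<close>

definition sawtooth_rem :: "nat \<Rightarrow> real \<Rightarrow> real" where
  "sawtooth_rem D x = pi * (1/2 - x) - (\<Sum>r=1..D. sin (2 * real r * pi * x) / real r)"

lemma sawtooth_rem_continuous: "continuous_on A (sawtooth_rem D)"
  unfolding sawtooth_rem_def by (intro continuous_intros) auto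

section \<open>Fourier integrals over the unit interval\<close>

lemma sin_two_pi_nat [simp]: "sin (2 * real r * pi) = 0" "cos (2 * real r * pi) = 1"
  "sin (2 * pi * real r) = 0" "cos (2 * pi * real r) = 1"
  using sin_npi[of "2 * r"] cos_npi[of "2 * r"] by (auto simp: mult_ac)

lemma has_integral_antiderivative:
  fixes f :: "real \<Rightarrow> real"
  assumes "\<And>x. (f has_real_derivative f' x) (at x)" "a \<le> b"
  shows "(f' has_integral (f b - f a)) {a..b}"
  by (rule fundamental_theorem_of_calculus[OF assms(2)])
    (meson assms(1) has_field_derivative_at_within has_real_derivative_iff_has_vector_derivative)

lemma integral_sin_sin:
  assumes "r > 0" "q > 0"
  shows "((\<lambda>x. sin (2 * real r * pi * x) * sin (2 * real q * pi * x)) has_integral (if r = q then 1/2 else 0)) {0..1}"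
proof (cases "r = q")
  case True
  let ?F = "\<lambda>x. x / 2 - sin (4 * real r * pi * x) / (8 * real r * pi)"
  have "((\<lambda>x. sin (2 * real r * pi * x) * sin (2 * real q * pi * x)) has_integral (?F 1 - ?F 0)) {0..1}"
  proof (rule has_integral_antiderivative)
    fix x :: real
    have "(?F has_real_derivative 1/2 - cos (4 * real r * pi * x) * (4 * real r * pi) / (8 * real r * pi)) (at x)"
      by (auto intro!: derivative_eq_intros)
    also have "1/2 - cos (4 * real r * pi * x) * (4 * real r * pi) / (8 * real r * pi)
        = sin (2 * real r * pi * x) * sin (2 * real q * pi * x)"
      using assms True cos_double_sin[of "2 * real r * pi * x"]
      by (simp add: power2_eq_square mult_ac) (simp add: diff_divide_distrib)
    finally show "(?F has_real_derivative sin (2 * real r * pi * x) * sin (2 * real q * pi * x)) (at x)" .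
  qed simp
  moreover have "sin (4 * real r * pi) = 0" using sin_two_pi_nat(1)[of "2 * r"] by (simp add: mult_ac)
  ultimately show ?thesis using True by simp
next
  case False
  let ?p = "real r - real q" and ?s = "real r + real q"
  let ?F = "\<lambda>x. sin (2 * ?p * pi * x) / (4 * ?p * pi) - sin (2 * ?s * pi * x) / (4 * ?s * pi)"
  have "((\<lambda>x. sin (2 * real r * pi * x) * sin (2 * real q * pi * x)) has_integral (?F 1 - ?F 0)) {0..1}"
  proof (rule has_integral_antiderivative)
    fix x :: real
    have "(?F has_real_derivative cos (2 * ?p * pi * x) * (2 * ?p * pi) / (4 * ?p * pi)
        - cos (2 * ?s * pi * x) * (2 * ?s * pi) / (4 * ?s * pi)) (at x)"
      using assms False by (auto intro!: derivative_eq_intros)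
    also have "cos (2 * ?p * pi * x) * (2 * ?p * pi) / (4 * ?p * pi)
        - cos (2 * ?s * pi * x) * (2 * ?s * pi) / (4 * ?s * pi)
        = (cos (2 * ?p * pi * x) - cos (2 * ?s * pi * x)) / 2"
    proof -
      have c: "cos y * (2 * z * pi) / (4 * z * pi) = cos y / 2" if "z \<noteq> 0" for y z :: real
        using that by simp
      have "?p \<noteq> 0" "?s \<noteq> 0" using assms False by auto
      then show ?thesis by (simp only: c[OF \<open>?p \<noteq> 0\<close>] c[OF \<open>?s \<noteq> 0\<close>] diff_divide_distrib)
    qed
    also have "\<dots> = sin (2 * real r * pi * x) * sin (2 * real q * pi * x)"
      using cos_diff[of "2 * real r * pi * x" "2 * real q * pi * x"] cos_add[of "2 * real r * pi * x" "2 * real q * pi * x"]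
      by (simp add: algebra_simps)
    finally show "(?F has_real_derivative sin (2 * real r * pi * x) * sin (2 * real q * pi * x)) (at x)" .
  qed simp
  moreover have "sin (2 * ?s * pi) = 0" using sin_two_pi_nat(1)[of "r + q"] by simp
  moreover have "sin (2 * ?p * pi) = 0"
    using sin_diff[of "2 * real r * pi" "2 * real q * pi"] by (simp add: left_diff_distrib right_diff_distrib)
  ultimately show ?thesis using False by simp
qed

text \<open>The first two give the sine coefficients of the sawtooth function. The first and the
  third give the share of the linear interpolation \<open>u / h * w h\<close> in
  \<open>b\<^sub>r\<close> and \<open>a\<^sub>r\<close>.\<close>

lemma integral_linear_sin:
  assumes "r > 0"
  shows "((\<lambda>x. x * sin (2 * real r * pi * x)) has_integral (- 1 / (2 * real r * pi))) {0..1}"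
    and "((\<lambda>x. sin (2 * real r * pi * x)) has_integral 0) {0..1}"
    and "((\<lambda>x. x * cos (2 * real r * pi * x)) has_integral 0) {0..1}"
proof -
  let ?c = "2 * real r * pi"
  have c: "?c > 0" using assms by simp
  let ?F = "\<lambda>x. sin (?c * x) / ?c\<^sup>2 - x * cos (?c * x) / ?c"
  have "((\<lambda>x. x * sin (?c * x)) has_integral (?F 1 - ?F 0)) {0..1}"
  proof (rule has_integral_antiderivative)
    fix x :: real
    show "(?F has_real_derivative x * sin (?c * x)) (at x)"
      using assms by (auto intro!: derivative_eq_intros simp: field_simps power2_eq_square)
  qed simp
  then show "((\<lambda>x. x * sin (2 * real r * pi * x)) has_integral (- 1 / (2 * real r * pi))) {0..1}" by simp
  let ?G = "\<lambda>x. - cos (?c * x) / ?c"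
  have "((\<lambda>x. sin (?c * x)) has_integral (?G 1 - ?G 0)) {0..1}"
  proof (rule has_integral_antiderivative)
    fix x :: real
    show "(?G has_real_derivative sin (?c * x)) (at x)"
      using assms by (auto intro!: derivative_eq_intros simp: field_simps power2_eq_square)
  qed simp
  then show "((\<lambda>x. sin (2 * real r * pi * x)) has_integral 0) {0..1}" by simp
  let ?H = "\<lambda>x. cos (?c * x) / ?c\<^sup>2 + x * sin (?c * x) / ?c"
  have "((\<lambda>x. x * cos (?c * x)) has_integral (?H 1 - ?H 0)) {0..1}"
  proof (rule has_integral_antiderivative)
    fix x :: real
    show "(?H has_real_derivative x * cos (?c * x)) (at x)"
      using assms by (auto intro!: derivative_eq_intros simp: field_simps power2_eq_square)
  qed simp
  then show "((\<lambda>x. x * cos (2 * real r * pi * x)) has_integral 0) {0..1}" by simp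
qed

text \<open>Beyond the truncation level the subtracted sines are orthogonal to the
  \<open>q\<close>-th one, so only the coefficient of the sawtooth function itself remains.\<close>

lemma integral_sawtooth_rem_sin:
  assumes "q > D"
  shows "((\<lambda>x. sawtooth_rem D x * sin (2 * real q * pi * x)) has_integral 1 / (2 * real q)) {0..1}"
proof -
  have q: "q > 0" using assms by simp
  have "((\<lambda>x. (pi / 2) * sin (2 * real q * pi * x) - pi * (x * sin (2 * real q * pi * x))
          - (\<Sum>r=1..D. sin (2 * real r * pi * x) * sin (2 * real q * pi * x) * (1 / real r)))
      has_integral (pi / 2 * 0 - pi * (- 1 / (2 * real q * pi)) - (\<Sum>r=1..D. 0 * (1 / real r)))) {0..1}"
    by (intro has_integral_diff has_integral_mult_right has_integral_sum has_integral_mult_left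
        integral_linear_sin[OF q] integral_sin_sin[of _ q, THEN has_integral_eq_rhs]) (use assms in auto)
  then show ?thesis
    using q by (simp add: sawtooth_rem_def algebra_simps sum_distrib_left sum_distrib_right)
qed

text \<open>Raising \<open>D\<close> by one subtracts one more sine divided by \<open>Suc D\<close>.
  The cross term lowers the integral by the inverse square of \<open>Suc D\<close> and the new
  square returns half of that. Parseval's identity for the remainder thus comes out of finite
  computations.\<close>

lemma integral_sawtooth_rem_sq:
  "((\<lambda>x. (sawtooth_rem D x)\<^sup>2) has_integral (pi\<^sup>2 / 12 - (\<Sum>r=1..D. 1 / (2 * (real r)\<^sup>2)))) {0..1}"
proof (induction D)
  case 0
  let ?F = "\<lambda>x::real. pi\<^sup>2 * (x / 4 - x\<^sup>2 / 2 + x ^ 3 / 3)"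
  have "((\<lambda>x. (sawtooth_rem 0 x)\<^sup>2) has_integral (?F 1 - ?F 0)) {0..1}"
  proof (rule has_integral_antiderivative)
    fix x :: real
    show "(?F has_real_derivative (sawtooth_rem 0 x)\<^sup>2) (at x)"
      by (auto intro!: derivative_eq_intros simp: sawtooth_rem_def field_simps power2_eq_square)
  qed simp
  then show ?case by (simp add: field_simps)
next
  case (Suc D)
  let ?s = "\<lambda>x. sin (2 * real (Suc D) * pi * x)"
  have "((\<lambda>x. (sawtooth_rem D x)\<^sup>2 - 2 / real (Suc D) * (sawtooth_rem D x * ?s x) + 1 / (real (Suc D))\<^sup>2 * (?s x * ?s x))
     has_integral ((pi\<^sup>2 / 12 - (\<Sum>r=1..D. 1 / (2 * (real r)\<^sup>2))) - 2 / real (Suc D) * (1 / (2 * real (Suc D)))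
        + 1 / (real (Suc D))\<^sup>2 * (1/2))) {0..1}"
    using integral_sin_sin[of "Suc D" "Suc D"]
    by (intro has_integral_diff has_integral_add has_integral_mult_right Suc integral_sawtooth_rem_sin) auto
  moreover have "(sawtooth_rem (Suc D) x)\<^sup>2 = (sawtooth_rem D x)\<^sup>2
      - 2 / real (Suc D) * (sawtooth_rem D x * ?s x) + 1 / (real (Suc D))\<^sup>2 * (?s x * ?s x)" for x
  proof -
    have "sawtooth_rem (Suc D) x = sawtooth_rem D x - ?s x / real (Suc D)"
      by (simp add: sawtooth_rem_def)
    then show ?thesis by (simp del: of_nat_Suc add: power2_diff power_divide) (simp add: power2_eq_square)
  qed
  moreover have "(pi\<^sup>2 / 12 - (\<Sum>r=1..D. 1 / (2 * (real r)\<^sup>2))) - 2 / real (Suc D) * (1 / (2 * real (Suc D)))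
        + 1 / (real (Suc D))\<^sup>2 * (1/2) = pi\<^sup>2 / 12 - (\<Sum>r=1..Suc D. 1 / (2 * (real r)\<^sup>2))"
    by (simp del: of_nat_Suc add: power2_eq_square)
  ultimately show ?case by (simp only:)
qed

lemma integral_sawtooth_rem_sq_le:
  assumes "D > 0"
  shows "integral {0..1} (\<lambda>x. (sawtooth_rem D x)\<^sup>2) \<le> 1 / (2 * real D)"
proof -
  have bound: "pi\<^sup>2 / 6 \<le> (\<Sum>r=1..D. 1 / (real r)\<^sup>2) + 1 / real D"
  proof (rule LIMSEQ_le_const2)
    show "(\<lambda>n. \<Sum>r<n. 1 / (real (r + 1))\<^sup>2) \<longlonglongrightarrow> pi\<^sup>2 / 6"
      using inverse_squares_sums by (simp add: sums_def)
    \<comment> \<open>The slack \<open>- 1 / real (D + n)\<close> carries the induction: the next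
      term of the series is at most \<open>1 / x - 1 / (x + 1)\<close> with
      \<open>x = real (D + n)\<close>, a telescoping difference.\<close>
    have "(\<Sum>r<D + n. 1 / (real (r + 1))\<^sup>2) \<le> (\<Sum>r=1..D. 1 / (real r)\<^sup>2) + 1 / real D - 1 / real (D + n)" for n
    proof (induction n)
      case 0
      have "(\<Sum>r<D. 1 / (real (r + 1))\<^sup>2) = (\<Sum>r=1..D. 1 / (real r)\<^sup>2)"
        by (rule sum.reindex_bij_witness[of _ "\<lambda>r. r - 1" Suc]) auto
      then show ?case by simp
    next
      case (Suc n)
      let ?x = "real (D + n)"
      have x: "?x > 0" using assms by simp
      have "1 / (?x + 1)\<^sup>2 \<le> 1 / (?x * (?x + 1))"
        using x by (intro divide_left_mono) (auto simp: power2_eq_square)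
      also have "\<dots> = 1 / ?x - 1 / (?x + 1)" using x by (simp add: field_simps)
      finally show ?case using Suc by (simp add: algebra_simps)
    qed
    then have "(\<Sum>r<D + n. 1 / (real (r + 1))\<^sup>2) \<le> (\<Sum>r=1..D. 1 / (real r)\<^sup>2) + 1 / real D" for n
      by (smt (verit) divide_nonneg_nonneg of_nat_0_le_iff)
    then show "\<exists>N. \<forall>n\<ge>N. (\<Sum>r<n. 1 / (real (r + 1))\<^sup>2) \<le> (\<Sum>r=1..D. 1 / (real r)\<^sup>2) + 1 / real D"
      by (metis le_Suc_ex)
  qed
  have "integral {0..1} (\<lambda>x. (sawtooth_rem D x)\<^sup>2) = pi\<^sup>2 / 12 - (\<Sum>r=1..D. 1 / (real r)\<^sup>2) / 2"
    using integral_unique[OF integral_sawtooth_rem_sq[of D]] by (simp add: sum_divide_distrib mult.commute)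
  then show ?thesis using bound by simp
qed

section \<open>Square roots of diagonal operators\<close>

lemma nonneg_symmetricD:
  assumes "nonneg_symmetric Q"
  shows "bounded_linear Q" "Q x \<bullet> y = x \<bullet> Q y" "0 \<le> Q x \<bullet> x"
  using assms by (auto simp: nonneg_symmetric_def)

lemma bounded_linear_eq_on_basis:
  assumes "bounded_linear A" "bounded_linear B" "orthonormal_basis J e" "\<And>j. j \<in> J \<Longrightarrow> A (e j) = B (e j)"
  shows "A = B"
proof
  fix x
  have lin: "linear A" "linear B" using assms(1,2) by (auto dest: bounded_linear.linear)
  have span: "A y = B y" if "y \<in> span (e ` J)" for y
    using linear_eq_on_span[OF lin _ that] assms(4) by blast
  have "closed {y. A y = B y}"
    using assms(1,2) by (intro closed_Collect_eq linear_continuous_on)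
  then have "closure (span (e ` J)) \<subseteq> {y. A y = B y}"
    by (intro closure_minimal) (use span in auto)
  then show "A x = B x" using assms(3) by (auto simp: orthonormal_basis_def)
qed

text \<open>If \<open>R\<^sup>2 = Q\<close> and \<open>Q v = c v\<close>, then \<open>y = (R - \<surd>c) v\<close> satisfies \<open>R y = - \<surd>c y\<close>, and
  nonnegativity of \<open>R\<close> forces \<open>y = 0\<close>.\<close>

lemma sqrt_eigenvector:
  assumes R: "nonneg_symmetric R" and RQ: "R \<circ> R = Q" and v: "Q v = c *\<^sub>R v" and c: "0 \<le> c"
  shows "R v = sqrt c *\<^sub>R v"
proof -
  note R' = nonneg_symmetricD[OF R]
  have lin: "linear R" using R'(1) by (rule bounded_linear.linear)
  have RR: "R (R v) = c *\<^sub>R v" using RQ v by (auto simp: fun_eq_iff)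
  define y where "y = R v - sqrt c *\<^sub>R v"
  have Ry: "R y = - sqrt c *\<^sub>R y"
    using c by (simp add: y_def linear_diff[OF lin] linear_scale[OF lin] RR scaleR_right_diff_distrib)
  show ?thesis
  proof (cases "c = 0")
    case True
    have "R v \<bullet> R v = v \<bullet> R (R v)" by (rule R'(2))
    then show ?thesis using True RR by simp
  next
    case False
    have "0 \<le> - (sqrt c * (y \<bullet> y))" using R'(3)[of y] Ry by simp
    moreover have "sqrt c > 0" using c False by simp
    ultimately have "y \<bullet> y \<le> 0" by (smt (verit) mult_pos_pos)
    then have "y = 0" by (metis inner_ge_zero inner_eq_zero_iff order_antisym)
    then show ?thesis by (simp add: y_def)
  qed
qed

text \<open>\<open>op_sqrt\<close> is a definite description, so uniqueness has to be proved as
  well. Every nonnegative root acts on an eigenvector of \<open>Q\<close> as the root of the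
  eigenvalue, and bounded operators that agree on an orthonormal basis are equal.\<close>

lemma op_sqrt_eqI:
  assumes R: "nonneg_symmetric R" "R \<circ> R = Q" and e: "orthonormal_basis J e"
    and eig: "\<And>j. j \<in> J \<Longrightarrow> 0 \<le> c j \<and> Q (e j) = c j *\<^sub>R e j"
  shows "op_sqrt Q = R"
  unfolding op_sqrt_def
proof (rule the_equality)
  fix R' assume R': "nonneg_symmetric R' \<and> R' \<circ> R' = Q"
  show "R' = R"
  proof (rule bounded_linear_eq_on_basis[OF _ _ e])
    show "bounded_linear R'" "bounded_linear R" using R R' nonneg_symmetricD(1) by auto
    fix j assume "j \<in> J"
    then have "R' (e j) = sqrt (c j) *\<^sub>R e j" "R (e j) = sqrt (c j) *\<^sub>R e j"
      using R R' eig by (blast intro: sqrt_eigenvector)+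
    then show "R' (e j) = R (e j)" by simp
  qed
qed (use R in auto)

lemma bessel_ineq:
  fixes e :: "'j \<Rightarrow> 'u::real_inner"
  assumes "finite K" "\<And>i j. i \<in> K \<Longrightarrow> j \<in> K \<Longrightarrow> e i \<bullet> e j = (if i = j then 1 else 0)"
  shows "(\<Sum>j\<in>K. (x \<bullet> e j)\<^sup>2) \<le> (norm x)\<^sup>2"
proof -
  let ?p = "\<Sum>j\<in>K. (x \<bullet> e j) *\<^sub>R e j"
  have 1: "x \<bullet> ?p = (\<Sum>j\<in>K. (x \<bullet> e j)\<^sup>2)"
    by (simp add: inner_sum_right power2_eq_square)
  have "?p \<bullet> ?p = (\<Sum>i\<in>K. \<Sum>j\<in>K. (x \<bullet> e i) * (x \<bullet> e j) * (e i \<bullet> e j))"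
    by (simp add: inner_sum_right inner_sum_left sum_distrib_left mult_ac inner_commute)
  also have "\<dots> = (\<Sum>i\<in>K. \<Sum>j\<in>K. if i = j then (x \<bullet> e j)\<^sup>2 else 0)"
    by (intro sum.cong refl) (auto simp: assms(2) power2_eq_square)
  also have "\<dots> = (\<Sum>j\<in>K. (x \<bullet> e j)\<^sup>2)" using assms(1) by simp
  finally have 2: "?p \<bullet> ?p = (\<Sum>j\<in>K. (x \<bullet> e j)\<^sup>2)" .
  have "0 \<le> (x - ?p) \<bullet> (x - ?p)" by simp
  also have "\<dots> = x \<bullet> x - (\<Sum>j\<in>K. (x \<bullet> e j)\<^sup>2)"
    by (simp add: inner_diff_left inner_diff_right 1 2 inner_commute[of ?p x])
  finally show ?thesis by (simp add: power2_norm_eq_inner)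
qed

lemma sum_mult_le_sqrt:
  fixes f g :: "'j \<Rightarrow> real"
  shows "(\<Sum>j\<in>K. \<bar>f j\<bar> * \<bar>g j\<bar>) \<le> sqrt (\<Sum>j\<in>K. (f j)\<^sup>2) * sqrt (\<Sum>j\<in>K. (g j)\<^sup>2)"
  using L2_set_mult_ineq[of f g K] by (simp add: L2_set_def)

text \<open>Testing the nuclear representation of \<open>Q\<close> against the \<open>e j\<close>
  writes the partial trace as a series over \<open>n\<close>; Cauchy-Schwarz and Bessel's inequality
  bound its \<open>n\<close>-th term. The bound does not see \<open>K\<close>, and this is the
  source of all uniformity in the index set.\<close>

lemma trace_bound:
  fixes e :: "'j \<Rightarrow> 'u::real_inner"
  assumes "finite K" "\<And>i j. i \<in> K \<Longrightarrow> j \<in> K \<Longrightarrow> e i \<bullet> e j = (if i = j then 1 else 0)"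
    and ab: "summable (\<lambda>n. norm (a n) * norm (b n))" "\<And>x. (\<lambda>n. (b n \<bullet> x) *\<^sub>R a n) sums Q x"
    and eig: "\<And>j. j \<in> K \<Longrightarrow> Q (e j) = \<eta> j *\<^sub>R e j"
  shows "(\<Sum>j\<in>K. \<eta> j) \<le> (\<Sum>n. norm (a n) * norm (b n))"
proof (rule sums_le[OF _ _ summable_sums[OF ab(1)]])
  have "(\<lambda>n. (b n \<bullet> e j) * (a n \<bullet> e j)) sums \<eta> j" if j: "j \<in> K" for j
  proof -
    have "(\<lambda>n. ((b n \<bullet> e j) *\<^sub>R a n) \<bullet> e j) sums (Q (e j) \<bullet> e j)"
      by (rule bounded_linear.sums[OF bounded_linear_inner_left ab(2)])
    moreover have "Q (e j) \<bullet> e j = \<eta> j" using eig[OF j] assms(2)[OF j j] by simp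
    ultimately show ?thesis by simp
  qed
  then show "(\<lambda>n. \<Sum>j\<in>K. (b n \<bullet> e j) * (a n \<bullet> e j)) sums (\<Sum>j\<in>K. \<eta> j)"
    by (rule sums_sum)
  fix n
  have "(\<Sum>j\<in>K. (b n \<bullet> e j) * (a n \<bullet> e j)) \<le> (\<Sum>j\<in>K. \<bar>b n \<bullet> e j\<bar> * \<bar>a n \<bullet> e j\<bar>)"
    by (intro sum_mono) (metis abs_ge_self abs_mult)
  also have "\<dots> \<le> sqrt (\<Sum>j\<in>K. (b n \<bullet> e j)\<^sup>2) * sqrt (\<Sum>j\<in>K. (a n \<bullet> e j)\<^sup>2)"
    by (rule sum_mult_le_sqrt)
  also have "\<dots> \<le> norm (b n) * norm (a n)"
    by (intro mult_mono real_le_lsqrt) (auto intro: bessel_ineq assms sum_nonneg)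
  finally show "(\<Sum>j\<in>K. (b n \<bullet> e j) * (a n \<bullet> e j)) \<le> norm (a n) * norm (b n)" by (simp add: mult.commute)
qed

text \<open>The root is the diagonal operator with entries \<open>sqrt (c j)\<close>. The bound
  \<open>B\<close> makes these entries square summable, so the defining series converges absolutely
  by Cauchy-Schwarz and Bessel's inequality and can be summed over \<open>J\<close> without an
  enumeration.\<close>

lemma op_sqrt_diagonal:
  fixes e :: "'j \<Rightarrow> 'u::{real_inner, banach}"
  assumes Q: "bounded_linear Q" and e: "orthonormal_basis J e"
    and eig: "\<And>j. j \<in> J \<Longrightarrow> 0 \<le> c j \<and> Q (e j) = c j *\<^sub>R e j"
    and B: "\<And>K. finite K \<Longrightarrow> K \<subseteq> J \<Longrightarrow> (\<Sum>j\<in>K. c j) \<le> B"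
  shows "nonneg_symmetric (op_sqrt Q)" "op_sqrt Q \<circ> op_sqrt Q = Q"
    "j \<in> J \<Longrightarrow> op_sqrt Q (e j) = sqrt (c j) *\<^sub>R e j"
proof -
  define f where "f x j = (sqrt (c j) * (x \<bullet> e j)) *\<^sub>R e j" for x j
  have on: "e i \<bullet> e j = (if i = j then 1 else 0)" if "i \<in> J" "j \<in> J" for i j
    using e that by (auto simp: orthonormal_basis_def)
  have norm_e: "norm (e j) = 1" if "j \<in> J" for j using on[OF that that] by (simp add: norm_eq_sqrt_inner)
  have B0: "0 \<le> B" using B[of "{}"] by simp
  have fin: "(\<Sum>j\<in>K. norm (f x j)) \<le> sqrt B * norm x" if K: "finite K" "K \<subseteq> J" for K x
  proof -
    have "(\<Sum>j\<in>K. norm (f x j)) = (\<Sum>j\<in>K. \<bar>sqrt (c j)\<bar> * \<bar>x \<bullet> e j\<bar>)"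
      using K norm_e by (intro sum.cong) (auto simp: f_def abs_mult)
    also have "\<dots> \<le> sqrt (\<Sum>j\<in>K. (sqrt (c j))\<^sup>2) * sqrt (\<Sum>j\<in>K. (x \<bullet> e j)\<^sup>2)"
      by (rule sum_mult_le_sqrt)
    also have "(\<Sum>j\<in>K. (sqrt (c j))\<^sup>2) = (\<Sum>j\<in>K. c j)"
      using K eig by (intro sum.cong) auto
    also have "sqrt (\<Sum>j\<in>K. c j) * sqrt (\<Sum>j\<in>K. (x \<bullet> e j)\<^sup>2) \<le> sqrt B * norm x"
      using B[OF K] K on by (intro mult_mono real_sqrt_le_mono real_le_lsqrt) (auto intro!: bessel_ineq sum_nonneg simp: subset_iff B0)
    finally show ?thesis .
  qed
  have abs: "f x abs_summable_on J" for x
    by (rule nonneg_bounded_partial_sums_imp_summable_on[where C = "sqrt B * norm x"])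
      (auto intro!: eventually_finite_subsets_at_top_weakI fin)
  then have summ: "f x summable_on J" for x by (rule abs_summable_summable)
  define R where "R x = infsum (f x) J" for x
  have add: "R (x + y) = R x + R y" for x y
    unfolding R_def infsum_add[OF summ summ, symmetric]
    by (intro infsum_cong) (simp add: f_def inner_add_left distrib_left scaleR_left_distrib)
  have scale: "R (r *\<^sub>R x) = r *\<^sub>R R x" for r x
  proof -
    have "R (r *\<^sub>R x) = infsum (\<lambda>j. r *\<^sub>R f x j) J" unfolding R_def f_def by (simp add: mult_ac)
    then show ?thesis by (simp add: R_def infsum_scaleR_right)
  qed
  have "norm (R x) \<le> norm x * sqrt B" for x
  proof -
    have "norm (R x) \<le> infsum (\<lambda>j. norm (f x j)) J" unfolding R_def by (rule norm_infsum_bound[OF abs])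
    also have "\<dots> \<le> sqrt B * norm x" by (rule infsum_le_finite_sums[OF abs fin])
    finally show ?thesis by (simp add: mult.commute)
  qed
  then have bl: "bounded_linear R" by (intro bounded_linear_intro[where K = "sqrt B"] add scale)
  have inner: "R x \<bullet> y = infsum (\<lambda>j. sqrt (c j) * (x \<bullet> e j) * (y \<bullet> e j)) J" for x y
  proof -
    have "(f x has_sum R x) J" unfolding R_def by (rule has_sum_infsum[OF summ])
    from has_sum_bounded_linear[OF bounded_linear_inner_left[of y] this]
    have "((\<lambda>j. sqrt (c j) * (x \<bullet> e j) * (y \<bullet> e j)) has_sum R x \<bullet> y) J"
      by (simp add: f_def inner_commute[of y])
    then show ?thesis by (simp add: infsumI)
  qed
  have ns: "nonneg_symmetric R"
    unfolding nonneg_symmetric_def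
  proof (intro conjI allI bl)
    show "R x \<bullet> y = x \<bullet> R y" for x y
      by (simp add: inner inner_commute[of x "R y"] mult_ac)
    show "0 \<le> R x \<bullet> x" for x
      unfolding inner using eig by (intro infsum_nonneg) (auto simp: mult.assoc)
  qed
  have Re: "R (e j) = sqrt (c j) *\<^sub>R e j" if j: "j \<in> J" for j
  proof -
    have "R (e j) = infsum (f (e j)) {j}"
      unfolding R_def by (intro infsum_cong_neutral) (use j on in \<open>auto simp: f_def\<close>)
    then show ?thesis using on[OF j j] by (simp add: f_def)
  qed
  have RR: "R \<circ> R = Q"
  proof (rule bounded_linear_eq_on_basis[OF _ Q e])
    show "bounded_linear (R \<circ> R)" unfolding o_def by (rule bounded_linear_compose[OF bl bl])
    show "(R \<circ> R) (e j) = Q (e j)" if "j \<in> J" for j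
      using that eig[OF that] by (simp add: Re scale)
  qed
  have "op_sqrt Q = R" by (rule op_sqrt_eqI[OF ns RR e eig])
  then show "nonneg_symmetric (op_sqrt Q)" "op_sqrt Q \<circ> op_sqrt Q = Q"
    "j \<in> J \<Longrightarrow> op_sqrt Q (e j) = sqrt (c j) *\<^sub>R e j"
    using ns RR Re by auto
qed

lemma op_sqrt_proj_cov:
  fixes e :: "'j \<Rightarrow> 'u::{real_inner, banach}"
  assumes e: "orthonormal_basis J e" and K: "finite K" "K \<subseteq> J" and eta: "\<And>j. j \<in> K \<Longrightarrow> 0 \<le> \<eta> j"
  shows "op_sqrt (proj_cov e \<eta> K) x = (\<Sum>j\<in>K. (sqrt (\<eta> j) * (x \<bullet> e j)) *\<^sub>R e j)"
proof -
  define R where "R x = (\<Sum>j\<in>K. (sqrt (\<eta> j) * (x \<bullet> e j)) *\<^sub>R e j)" for x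
  have on: "e i \<bullet> e j = (if i = j then 1 else 0)" if "i \<in> J" "j \<in> J" for i j
    using e that by (auto simp: orthonormal_basis_def)
  have coord: "R x \<bullet> e j = sqrt (\<eta> j) * (x \<bullet> e j)" if "j \<in> K" for x j
  proof -
    have "R x \<bullet> e j = (\<Sum>i\<in>K. if i = j then sqrt (\<eta> j) * (x \<bullet> e j) else 0)"
      unfolding R_def inner_sum_left using K that by (intro sum.cong refl) (auto simp: on subset_iff)
    then show ?thesis using K that by simp
  qed
  have "op_sqrt (proj_cov e \<eta> K) = R"
  proof (rule op_sqrt_eqI[OF _ _ e])
    show "nonneg_symmetric R"
      unfolding nonneg_symmetric_def
    proof (intro conjI allI)
      show "bounded_linear R" unfolding R_def
        by (intro bounded_linear_sum bounded_linear_compose[OF bounded_linear_scaleR_left]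
            bounded_linear_compose[OF bounded_linear_mult_right] bounded_linear_inner_left)
      show "R x \<bullet> y = x \<bullet> R y" for x y
        by (simp add: R_def inner_sum_left inner_sum_right inner_commute mult_ac)
      show "0 \<le> R x \<bullet> x" for x
        unfolding R_def inner_sum_left using eta by (auto intro!: sum_nonneg simp: inner_commute mult.assoc)
    qed
    show "R \<circ> R = proj_cov e \<eta> K"
    proof
      fix x
      have "(R \<circ> R) x = (\<Sum>j\<in>K. (sqrt (\<eta> j) * (R x \<bullet> e j)) *\<^sub>R e j)" by (simp add: R_def)
      also have "\<dots> = proj_cov e \<eta> K x"
        unfolding proj_cov_def by (intro sum.cong refl) (simp add: coord eta flip: mult.assoc)
      finally show "(R \<circ> R) x = proj_cov e \<eta> K x" .
    qed
    fix j assume j: "j \<in> J"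
    have "proj_cov e \<eta> K (e j) = (\<Sum>i\<in>K. if i = j then \<eta> j *\<^sub>R e j else 0)"
      unfolding proj_cov_def using j K by (intro sum.cong refl) (auto simp: on subset_iff)
    \<comment> \<open>Uniqueness of the root is tested on the whole basis; the directions outside
      \<open>K\<close> are eigenvectors with eigenvalue 0.\<close>
    then show "0 \<le> (if j \<in> K then \<eta> j else 0) \<and> proj_cov e \<eta> K (e j) = (if j \<in> K then \<eta> j else 0) *\<^sub>R e j"
      using K eta by auto
  qed
  then show ?thesis by (simp add: R_def)
qed

section \<open>Increments of the Wiener process and the Ito isometry\<close>

definition L2_on :: "'a measure \<Rightarrow> 'a measure \<Rightarrow> ('a \<Rightarrow> 'b::real_normed_vector) \<Rightarrow> bool" where
  "L2_on M G f \<longleftrightarrow> f \<in> borel_measurable G \<and> integrable M (\<lambda>x. (norm (f x))\<^sup>2)"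

lemma norm_add_sq_le:
  fixes x y :: "'b::real_normed_vector"
  shows "(norm (x + y))\<^sup>2 \<le> 2 * (norm x)\<^sup>2 + 2 * (norm y)\<^sup>2"
proof -
  have "(norm (x + y))\<^sup>2 \<le> (norm x + norm y)\<^sup>2" by (intro power_mono norm_triangle_ineq) auto
  also have "\<dots> \<le> 2 * (norm x)\<^sup>2 + 2 * (norm y)\<^sup>2"
    using zero_le_power2[of "norm x - norm y"] by (simp add: power2_sum power2_diff)
  finally show ?thesis .
qed

abbreviation mean_sq :: "'a measure \<Rightarrow> ('a \<Rightarrow> 'b::real_normed_vector) \<Rightarrow> ennreal" where
  "mean_sq M f \<equiv> \<integral>\<^sup>+ \<omega>. ennreal ((norm (f \<omega>))\<^sup>2) \<partial>M"

lemma L2_on_measurable_subalg: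
  assumes "subalgebra M G" "L2_on M G f"
  shows "f \<in> borel_measurable M"
  using assms measurable_from_subalg by (auto simp: L2_on_def)

lemma L2_on_mono:
  assumes "subalgebra G' G" "L2_on M G f"
  shows "L2_on M G' f"
  using assms measurable_from_subalg by (auto simp: L2_on_def)

section \<open>Square integrable variables over a sub-sigma-algebra\<close>

context
  fixes M G :: "'a measure"
  assumes sub: "subalgebra M G"
begin

lemma L2_on_add:
  fixes f g :: "'a \<Rightarrow> 'b::{real_normed_vector, second_countable_topology}"
  assumes "L2_on M G f" "L2_on M G g"
  shows "L2_on M G (\<lambda>x. f x + g x)"
proof -
  note [measurable] = assms[THEN L2_on_measurable_subalg[OF sub]]
  have "integrable M (\<lambda>x. (norm (f x + g x))\<^sup>2)"
  proof (rule Bochner_Integration.integrable_bound)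
    show "integrable M (\<lambda>x. 2 * (norm (f x))\<^sup>2 + 2 * (norm (g x))\<^sup>2)"
      using assms by (auto simp: L2_on_def)
    show "AE x in M. norm ((norm (f x + g x))\<^sup>2) \<le> norm (2 * (norm (f x))\<^sup>2 + 2 * (norm (g x))\<^sup>2)"
      using norm_add_sq_le by auto
  qed simp
  then show ?thesis using assms by (auto simp: L2_on_def)
qed

lemma L2_on_scaleR:
  fixes f :: "'a \<Rightarrow> 'b::{real_normed_vector, second_countable_topology}"
  assumes "L2_on M G f"
  shows "L2_on M G (\<lambda>x. c *\<^sub>R f x)"
  using assms by (auto simp: L2_on_def power_mult_distrib)

lemma L2_on_zero: "L2_on M G (\<lambda>x. 0)"
  by (simp add: L2_on_def)

lemma L2_on_minus:
  fixes f :: "'a \<Rightarrow> 'b::{real_normed_vector, second_countable_topology}"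
  assumes "L2_on M G f"
  shows "L2_on M G (\<lambda>x. - f x)"
  using assms by (auto simp: L2_on_def)

lemma L2_on_diff:
  fixes f g :: "'a \<Rightarrow> 'b::{real_normed_vector, second_countable_topology}"
  assumes "L2_on M G f" "L2_on M G g"
  shows "L2_on M G (\<lambda>x. f x - g x)"
  using L2_on_add[OF assms(1) L2_on_minus[OF assms(2)]] by simp

lemma L2_on_sum:
  fixes f :: "'i \<Rightarrow> 'a \<Rightarrow> 'b::{real_normed_vector, second_countable_topology}"
  assumes "\<And>i. i \<in> I \<Longrightarrow> L2_on M G (f i)"
  shows "L2_on M G (\<lambda>x. \<Sum>i\<in>I. f i x)"
  using assms by (induction I rule: infinite_finite_induct) (auto simp: L2_on_zero intro: L2_on_add)

lemma L2_on_scaleR_left: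
  fixes f :: "'a \<Rightarrow> real" and v :: "'b::{real_normed_vector, second_countable_topology}"
  assumes "L2_on M G f"
  shows "L2_on M G (\<lambda>x. f x *\<^sub>R v)"
  using assms by (auto simp: L2_on_def power_mult_distrib)

lemma L2_on_inner:
  fixes f g :: "'a \<Rightarrow> 'b::{real_inner, second_countable_topology}"
  assumes "L2_on M G f" "L2_on M G g"
  shows "integrable M (\<lambda>x. f x \<bullet> g x)"
proof (rule Bochner_Integration.integrable_bound)
  note [measurable] = assms[THEN L2_on_measurable_subalg[OF sub]]
  show "integrable M (\<lambda>x. (norm (f x))\<^sup>2 + (norm (g x))\<^sup>2)"
    using assms by (auto simp: L2_on_def)
  show "(\<lambda>x. f x \<bullet> g x) \<in> borel_measurable M" by measurable
  show "AE x in M. norm (f x \<bullet> g x) \<le> norm ((norm (f x))\<^sup>2 + (norm (g x))\<^sup>2)"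
  proof (intro AE_I2)
    fix x
    have "\<bar>f x \<bullet> g x\<bar> \<le> norm (f x) * norm (g x)" by (rule Cauchy_Schwarz_ineq2)
    also have "\<dots> \<le> (norm (f x))\<^sup>2 + (norm (g x))\<^sup>2"
      using zero_le_power2[of "norm (f x) - norm (g x)"] zero_le_power2[of "norm (f x) + norm (g x)"]
      unfolding power2_diff power2_sum by linarith
    finally show "norm (f x \<bullet> g x) \<le> norm ((norm (f x))\<^sup>2 + (norm (g x))\<^sup>2)" by simp
  qed
qed

end

text \<open>The fourth moment serves for the variance of squared increments in the quadratic
  variation. Zero variance is a case of its own, since \<open>normal_law\<close> is then a point
  mass and has no density.\<close>

lemma normal_law_moments:
  assumes [measurable]: "X \<in> borel_measurable M" and M: "prob_space M"
    and d: "distr M borel X = normal_law 0 v" and v: "0 \<le> v"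
  shows "has_bochner_integral M X 0"
    and "has_bochner_integral M (\<lambda>\<omega>. (X \<omega>)\<^sup>2) v"
    and "has_bochner_integral M (\<lambda>\<omega>. X \<omega> ^ 4) (3 * v\<^sup>2)"
proof -
  have tr: "has_bochner_integral M (\<lambda>\<omega>. g (X \<omega>)) c"
    if [measurable]: "g \<in> borel_measurable borel" and "has_bochner_integral (normal_law 0 v) g c" for g :: "real \<Rightarrow> real" and c
    using that(2) unfolding d[symmetric] has_bochner_integral_iff
    by (simp add: integrable_distr_eq integral_distr)
  have law: "has_bochner_integral (normal_law 0 v) (\<lambda>x. x) 0 \<and>
      has_bochner_integral (normal_law 0 v) (\<lambda>x. x\<^sup>2) v \<and>
      has_bochner_integral (normal_law 0 v) (\<lambda>x. x ^ 4) (3 * v\<^sup>2)"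
  proof (cases "v = 0")
    case True
    have zero: "has_bochner_integral (return borel 0) g 0"
      if [measurable]: "g \<in> borel_measurable borel" and "g 0 = 0" for g :: "real \<Rightarrow> real"
    proof -
      have [measurable]: "g \<in> borel_measurable (return borel 0)" by simp
      have "AE x in return borel (0::real). g x = 0"
        using that(2) by (subst AE_return) auto
      then show ?thesis
        by (intro has_bochner_integralI_AE[OF has_bochner_integral_zero]) auto
    qed
    show ?thesis
      unfolding True normal_law_def by (auto intro!: zero)
  next
    case False
    then have s: "0 < sqrt v" using v by simp
    have dens: "has_bochner_integral (normal_law 0 v) g c"
      if [measurable]: "g \<in> borel_measurable borel"
        and "has_bochner_integral lborel (\<lambda>x. normal_density 0 (sqrt v) x * g x) c" for g c
      using that(2) False unfolding normal_law_def
      by (auto intro!: has_bochner_integral_density)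
    have "fact 4 = (24 :: real)" by (simp add: eval_nat_numeral)
    then have m4: "fact (2 * 2) / ((2 / (sqrt v)\<^sup>2) ^ 2 * fact 2) = 3 * v\<^sup>2"
      using v False by (simp add: power_divide field_simps)
    have m2: "fact (2 * 1) / ((2 / (sqrt v)\<^sup>2) ^ 1 * fact 1) = v"
      using v by simp
    show ?thesis
      using normal_moment_odd[OF s, of 0 0] normal_moment_even[OF s, of 0 1, unfolded m2]
        normal_moment_even[OF s, of 0 2, unfolded m4]
      by (auto intro!: dens)
  qed
  show "has_bochner_integral M X 0" by (rule tr[of "\<lambda>x. x"]) (use law in auto)
  show "has_bochner_integral M (\<lambda>\<omega>. (X \<omega>)\<^sup>2) v" by (rule tr[of "\<lambda>x. x\<^sup>2"]) (use law in auto)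
  show "has_bochner_integral M (\<lambda>\<omega>. X \<omega> ^ 4) (3 * v\<^sup>2)" by (rule tr[of "\<lambda>x. x ^ 4"]) (use law in auto)
qed

locale filtered_wiener =
  fixes M :: "'a measure" and F :: "real \<Rightarrow> 'a measure"
    and Q :: "'u::{real_inner, banach, second_countable_topology} \<Rightarrow> 'u" and W :: "real \<Rightarrow> 'a \<Rightarrow> 'u"
  assumes filtered: "filtered_prob_space M F"
    and wiener: "Q_Wiener_process_wrt M F Q W"
    and nonneg: "nonneg_symmetric Q"

sublocale filtered_wiener \<subseteq> prob_space M
  using filtered by (simp add: filtered_prob_space_def)

section \<open>Moments and orthogonality of the increments\<close>

context filtered_wiener
begin

definition incr :: "real \<Rightarrow> real \<Rightarrow> 'a \<Rightarrow> 'u" where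
  "incr s t \<omega> = W t \<omega> - W s \<omega>"

lemma subalg: "0 \<le> t \<Longrightarrow> subalgebra M (F t)"
  and subalg_F: "0 \<le> s \<Longrightarrow> s \<le> t \<Longrightarrow> subalgebra (F t) (F s)"
  using filtered by (auto simp: filtered_prob_space_def)

lemma space_F: "0 \<le> t \<Longrightarrow> space (F t) = space M"
  using subalg by (auto simp: subalgebra_def)

lemma W_measurable_F: "0 \<le> t \<Longrightarrow> W t \<in> borel_measurable (F t)"
  using wiener by (auto simp: Q_Wiener_process_wrt_def)

lemma incr_measurable_F: "0 \<le> s \<Longrightarrow> s \<le> t \<Longrightarrow> incr s t \<in> borel_measurable (F t)"
  unfolding incr_def
  by (intro borel_measurable_diff W_measurable_F measurable_from_subalg[OF subalg_F W_measurable_F]) auto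

lemma incr_measurable: "0 \<le> s \<Longrightarrow> s \<le> t \<Longrightarrow> incr s t \<in> borel_measurable M"
  using incr_measurable_F measurable_from_subalg subalg by (meson order_trans)

lemma incr_add: "incr s t \<omega> + incr t r \<omega> = incr s r \<omega>"
  by (simp add: incr_def)

lemma incr_self: "incr s s \<omega> = 0"
  by (simp add: incr_def)

text \<open>The Wiener process provides independence of \<open>F s\<close> and the sigma-algebra of
  the increment. Those generated by \<open>Y\<close> and by \<open>g\<close> of the increment are
  smaller, so the expectation factorises; \<open>has_bochner_integral\<close> carries the
  integrability along with the value.\<close>

lemma indep_mult:
  fixes Y :: "'a \<Rightarrow> real" and g :: "'u \<Rightarrow> real"
  assumes st: "0 \<le> s" "s \<le> t" and Y: "Y \<in> borel_measurable (F s)" "has_bochner_integral M Y y"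
    and g [measurable]: "g \<in> borel_measurable borel" and G: "has_bochner_integral M (\<lambda>\<omega>. g (incr s t \<omega>)) z"
  shows "has_bochner_integral M (\<lambda>\<omega>. Y \<omega> * g (incr s t \<omega>)) (y * z)"
proof -
  let ?V = "vimage_algebra (space M) (incr s t) borel"
  have ind: "indep_set (sets (F s)) (sets ?V)"
    using wiener st unfolding Q_Wiener_process_wrt_def incr_def by simp
  have [measurable]: "Y \<in> borel_measurable M" using Y(1) subalg[OF st(1)] measurable_from_subalg by blast
  have [measurable]: "incr s t \<in> borel_measurable M" using st by (rule incr_measurable)
  have V: "(\<lambda>\<omega>. g (incr s t \<omega>)) \<in> borel_measurable ?V"
    by (rule measurable_compose[OF measurable_vimage_algebra1 g]) auto
  have 1: "sigma_sets (space M) {Y -` A \<inter> space M |A. A \<in> sets borel} \<subseteq> sets (F s)"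
    unfolding space_F[OF st(1), symmetric]
    by (rule sets.sigma_sets_subset) (use Y(1) in \<open>auto intro: measurable_sets\<close>)
  have 2: "sigma_sets (space M) {(\<lambda>\<omega>. g (incr s t \<omega>)) -` A \<inter> space M |A. A \<in> sets borel} \<subseteq> sets ?V"
    using V by (subst (1 2) space_vimage_algebra[symmetric, of "space M" "incr s t" borel], intro sets.sigma_sets_subset)
      (auto dest: measurable_sets)
  have "indep_var borel Y borel (\<lambda>\<omega>. g (incr s t \<omega>))"
    unfolding indep_var_eq
  proof (intro conjI)
    show "indep_set (sigma_sets (space M) {Y -` A \<inter> space M |A. A \<in> sets borel})
       (sigma_sets (space M) {(\<lambda>\<omega>. g (incr s t \<omega>)) -` A \<inter> space M |A. A \<in> sets borel})"
      using ind unfolding indep_set_def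
      by (rule indep_sets_mono_sets) (use 1 2 in \<open>auto split: bool.split\<close>)
  qed measurable
  then show ?thesis
    using Y(2) G indep_var_integrable[of Y] indep_var_lebesgue_integral[of Y]
    by (auto simp: has_bochner_integral_iff)
qed

lemma Q_nonneg: "0 \<le> Q v \<bullet> v"
  using nonneg by (rule nonneg_symmetricD)

lemma incr_moments:
  assumes "0 \<le> s" "s \<le> t"
  shows "has_bochner_integral M (\<lambda>\<omega>. incr s t \<omega> \<bullet> v) 0"
    and "has_bochner_integral M (\<lambda>\<omega>. (incr s t \<omega> \<bullet> v)\<^sup>2) ((t - s) * (Q v \<bullet> v))"
    and "has_bochner_integral M (\<lambda>\<omega>. (incr s t \<omega> \<bullet> v) ^ 4) (3 * ((t - s) * (Q v \<bullet> v))\<^sup>2)"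
proof -
  have [measurable]: "incr s t \<in> borel_measurable M" using assms by (rule incr_measurable)
  have d: "distr M borel (\<lambda>\<omega>. incr s t \<omega> \<bullet> v) = normal_law 0 ((t - s) * (Q v \<bullet> v))"
    using wiener assms unfolding Q_Wiener_process_wrt_def Q_Wiener_process_def centred_gaussian_def incr_def
    by blast
  have nn: "0 \<le> (t - s) * (Q v \<bullet> v)" using assms Q_nonneg by simp
  have meas: "(\<lambda>\<omega>. incr s t \<omega> \<bullet> v) \<in> borel_measurable M" by measurable
  show "has_bochner_integral M (\<lambda>\<omega>. incr s t \<omega> \<bullet> v) 0"
    "has_bochner_integral M (\<lambda>\<omega>. (incr s t \<omega> \<bullet> v)\<^sup>2) ((t - s) * (Q v \<bullet> v))"
    "has_bochner_integral M (\<lambda>\<omega>. (incr s t \<omega> \<bullet> v) ^ 4) (3 * ((t - s) * (Q v \<bullet> v))\<^sup>2)"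
    using normal_law_moments[OF meas prob_space_axioms d nn] .
qed

text \<open>\<open>centred_gaussian\<close> fixes only the laws of one-dimensional projections, so
  mixed moments are obtained by polarisation from the directions \<open>u + v\<close> and
  \<open>u - v\<close>.\<close>

lemma incr_cov:
  assumes "0 \<le> s" "s \<le> t"
  shows "has_bochner_integral M (\<lambda>\<omega>. (incr s t \<omega> \<bullet> u) * (incr s t \<omega> \<bullet> v)) ((t - s) * (Q u \<bullet> v))"
proof -
  note Q = nonneg_symmetricD[OF nonneg]
  have lin: "linear Q" using Q(1) by (rule bounded_linear.linear)
  have "has_bochner_integral M (\<lambda>\<omega>. 1/4 * ((incr s t \<omega> \<bullet> (u + v))\<^sup>2 - (incr s t \<omega> \<bullet> (u - v))\<^sup>2))
     (1/4 * ((t - s) * (Q (u + v) \<bullet> (u + v)) - (t - s) * (Q (u - v) \<bullet> (u - v))))"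
    by (intro has_bochner_integral_mult_right has_bochner_integral_diff incr_moments assms)
  moreover have "1/4 * ((t - s) * (Q (u + v) \<bullet> (u + v)) - (t - s) * (Q (u - v) \<bullet> (u - v))) = (t - s) * (Q u \<bullet> v)"
    using Q(2)[of v u] by (simp add: linear_add[OF lin] linear_diff[OF lin] inner_add_left inner_add_right
        inner_diff_left inner_diff_right inner_commute[of v "Q u"] algebra_simps)
  moreover have "1/4 * ((incr s t \<omega> \<bullet> (u + v))\<^sup>2 - (incr s t \<omega> \<bullet> (u - v))\<^sup>2) = (incr s t \<omega> \<bullet> u) * (incr s t \<omega> \<bullet> v)" for \<omega>
    by (simp add: inner_add_right inner_diff_right power2_sum power2_diff)
  ultimately show ?thesis by simp
qed

lemma L2_on_incr:
  assumes "0 \<le> s" "s \<le> t"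
  shows "L2_on M (F t) (\<lambda>\<omega>. incr s t \<omega> \<bullet> v)"
  using incr_moments(2)[OF assms, of v] incr_measurable_F[OF assms]
  by (auto simp: L2_on_def has_bochner_integral_iff)

text \<open>A product of two square integrable variables is in general only integrable. Here
  \<open>\<xi>\<close> is known at time \<open>s\<close>, hence independent of the increment, and
  the second moment factorises.\<close>

lemma L2_on_incr_scaleR:
  fixes \<xi> :: "'a \<Rightarrow> 'h::{real_inner, banach, second_countable_topology}"
  assumes st: "0 \<le> s" "s \<le> t" and \<xi>: "L2_on M (F s) \<xi>"
  shows "L2_on M (F t) (\<lambda>\<omega>. (incr s t \<omega> \<bullet> v) *\<^sub>R \<xi> \<omega>)"
proof -
  have [measurable]: "\<xi> \<in> borel_measurable (F s)" using \<xi> by (simp add: L2_on_def)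
  have [measurable]: "\<xi> \<in> borel_measurable (F t)" using \<xi> L2_on_mono[OF subalg_F[OF st]] L2_on_def by blast
  have [measurable]: "incr s t \<in> borel_measurable (F t)" using st by (rule incr_measurable_F)
  have "has_bochner_integral M (\<lambda>\<omega>. (norm (\<xi> \<omega>))\<^sup>2 * (incr s t \<omega> \<bullet> v)\<^sup>2)
      (integral\<^sup>L M (\<lambda>\<omega>. (norm (\<xi> \<omega>))\<^sup>2) * ((t - s) * (Q v \<bullet> v)))"
    using \<xi> by (intro indep_mult[OF st, where g = "\<lambda>x. (x \<bullet> v)\<^sup>2"] has_bochner_integral_integrable incr_moments st)
      (auto simp: L2_on_def)
  then have "integrable M (\<lambda>\<omega>. (norm ((incr s t \<omega> \<bullet> v) *\<^sub>R \<xi> \<omega>))\<^sup>2)"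
    by (simp add: has_bochner_integral_iff power_mult_distrib mult.commute)
  then show ?thesis by (simp add: L2_on_def)
qed

lemma incr_orthogonal:
  assumes "0 \<le> s" "s \<le> t" "p \<in> borel_measurable (F s)" "integrable M p"
  shows "has_bochner_integral M (\<lambda>\<omega>. p \<omega> * (incr s t \<omega> \<bullet> v)) 0"
  using indep_mult[OF assms(1-3) has_bochner_integral_integrable[OF assms(4)], of "\<lambda>x. x \<bullet> v" 0]
    incr_moments(1)[OF assms(1,2)] by simp

text \<open>The intervals are cut at each other's endpoints; over two disjoint parts, the later increment is
  orthogonal to the past. Since any two intervals are allowed, no common refinement of partitions is
  needed later.\<close>

lemma incr_product_ordered:
  fixes \<xi> \<zeta> :: "'a \<Rightarrow> 'h::{real_inner, banach, second_countable_topology}"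
  assumes ac: "0 \<le> a" "a \<le> b" "a \<le> c" "c \<le> d"
    and \<xi>: "L2_on M (F a) \<xi>" and \<zeta>: "L2_on M (F c) \<zeta>"
  shows "has_bochner_integral M (\<lambda>\<omega>. (incr a b \<omega> \<bullet> u) * (incr c d \<omega> \<bullet> v) * (\<xi> \<omega> \<bullet> \<zeta> \<omega>))
     (max 0 (min b d - max a c) * (Q u \<bullet> v) * (\<integral>\<omega>. \<xi> \<omega> \<bullet> \<zeta> \<omega> \<partial>M))"
proof -
  have inner_F: "(\<lambda>\<omega>. f \<omega> \<bullet> g \<omega>) \<in> borel_measurable (F s) \<and> integrable M (\<lambda>\<omega>. f \<omega> \<bullet> g \<omega>)"
    if "0 \<le> s" "L2_on M (F s) f" "L2_on M (F s) g" for s and f g :: "'a \<Rightarrow> 'h"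
    using that L2_on_inner[OF subalg] by (auto simp: L2_on_def intro!: borel_measurable_inner)
  have lift: "L2_on M (F t) f" if "0 \<le> s" "s \<le> t" "L2_on M (F s) f" for s t and f :: "'a \<Rightarrow> 'h"
    using that L2_on_mono[OF subalg_F] by blast
  show ?thesis
  proof (cases "b \<le> c")
    case True
    have "L2_on M (F c) (\<lambda>\<omega>. (incr a b \<omega> \<bullet> u) *\<^sub>R \<xi> \<omega>)"
      using ac True by (intro lift[of b c] L2_on_incr_scaleR \<xi>) auto
    from inner_F[OF _ this \<zeta>] have "has_bochner_integral M
        (\<lambda>\<omega>. (((incr a b \<omega> \<bullet> u) *\<^sub>R \<xi> \<omega>) \<bullet> \<zeta> \<omega>) * (incr c d \<omega> \<bullet> v)) 0"
      using ac by (intro incr_orthogonal) auto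
    then show ?thesis using True ac by (simp add: mult_ac)
  next
    case False
    define m where "m = min b d"
    have m: "c \<le> m" "m \<le> b" "m \<le> d" "m = b \<or> m = d" "0 \<le> c" "0 \<le> m" "a \<le> m"
      using False ac by (auto simp: m_def)
    have \<xi>c: "L2_on M (F c) \<xi>" using lift[OF _ _ \<xi>] ac by auto
    note E = inner_F[OF m(5) \<xi>c \<zeta>]
    have L1: "L2_on M (F c) (\<lambda>\<omega>. (incr a c \<omega> \<bullet> u) *\<^sub>R \<xi> \<omega>)"
      using ac by (intro L2_on_incr_scaleR \<xi>) auto
    have i1: "has_bochner_integral M (\<lambda>\<omega>. (((incr a c \<omega> \<bullet> u) *\<^sub>R \<xi> \<omega>) \<bullet> \<zeta> \<omega>) * (incr c d \<omega> \<bullet> v)) 0"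
      using inner_F[OF m(5) L1 \<zeta>] ac m by (intro incr_orthogonal) auto
    have i2: "has_bochner_integral M (\<lambda>\<omega>. (\<xi> \<omega> \<bullet> \<zeta> \<omega>) * ((incr c m \<omega> \<bullet> u) * (incr c m \<omega> \<bullet> v)))
        ((\<integral>\<omega>. \<xi> \<omega> \<bullet> \<zeta> \<omega> \<partial>M) * ((m - c) * (Q u \<bullet> v)))"
      using E m by (intro indep_mult[where g = "\<lambda>x. (x \<bullet> u) * (x \<bullet> v)"] incr_cov has_bochner_integral_integrable) auto
    have L3: "L2_on M (F m) (\<lambda>\<omega>. (incr c m \<omega> \<bullet> u) *\<^sub>R \<xi> \<omega>)" "L2_on M (F m) (\<lambda>\<omega>. (incr c m \<omega> \<bullet> v) *\<^sub>R \<zeta> \<omega>)"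
      using m by (auto intro!: L2_on_incr_scaleR \<xi>c \<zeta>)
    have Lm: "L2_on M (F m) \<xi>" "L2_on M (F m) \<zeta>" using lift m \<xi>c \<zeta> by blast+
    have i3: "has_bochner_integral M (\<lambda>\<omega>. (((incr c m \<omega> \<bullet> u) *\<^sub>R \<xi> \<omega>) \<bullet> \<zeta> \<omega>) * (incr m d \<omega> \<bullet> v)) 0"
      using inner_F[OF m(6) L3(1) Lm(2)] m by (intro incr_orthogonal) auto
    have i4: "has_bochner_integral M (\<lambda>\<omega>. (\<xi> \<omega> \<bullet> ((incr c m \<omega> \<bullet> v) *\<^sub>R \<zeta> \<omega>)) * (incr m b \<omega> \<bullet> u)) 0"
      using inner_F[OF m(6) Lm(1) L3(2)] m by (intro incr_orthogonal) auto
    \<comment> \<open>Of the four parts only the second, where both increments run over the common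
      interval from \<open>c\<close> to \<open>m\<close>, can have a nonzero mean. In each of the
      others one increment is later than all the other factors.\<close>
    have expand: "(incr a b \<omega> \<bullet> u) * (incr c d \<omega> \<bullet> v) * (\<xi> \<omega> \<bullet> \<zeta> \<omega>) =
       (((incr a c \<omega> \<bullet> u) *\<^sub>R \<xi> \<omega>) \<bullet> \<zeta> \<omega>) * (incr c d \<omega> \<bullet> v)
       + (\<xi> \<omega> \<bullet> \<zeta> \<omega>) * ((incr c m \<omega> \<bullet> u) * (incr c m \<omega> \<bullet> v))
       + (((incr c m \<omega> \<bullet> u) *\<^sub>R \<xi> \<omega>) \<bullet> \<zeta> \<omega>) * (incr m d \<omega> \<bullet> v)
       + (\<xi> \<omega> \<bullet> ((incr c m \<omega> \<bullet> v) *\<^sub>R \<zeta> \<omega>)) * (incr m b \<omega> \<bullet> u)" for \<omega>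
    proof -
      have "incr a b \<omega> = incr a c \<omega> + incr c m \<omega> + incr m b \<omega>" "incr c d \<omega> = incr c m \<omega> + incr m d \<omega>"
        by (simp_all add: incr_def)
      \<comment> \<open>As \<open>m\<close> is the smaller of \<open>b\<close> and \<open>d\<close>,
        one of the two intervals beyond \<open>m\<close> is empty.\<close>
      moreover have "(incr m b \<omega> \<bullet> u) * (incr m d \<omega> \<bullet> v) = 0" using m(4) by (auto simp: incr_self)
      ultimately show ?thesis by (simp add: inner_add_left algebra_simps)
    qed
    have "max 0 (min b d - max a c) = m - c" using ac m by (simp add: m_def)
    then show ?thesis
      using has_bochner_integral_add[OF has_bochner_integral_add[OF has_bochner_integral_add[OF i1 i2] i3] i4]
      unfolding expand by (simp add: mult_ac)
  qed
qed

lemma incr_product: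
  fixes \<xi> \<zeta> :: "'a \<Rightarrow> 'h::{real_inner, banach, second_countable_topology}"
  assumes "0 \<le> a" "a \<le> b" "0 \<le> c" "c \<le> d"
    and \<xi>: "L2_on M (F a) \<xi>" and \<zeta>: "L2_on M (F c) \<zeta>"
  shows "has_bochner_integral M (\<lambda>\<omega>. (incr a b \<omega> \<bullet> u) * (incr c d \<omega> \<bullet> v) * (\<xi> \<omega> \<bullet> \<zeta> \<omega>))
     (max 0 (min b d - max a c) * (Q u \<bullet> v) * (\<integral>\<omega>. \<xi> \<omega> \<bullet> \<zeta> \<omega> \<partial>M))"
proof (cases "a \<le> c")
  case True
  then show ?thesis using assms by (intro incr_product_ordered)
next
  case False
  then have "has_bochner_integral M (\<lambda>\<omega>. (incr c d \<omega> \<bullet> v) * (incr a b \<omega> \<bullet> u) * (\<zeta> \<omega> \<bullet> \<xi> \<omega>))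
     (max 0 (min d b - max c a) * (Q v \<bullet> u) * (\<integral>\<omega>. \<zeta> \<omega> \<bullet> \<xi> \<omega> \<partial>M))"
    using assms by (intro incr_product_ordered) auto
  moreover have "Q v \<bullet> u = Q u \<bullet> v" using nonneg_symmetricD(2)[OF nonneg, of v u] by (simp add: inner_commute)
  ultimately show ?thesis by (simp add: inner_commute max.commute min.commute mult.commute mult.left_commute)
qed

end

section \<open>Integrals of block processes\<close>

locale filtered_wiener_basis = filtered_wiener M F Q W
  for M :: "'a measure" and F and Q :: "'u::{real_inner, banach, second_countable_topology} \<Rightarrow> 'u" and W +
  fixes J K :: "'j set" and e :: "'j \<Rightarrow> 'u" and \<eta> :: "'j \<Rightarrow> real"
  assumes basis: "orthonormal_basis J e" and K: "finite K" "K \<subseteq> J"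
    and eigen: "\<And>j. j \<in> K \<Longrightarrow> 0 < \<eta> j \<and> Q (e j) = \<eta> j *\<^sub>R e j"
begin

text \<open>With \<open>f j = L (e j)\<close>, this is \<open>E \<parallel>L Q\<^sub>K\<^sup>1\<^sup>/\<^sup>2\<parallel>\<^sup>2\<close> in the Hilbert-Schmidt norm, where \<open>Q\<^sub>K\<close> is the
  projected covariance operator.\<close>

definition coeff_norm2 :: "('j \<Rightarrow> 'a \<Rightarrow> 'h::real_normed_vector) \<Rightarrow> ennreal" where
  "coeff_norm2 f = (\<integral>\<^sup>+ \<omega>. (\<Sum>j\<in>K. ennreal (\<eta> j * (norm (f j \<omega>))\<^sup>2)) \<partial>M)"

text \<open>Blocks may overlap and are indexed by a set of any type. This keeps the class closed
  under differences, with the disjoint sum of the index sets as the new index set.\<close>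

definition block_value :: "'k set \<Rightarrow> ('k \<Rightarrow> real) \<Rightarrow> ('k \<Rightarrow> real) \<Rightarrow> ('k \<Rightarrow> 'j \<Rightarrow> 'a \<Rightarrow> 'h::real_vector) \<Rightarrow>
    real \<Rightarrow> 'j \<Rightarrow> 'a \<Rightarrow> 'h" where
  "block_value A a b \<xi> s j \<omega> = (\<Sum>k\<in>A. indicator {a k<..b k} s *\<^sub>R \<xi> k j \<omega>)"

definition block_integral :: "'k set \<Rightarrow> ('k \<Rightarrow> real) \<Rightarrow> ('k \<Rightarrow> real) \<Rightarrow> ('k \<Rightarrow> 'j \<Rightarrow> 'a \<Rightarrow> 'h::real_vector) \<Rightarrow>
    'a \<Rightarrow> 'h" where
  "block_integral A a b \<xi> \<omega> = (\<Sum>k\<in>A. \<Sum>j\<in>K. (incr (a k) (b k) \<omega> \<bullet> e j) *\<^sub>R \<xi> k j \<omega>)"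

definition admissible :: "'k set \<Rightarrow> ('k \<Rightarrow> real) \<Rightarrow> ('k \<Rightarrow> real) \<Rightarrow>
    ('k \<Rightarrow> 'j \<Rightarrow> 'a \<Rightarrow> 'h::real_normed_vector) \<Rightarrow> bool" where
  "admissible A a b \<xi> \<longleftrightarrow> finite A \<and>
     (\<forall>k\<in>A. 0 \<le> a k \<and> a k \<le> b k \<and> (\<forall>j\<in>K. L2_on M (F (a k)) (\<xi> k j)))"

lemma orthonormal: "i \<in> K \<Longrightarrow> j \<in> K \<Longrightarrow> e i \<bullet> e j = (if i = j then 1 else 0)"
  using basis K(2) unfolding orthonormal_basis_def by (meson subsetD)

lemma eta_nonneg: "j \<in> K \<Longrightarrow> 0 \<le> \<eta> j"
  using eigen less_imp_le by blast

lemma Q_basis: "i \<in> K \<Longrightarrow> j \<in> K \<Longrightarrow> Q (e i) \<bullet> e j = (if i = j then \<eta> i else 0)"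
  by (simp add: eigen orthonormal)

lemma coeff_norm2_integral:
  fixes f :: "'j \<Rightarrow> 'a \<Rightarrow> 'h::{real_normed_vector}"
  assumes "\<And>j. j \<in> K \<Longrightarrow> L2_on M M (f j)"
  shows "coeff_norm2 f = ennreal (\<Sum>j\<in>K. \<eta> j * (\<integral>\<omega>. (norm (f j \<omega>))\<^sup>2 \<partial>M))"
proof -
  have int: "integrable M (\<lambda>\<omega>. \<Sum>j\<in>K. \<eta> j * (norm (f j \<omega>))\<^sup>2)"
    using assms by (auto simp: L2_on_def)
  have "coeff_norm2 f = (\<integral>\<^sup>+ \<omega>. ennreal (\<Sum>j\<in>K. \<eta> j * (norm (f j \<omega>))\<^sup>2) \<partial>M)"
    unfolding coeff_norm2_def by (intro nn_integral_cong sum_ennreal) (auto simp: eta_nonneg)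
  also have "\<dots> = ennreal (\<integral>\<omega>. (\<Sum>j\<in>K. \<eta> j * (norm (f j \<omega>))\<^sup>2) \<partial>M)"
    by (rule nn_integral_eq_integral[OF int]) (auto intro!: sum_nonneg simp: eta_nonneg)
  also have "(\<integral>\<omega>. (\<Sum>j\<in>K. \<eta> j * (norm (f j \<omega>))\<^sup>2) \<partial>M) = (\<Sum>j\<in>K. \<eta> j * (\<integral>\<omega>. (norm (f j \<omega>))\<^sup>2 \<partial>M))"
    using assms by (subst Bochner_Integration.integral_sum) (auto simp: L2_on_def)
  finally show ?thesis .
qed

lemma L2_on_M: "0 \<le> t \<Longrightarrow> L2_on M (F t) f \<Longrightarrow> L2_on M M f"
  using L2_on_mono subalg by blast

lemma subalg_refl: "subalgebra M M"
  by (simp add: subalgebra_def)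

text \<open>Both sides expand into one double sum over pairs of blocks. On the left a pair is
  weighted by the covariance of its increments, on the right by the Lebesgue measure of its
  intersection, and both yield the overlap length \<open>len k l\<close>. Orthogonality of the
  \<open>e j\<close> under \<open>Q\<close> removes the mixed terms in the directions.\<close>

theorem ito_isometry:
  fixes \<xi> :: "'k \<Rightarrow> 'j \<Rightarrow> 'a \<Rightarrow> 'h::{real_inner, banach, second_countable_topology}"
  assumes adm: "admissible A a b \<xi>"
  shows "L2_on M M (block_integral A a b \<xi>)"
    and "mean_sq M (\<lambda>\<omega>. block_integral A a b \<xi> \<omega>) =
      (\<integral>\<^sup>+ s. coeff_norm2 (block_value A a b \<xi> s) \<partial>lborel)"
proof -
  have fin: "finite A" using adm by (simp add: admissible_def)
  have ab: "0 \<le> a k" "a k \<le> b k" if "k \<in> A" for k using adm that by (auto simp: admissible_def)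
  have \<xi>: "L2_on M (F (a k)) (\<xi> k j)" if "k \<in> A" "j \<in> K" for k j
    using adm that by (auto simp: admissible_def)
  have \<xi>M: "L2_on M M (\<xi> k j)" if "k \<in> A" "j \<in> K" for k j using \<xi>[OF that] ab[OF that(1)] L2_on_M by blast
  show L2: "L2_on M M (block_integral A a b \<xi>)"
    unfolding block_integral_def
  proof (intro L2_on_sum[OF subalg_refl])
    fix k j assume kj: "k \<in> A" "j \<in> K"
    then have "0 \<le> b k" using ab order_trans by blast
    then show "L2_on M M (\<lambda>\<omega>. (incr (a k) (b k) \<omega> \<bullet> e j) *\<^sub>R \<xi> k j \<omega>)"
      by (rule L2_on_M) (intro L2_on_incr_scaleR ab \<xi> kj)
  qed
  define len where "len k l = max 0 (min (b k) (b l) - max (a k) (a l))" for k l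
  define E where "E k l j = (\<integral>\<omega>. \<xi> k j \<omega> \<bullet> \<xi> l j \<omega> \<partial>M)" for k l j
  have sq: "(norm (block_integral A a b \<xi> \<omega>))\<^sup>2 = (\<Sum>k\<in>A. \<Sum>i\<in>K. \<Sum>l\<in>A. \<Sum>j\<in>K.
      (incr (a k) (b k) \<omega> \<bullet> e i) * (incr (a l) (b l) \<omega> \<bullet> e j) * (\<xi> k i \<omega> \<bullet> \<xi> l j \<omega>))" for \<omega>
    unfolding power2_norm_eq_inner block_integral_def inner_sum_left inner_sum_right
    by (intro sum.cong refl) (simp only: inner_scaleR_left inner_scaleR_right mult_ac inner_commute)
  have "has_bochner_integral M (\<lambda>\<omega>. (norm (block_integral A a b \<xi> \<omega>))\<^sup>2) (\<Sum>k\<in>A. \<Sum>i\<in>K. \<Sum>l\<in>A. \<Sum>j\<in>K.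
      len k l * (Q (e i) \<bullet> e j) * (\<integral>\<omega>. \<xi> k i \<omega> \<bullet> \<xi> l j \<omega> \<partial>M))"
    unfolding sq len_def by (intro has_bochner_integral_sum incr_product \<xi> ab)
  moreover have "(\<Sum>k\<in>A. \<Sum>i\<in>K. \<Sum>l\<in>A. \<Sum>j\<in>K. len k l * (Q (e i) \<bullet> e j) * (\<integral>\<omega>. \<xi> k i \<omega> \<bullet> \<xi> l j \<omega> \<partial>M))
      = (\<Sum>k\<in>A. \<Sum>i\<in>K. \<Sum>l\<in>A. \<Sum>j\<in>K. if i = j then len k l * \<eta> i * E k l i else 0)"
    by (intro sum.cong refl) (simp add: Q_basis E_def)
  moreover have "\<dots> = (\<Sum>k\<in>A. \<Sum>i\<in>K. \<Sum>l\<in>A. len k l * \<eta> i * E k l i)"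
    by (intro sum.cong refl) (simp add: K)
  ultimately have lhs: "has_bochner_integral M (\<lambda>\<omega>. (norm (block_integral A a b \<xi> \<omega>))\<^sup>2)
      (\<Sum>k\<in>A. \<Sum>i\<in>K. \<Sum>l\<in>A. len k l * \<eta> i * E k l i)" by simp
  define f where "f s = (\<Sum>k\<in>A. \<Sum>i\<in>K. \<Sum>l\<in>A. indicator ({a k<..b k} \<inter> {a l<..b l}) s * (\<eta> i * E k l i))" for s :: real
  have f: "coeff_norm2 (block_value A a b \<xi> s) = ennreal (f s)" "0 \<le> f s" for s
  proof -
    have L2v: "L2_on M M (block_value A a b \<xi> s j)" if "j \<in> K" for j
      unfolding block_value_def using that
      by (intro L2_on_sum[OF subalg_refl] L2_on_scaleR[OF subalg_refl] \<xi>M)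
    have "(\<integral>\<omega>. (norm (block_value A a b \<xi> s j \<omega>))\<^sup>2 \<partial>M)
        = (\<Sum>k\<in>A. \<Sum>l\<in>A. indicator ({a k<..b k} \<inter> {a l<..b l}) s * E k l j)" if j: "j \<in> K" for j
    proof -
      have "(norm (block_value A a b \<xi> s j \<omega>))\<^sup>2
        = (\<Sum>k\<in>A. \<Sum>l\<in>A. indicator ({a k<..b k} \<inter> {a l<..b l}) s * (\<xi> k j \<omega> \<bullet> \<xi> l j \<omega>))" for \<omega>
        unfolding power2_norm_eq_inner block_value_def inner_sum_left inner_sum_right
        by (intro sum.cong refl)
          (simp only: inner_scaleR_left inner_scaleR_right indicator_inter_arith mult_ac inner_commute)
      moreover have "integrable M (\<lambda>\<omega>. \<xi> k j \<omega> \<bullet> \<xi> l j \<omega>)" if "k \<in> A" "l \<in> A" for k l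
        using \<xi>M that j by (intro L2_on_inner[OF subalg_refl])
      ultimately show ?thesis by (simp add: E_def)
    qed
    then have "(\<Sum>j\<in>K. \<eta> j * (\<integral>\<omega>. (norm (block_value A a b \<xi> s j \<omega>))\<^sup>2 \<partial>M)) =
        (\<Sum>j\<in>K. \<Sum>k\<in>A. \<Sum>l\<in>A. indicator ({a k<..b k} \<inter> {a l<..b l}) s * (\<eta> j * E k l j))"
      by (intro sum.cong refl) (simp add: sum_distrib_left mult_ac)
    also have "\<dots> = f s"
      unfolding f_def by (rule sum.swap)
    finally have "(\<Sum>j\<in>K. \<eta> j * (\<integral>\<omega>. (norm (block_value A a b \<xi> s j \<omega>))\<^sup>2 \<partial>M)) = f s" .
    moreover have "0 \<le> (\<Sum>j\<in>K. \<eta> j * (\<integral>\<omega>. (norm (block_value A a b \<xi> s j \<omega>))\<^sup>2 \<partial>M))"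
      by (intro sum_nonneg mult_nonneg_nonneg) (auto simp: eta_nonneg)
    ultimately show "coeff_norm2 (block_value A a b \<xi> s) = ennreal (f s)" "0 \<le> f s"
      using coeff_norm2_integral[OF L2v] by auto
  qed
  have ind: "has_bochner_integral lborel (indicator ({a k<..b k} \<inter> {a l<..b l})) (len k l)" if "k \<in> A" "l \<in> A" for k l
  proof -
    have "{a k<..b k} \<inter> {a l<..b l} = {max (a k) (a l)<..min (b k) (b l)}" by auto
    then show ?thesis
      by (auto simp: has_bochner_integral_iff len_def max_def min_def)
  qed
  have fint: "has_bochner_integral lborel f (\<Sum>k\<in>A. \<Sum>i\<in>K. \<Sum>l\<in>A. len k l * (\<eta> i * E k l i))"
    unfolding f_def by (intro has_bochner_integral_sum has_bochner_integral_mult_left ind)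
  have "mean_sq M (\<lambda>\<omega>. block_integral A a b \<xi> \<omega>)
      = ennreal (\<Sum>k\<in>A. \<Sum>i\<in>K. \<Sum>l\<in>A. len k l * \<eta> i * E k l i)"
    using lhs by (subst nn_integral_eq_integral) (auto simp: has_bochner_integral_iff)
  also have "\<dots> = (\<integral>\<^sup>+ s. ennreal (f s) \<partial>lborel)"
    using fint f(2) by (subst nn_integral_eq_integral) (auto simp: has_bochner_integral_iff mult.assoc)
  finally show "mean_sq M (\<lambda>\<omega>. block_integral A a b \<xi> \<omega>) =
      (\<integral>\<^sup>+ s. coeff_norm2 (block_value A a b \<xi> s) \<partial>lborel)" by (simp add: f)
qed

text \<open>The second family enters with the opposite sign as further blocks, indexed by
  \<open>A <+> A'\<close>.\<close>

lemma ito_isometry_diff: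
  fixes \<xi> \<xi>' :: "_ \<Rightarrow> 'j \<Rightarrow> 'a \<Rightarrow> 'h::{real_inner, banach, second_countable_topology}"
  assumes adm: "admissible A a b \<xi>" "admissible A' a' b' \<xi>'"
  shows "mean_sq M (\<lambda>\<omega>. block_integral A a b \<xi> \<omega> - block_integral A' a' b' \<xi>' \<omega>) =
      (\<integral>\<^sup>+ s. coeff_norm2 (\<lambda>j \<omega>. block_value A a b \<xi> s j \<omega> - block_value A' a' b' \<xi>' s j \<omega>) \<partial>lborel)"
proof -
  let ?\<xi> = "case_sum \<xi> (\<lambda>k j \<omega>. - \<xi>' k j \<omega>)"
  have fin: "finite A" "finite A'" using adm by (auto simp: admissible_def)
  have "admissible (A <+> A') (case_sum a a') (case_sum b b') ?\<xi>"
    using adm unfolding admissible_def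
    by (auto intro!: L2_on_minus[OF subalg])
  note iso = ito_isometry(2)[OF this]
  have "block_integral (A <+> A') (case_sum a a') (case_sum b b') ?\<xi> \<omega>
      = block_integral A a b \<xi> \<omega> - block_integral A' a' b' \<xi>' \<omega>" for \<omega>
    by (simp add: block_integral_def sum.Plus fin sum_negf)
  moreover have "block_value (A <+> A') (case_sum a a') (case_sum b b') ?\<xi> s
      = (\<lambda>j \<omega>. block_value A a b \<xi> s j \<omega> - block_value A' a' b' \<xi>' s j \<omega>)" for s
    by (intro ext) (simp add: block_value_def sum.Plus fin sum_negf del: sum_indicator_scaleR)
  ultimately show ?thesis using iso by simp
qed

end

section \<open>Versions of the stochastic integral\<close>

context filtered_wiener_basis
begin

abbreviation "WK \<equiv> proj_process e K W"
abbreviation "cov \<equiv> proj_cov e \<eta> K"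
abbreviation "elem_dist \<equiv> hs_mean_square_dist M cov J e"
abbreviation "is_SI \<equiv> is_stoch_integral M F cov J e WK"
abbreviation "SI \<equiv> stoch_integral M F cov J e WK"

definition eval_coeff :: "(nat \<Rightarrow> 'a \<Rightarrow> 'u \<Rightarrow>\<^sub>L 'h::real_normed_vector) \<Rightarrow> nat \<Rightarrow> 'j \<Rightarrow> 'a \<Rightarrow> 'h" where
  "eval_coeff L m j \<omega> = blinfun_apply (L m \<omega>) (e j)"

text \<open>A restriction to \<open>U0_space Q\<close> is \<open>undefined\<close> elsewhere and so
  need not be linear on the whole space. This property is what evaluation at
  \<open>op_sqrt cov (e j)\<close> uses, which is a multiple of \<open>e j\<close> or 0.\<close>

definition homogeneous :: "('u \<Rightarrow> 'h::real_vector) \<Rightarrow> bool" where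
  "homogeneous f \<longleftrightarrow> f 0 = 0 \<and> (\<forall>j\<in>K. \<forall>c. f (c *\<^sub>R e j) = c *\<^sub>R f (e j))"

lemma eta_pos: "j \<in> K \<Longrightarrow> 0 < \<eta> j"
  using eigen by blast

lemma op_sqrt_cov_eq: "op_sqrt cov x = (\<Sum>j\<in>K. (sqrt (\<eta> j) * (x \<bullet> e j)) *\<^sub>R e j)"
  by (rule op_sqrt_proj_cov[OF basis K]) (rule eta_nonneg)

lemma op_sqrt_cov:
  assumes "j \<in> J"
  shows "op_sqrt cov (e j) = (if j \<in> K then sqrt (\<eta> j) *\<^sub>R e j else 0)"
proof -
  have "e j \<bullet> e i = (if j = i then 1 else 0)" if "i \<in> K" for i
    using basis K(2) assms that unfolding orthonormal_basis_def by (meson subsetD)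
  then have "op_sqrt cov (e j) = (\<Sum>i\<in>K. if j = i then sqrt (\<eta> j) *\<^sub>R e j else 0)"
    unfolding op_sqrt_cov_eq by (intro sum.cong refl) simp
  then show ?thesis using K(1) by simp
qed

lemma op_sqrt_cov_in_span: "\<exists>c. op_sqrt cov x = (\<Sum>j\<in>K. c j *\<^sub>R e j)"
  by (rule exI) (rule op_sqrt_cov_eq)

text \<open>\<open>is_stoch_integral\<close> speaks of integrands only on the range of the root.
  Since \<open>\<eta> j > 0\<close> on \<open>K\<close>, that range contains \<open>e j\<close>,
  which gives measurability of \<open>X s \<omega> (e j)\<close> in \<open>\<omega>\<close>.\<close>

lemma op_sqrt_cov_preimage:
  assumes "j \<in> K"
  shows "op_sqrt cov ((1 / sqrt (\<eta> j)) *\<^sub>R e j) = e j"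
proof -
  have "op_sqrt cov ((1 / sqrt (\<eta> j)) *\<^sub>R e j) = (\<Sum>i\<in>K. if j = i then e j else 0)"
    unfolding op_sqrt_cov_eq using eta_pos[OF assms]
    by (intro sum.cong refl) (auto simp: orthonormal assms)
  then show ?thesis using K(1) assms by simp
qed

lemma elementary_integral_eq:
  "elementary_integral WK n \<tau> L = block_integral {..<n} \<tau> (\<lambda>m. \<tau> (Suc m)) (eval_coeff L)"
proof
  fix \<omega>
  have "WK t \<omega> - WK s \<omega> = (\<Sum>j\<in>K. (incr s t \<omega> \<bullet> e j) *\<^sub>R e j)" for s t
    by (simp add: proj_process_def incr_def inner_diff_left scaleR_left_diff_distrib sum_subtractf)
  then show "elementary_integral WK n \<tau> L \<omega> = block_integral {..<n} \<tau> (\<lambda>m. \<tau> (Suc m)) (eval_coeff L) \<omega>"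
    by (simp add: elementary_integral_def block_integral_def eval_coeff_def blinfun.sum_right blinfun.scaleR_right)
qed

lemma elementary_value_eq:
  "elementary_value n \<tau> L s \<omega> (e j) = block_value {..<n} \<tau> (\<lambda>m. \<tau> (Suc m)) (eval_coeff L) s j \<omega>"
  by (simp only: elementary_value_def block_value_def eval_coeff_def)

lemma elementary_value_homogeneous: "homogeneous (elementary_value n \<tau> L s \<omega>)"
  unfolding homogeneous_def elementary_value_def scaleR_sum_right blinfun.scaleR_right scaleR_left_commute
  by (simp add: scaleR_left_commute del: sum_indicator_scaleR scaleR_scaleR)

lemma L2_on_simple:
  fixes f :: "'a \<Rightarrow> 'h::{real_normed_vector, second_countable_topology}"
  assumes s: "0 \<le> s" and f: "simple_function (F s) f"
  shows "L2_on M (F s) f"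
proof -
  have meas: "f \<in> borel_measurable (F s)" using f by (rule borel_measurable_simple_function)
  then have [measurable]: "f \<in> borel_measurable M" using measurable_from_subalg subalg s by blast
  have fin: "finite (f ` space M)" using f space_F[OF s] by (simp add: simple_function_def)
  obtain B where B: "\<And>\<omega>. \<omega> \<in> space M \<Longrightarrow> norm (f \<omega>) \<le> B"
    using finite_imp_bounded[OF fin] by (auto simp: bounded_iff)
  have "integrable M (\<lambda>x. (norm (f x))\<^sup>2)"
  proof (rule integrable_const_bound[where B = "B\<^sup>2"])
    show "AE x in M. norm ((norm (f x))\<^sup>2) \<le> B\<^sup>2"
      using B by (auto intro!: power_mono)
  qed measurable
  then show ?thesis using meas by (simp add: L2_on_def)
qed

lemma partition_bounds:
  fixes \<tau> :: "nat \<Rightarrow> real"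
  assumes "\<And>m. m < n \<Longrightarrow> \<tau> m < \<tau> (Suc m)"
  shows "m \<le> n \<Longrightarrow> \<tau> 0 \<le> \<tau> m" "m \<le> n \<Longrightarrow> \<tau> m \<le> \<tau> n"
proof -
  show "m \<le> n \<Longrightarrow> \<tau> 0 \<le> \<tau> m"
  proof (induction m)
    case (Suc m) then show ?case using assms[of m] by simp
  qed simp
  show "m \<le> n \<Longrightarrow> \<tau> m \<le> \<tau> n"
  proof (induction rule: inc_induct)
    case (step k) then show ?case using assms[of k] by simp
  qed simp
qed

lemma elementary_admissible:
  fixes L :: "nat \<Rightarrow> 'a \<Rightarrow> 'u \<Rightarrow>\<^sub>L 'h::{real_normed_vector, second_countable_topology}"
  assumes L: "elementary_integrand F a b n \<tau> L" and a: "0 \<le> a"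
  shows "admissible {..<n} \<tau> (\<lambda>m. \<tau> (Suc m)) (eval_coeff L)"
    and "m < n \<Longrightarrow> a \<le> \<tau> m \<and> \<tau> m < \<tau> (Suc m) \<and> \<tau> (Suc m) \<le> b"
proof -
  have \<tau>: "\<tau> 0 = a" "\<tau> n = b" "\<And>m. m < n \<Longrightarrow> \<tau> m < \<tau> (Suc m)"
    using L by (auto simp: elementary_integrand_def)
  show bounds: "a \<le> \<tau> m \<and> \<tau> m < \<tau> (Suc m) \<and> \<tau> (Suc m) \<le> b" if "m < n" for m
    using partition_bounds[of n \<tau>, OF \<tau>(3)] \<tau> that by (metis Suc_leI less_imp_le_nat)
  have "L2_on M (F (\<tau> m)) (eval_coeff L m j)" if m: "m < n" for m j
  proof -
    have "simple_function (F (\<tau> m)) (L m)" using L m by (auto simp: elementary_integrand_def)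
    then have "simple_function (F (\<tau> m)) (\<lambda>\<omega>. blinfun_apply (L m \<omega>) (e j))"
      by (rule simple_function_compose1)
    then show ?thesis using L2_on_simple[of "\<tau> m"] bounds[OF m] a by (simp add: eval_coeff_def[abs_def])
  qed
  then show "admissible {..<n} \<tau> (\<lambda>m. \<tau> (Suc m)) (eval_coeff L)"
    using bounds a by (force simp: admissible_def intro: order_trans)
qed

text \<open>The root kills the basis vectors outside \<open>K\<close> and multiplies the others by
  \<open>sqrt (\<eta> j)\<close>, so the Hilbert-Schmidt norm collapses to a finite sum with weights
  \<open>\<eta> j\<close>.\<close>

lemma hs_dist_eq:
  fixes X :: "real \<Rightarrow> 'a \<Rightarrow> 'u \<Rightarrow> 'h::real_normed_vector"
  assumes "\<And>\<omega>. homogeneous (X s \<omega>)"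
  shows "elem_dist X (elementary_value n \<tau> L) s
    = coeff_norm2 (\<lambda>j \<omega>. X s \<omega> (e j) - block_value {..<n} \<tau> (\<lambda>m. \<tau> (Suc m)) (eval_coeff L) s j \<omega>)"
  unfolding hs_mean_square_dist_def coeff_norm2_def
proof (intro nn_integral_cong)
  fix \<omega>
  let ?Y = "elementary_value n \<tau> L s \<omega>"
  have hom: "homogeneous (X s \<omega>)" "homogeneous ?Y" by (rule assms, rule elementary_value_homogeneous)
  have "hs_norm_sq J e (\<lambda>u. X s \<omega> (op_sqrt cov u) - ?Y (op_sqrt cov u))
      = (\<integral>\<^sup>+ j. (if j \<in> K then ennreal (\<eta> j * (norm (X s \<omega> (e j) - ?Y (e j)))\<^sup>2) else 0) \<partial>count_space J)"
    unfolding hs_norm_sq_def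
  proof (intro nn_integral_cong)
    fix j assume "j \<in> space (count_space J)"
    then have j: "j \<in> J" by simp
    show "ennreal ((norm (X s \<omega> (op_sqrt cov (e j)) - ?Y (op_sqrt cov (e j))))\<^sup>2)
      = (if j \<in> K then ennreal (\<eta> j * (norm (X s \<omega> (e j) - ?Y (e j)))\<^sup>2) else 0)"
    proof (cases "j \<in> K")
      case True
      then have "X s \<omega> (op_sqrt cov (e j)) - ?Y (op_sqrt cov (e j)) = sqrt (\<eta> j) *\<^sub>R (X s \<omega> (e j) - ?Y (e j))"
        using hom j by (simp add: op_sqrt_cov homogeneous_def scaleR_right_diff_distrib)
      then show ?thesis using True eta_nonneg[OF True] by (simp add: power_mult_distrib)
    next
      case False
      then show ?thesis using hom j by (simp add: op_sqrt_cov homogeneous_def)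
    qed
  qed
  also have "\<dots> = (\<Sum>j\<in>K. ennreal (\<eta> j * (norm (X s \<omega> (e j) - ?Y (e j)))\<^sup>2))"
    using K by (subst nn_integral_count_space'[of K]) auto
  finally show "hs_norm_sq J e (\<lambda>u. X s \<omega> (op_sqrt cov u) - ?Y (op_sqrt cov u))
      = (\<Sum>j\<in>K. ennreal (\<eta> j * (norm (X s \<omega> (e j) -
          block_value {..<n} \<tau> (\<lambda>m. \<tau> (Suc m)) (eval_coeff L) s j \<omega>))\<^sup>2))"
    by (simp add: elementary_value_eq)
qed

lemma coeff_norm2_diff_le:
  fixes f g x :: "'j \<Rightarrow> 'a \<Rightarrow> 'h::{real_normed_vector, second_countable_topology}"
  assumes "\<And>j. j \<in> K \<Longrightarrow> f j \<in> borel_measurable M" "\<And>j. j \<in> K \<Longrightarrow> g j \<in> borel_measurable M"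
    "\<And>j. j \<in> K \<Longrightarrow> x j \<in> borel_measurable M"
  shows "coeff_norm2 (\<lambda>j \<omega>. f j \<omega> - g j \<omega>)
    \<le> 2 * coeff_norm2 (\<lambda>j \<omega>. x j \<omega> - f j \<omega>) + 2 * coeff_norm2 (\<lambda>j \<omega>. x j \<omega> - g j \<omega>)"
proof -
  note [measurable] = assms
  have "coeff_norm2 (\<lambda>j \<omega>. f j \<omega> - g j \<omega>) \<le> (\<integral>\<^sup>+ \<omega>. 2 * (\<Sum>j\<in>K. ennreal (\<eta> j * (norm (x j \<omega> - f j \<omega>))\<^sup>2))
       + 2 * (\<Sum>j\<in>K. ennreal (\<eta> j * (norm (x j \<omega> - g j \<omega>))\<^sup>2)) \<partial>M)"
    unfolding coeff_norm2_def
  proof (intro nn_integral_mono)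
    fix \<omega>
    have "ennreal (\<eta> j * (norm (f j \<omega> - g j \<omega>))\<^sup>2)
        \<le> 2 * ennreal (\<eta> j * (norm (x j \<omega> - f j \<omega>))\<^sup>2) + 2 * ennreal (\<eta> j * (norm (x j \<omega> - g j \<omega>))\<^sup>2)"
      if j: "j \<in> K" for j
    proof -
      have "(norm (f j \<omega> - g j \<omega>))\<^sup>2 \<le> 2 * (norm (x j \<omega> - f j \<omega>))\<^sup>2 + 2 * (norm (x j \<omega> - g j \<omega>))\<^sup>2"
        using norm_add_sq_le[of "f j \<omega> - x j \<omega>" "x j \<omega> - g j \<omega>"] by (simp add: norm_minus_commute)
      then have "\<eta> j * (norm (f j \<omega> - g j \<omega>))\<^sup>2
          \<le> \<eta> j * (2 * (norm (x j \<omega> - f j \<omega>))\<^sup>2 + 2 * (norm (x j \<omega> - g j \<omega>))\<^sup>2)"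
        by (rule mult_left_mono) (rule eta_nonneg[OF j])
      also have "\<dots> = 2 * (\<eta> j * (norm (x j \<omega> - f j \<omega>))\<^sup>2) + 2 * (\<eta> j * (norm (x j \<omega> - g j \<omega>))\<^sup>2)"
        by (simp add: algebra_simps)
      finally show ?thesis
        using eta_nonneg[OF j] by (simp add: ennreal_plus[symmetric] ennreal_mult'[symmetric]
            del: ennreal_plus flip: ennreal_numeral)
    qed
    then show "(\<Sum>j\<in>K. ennreal (\<eta> j * (norm (f j \<omega> - g j \<omega>))\<^sup>2))
      \<le> 2 * (\<Sum>j\<in>K. ennreal (\<eta> j * (norm (x j \<omega> - f j \<omega>))\<^sup>2)) + 2 * (\<Sum>j\<in>K. ennreal (\<eta> j * (norm (x j \<omega> - g j \<omega>))\<^sup>2))"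
      unfolding sum_distrib_left sum.distrib[symmetric] by (rule sum_mono)
  qed
  also have "\<dots> = 2 * coeff_norm2 (\<lambda>j \<omega>. x j \<omega> - f j \<omega>) + 2 * coeff_norm2 (\<lambda>j \<omega>. x j \<omega> - g j \<omega>)"
    unfolding coeff_norm2_def by (subst nn_integral_add) (auto simp: nn_integral_cmult)
  finally show ?thesis .
qed

lemma nn_integral_norm_sq_add_le:
  fixes f g :: "'a \<Rightarrow> 'h::{real_normed_vector, second_countable_topology}"
  assumes [measurable]: "f \<in> borel_measurable M" "g \<in> borel_measurable M"
  shows "mean_sq M (\<lambda>\<omega>. f \<omega> + g \<omega>)
    \<le> 2 * mean_sq M f + 2 * mean_sq M g"
proof -
  have "mean_sq M (\<lambda>\<omega>. f \<omega> + g \<omega>)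
      \<le> (\<integral>\<^sup>+ \<omega>. 2 * ennreal ((norm (f \<omega>))\<^sup>2) + 2 * ennreal ((norm (g \<omega>))\<^sup>2) \<partial>M)"
    using norm_add_sq_le by (intro nn_integral_mono) (simp add: ennreal_plus[symmetric] ennreal_mult'[symmetric]
            del: ennreal_plus flip: ennreal_numeral)
  also have "\<dots> = 2 * mean_sq M f + 2 * mean_sq M g"
    by (subst nn_integral_add) (auto simp: nn_integral_cmult)
  finally show ?thesis .
qed

lemma block_value_measurable:
  fixes \<xi> :: "'k \<Rightarrow> 'j \<Rightarrow> 'a \<Rightarrow> 'h::{real_normed_vector, second_countable_topology}"
  assumes "admissible A \<alpha> \<beta> \<xi>" "j \<in> K"
  shows "block_value A \<alpha> \<beta> \<xi> s j \<in> borel_measurable M"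
  unfolding block_value_def
proof (intro borel_measurable_sum borel_measurable_scaleR borel_measurable_const)
  fix k assume "k \<in> A"
  then show "\<xi> k j \<in> borel_measurable M"
    using assms L2_on_measurable_subalg[OF subalg] unfolding admissible_def by blast
qed

lemma block_value_outside:
  assumes "\<And>k. k \<in> A \<Longrightarrow> a \<le> \<alpha> k \<and> \<beta> k \<le> b" "s \<notin> {a..b}"
  shows "block_value A \<alpha> \<beta> \<xi> s j \<omega> = 0"
  unfolding block_value_def
proof (rule sum.neutral, rule)
  fix k assume "k \<in> A"
  then have "s \<notin> {\<alpha> k<..\<beta> k}" using assms(1)[of k] assms(2) by auto
  then show "indicator {\<alpha> k<..\<beta> k} s *\<^sub>R \<xi> k j \<omega> = 0" by simp
qed

text \<open>The isometry turns the difference of the integrals into the difference of the block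
  values, which is then compared through \<open>x\<close> at each \<open>s\<close>. The
  measurability of the two distances in \<open>s\<close> lets the integral of their sum
  split.\<close>

lemma block_diff_le:
  fixes \<xi> :: "'k \<Rightarrow> 'j \<Rightarrow> 'a \<Rightarrow> 'h::{real_inner, banach, second_countable_topology}"
    and \<xi>' :: "'l \<Rightarrow> 'j \<Rightarrow> 'a \<Rightarrow> 'h" and x :: "real \<Rightarrow> 'j \<Rightarrow> 'a \<Rightarrow> 'h"
  assumes adm: "admissible A \<alpha> \<beta> \<xi>" "admissible A' \<alpha>' \<beta>' \<xi>'"
    and ab: "\<And>k. k \<in> A \<Longrightarrow> a \<le> \<alpha> k \<and> \<beta> k \<le> b" "\<And>k. k \<in> A' \<Longrightarrow> a \<le> \<alpha>' k \<and> \<beta>' k \<le> b"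
    and x: "\<And>s j. s \<in> {a..b} \<Longrightarrow> j \<in> K \<Longrightarrow> x s j \<in> borel_measurable M"
    and D: "(\<lambda>s. coeff_norm2 (\<lambda>j \<omega>. x s j \<omega> - block_value A \<alpha> \<beta> \<xi> s j \<omega>)) \<in> borel_measurable (restrict_space borel {a..b})"
    and D': "(\<lambda>s. coeff_norm2 (\<lambda>j \<omega>. x s j \<omega> - block_value A' \<alpha>' \<beta>' \<xi>' s j \<omega>)) \<in> borel_measurable (restrict_space borel {a..b})"
  shows "mean_sq M (\<lambda>\<omega>. block_integral A \<alpha> \<beta> \<xi> \<omega> - block_integral A' \<alpha>' \<beta>' \<xi>' \<omega>)
    \<le> 2 * (\<integral>\<^sup>+ s\<in>{a..b}. coeff_norm2 (\<lambda>j \<omega>. x s j \<omega> - block_value A \<alpha> \<beta> \<xi> s j \<omega>) \<partial>lborel)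
     + 2 * (\<integral>\<^sup>+ s\<in>{a..b}. coeff_norm2 (\<lambda>j \<omega>. x s j \<omega> - block_value A' \<alpha>' \<beta>' \<xi>' s j \<omega>) \<partial>lborel)"
    (is "?lhs \<le> 2 * (\<integral>\<^sup>+ s\<in>_. ?D s \<partial>_) + 2 * (\<integral>\<^sup>+ s\<in>_. ?D' s \<partial>_)")
proof -
  have [measurable]: "(\<lambda>s. ?D s * indicator {a..b} s) \<in> borel_measurable borel"
    "(\<lambda>s. ?D' s * indicator {a..b} s) \<in> borel_measurable borel"
    using D D' by (simp_all add: borel_measurable_restrict_space_iff_ennreal)
  have "?lhs = (\<integral>\<^sup>+ s. coeff_norm2 (\<lambda>j \<omega>. block_value A \<alpha> \<beta> \<xi> s j \<omega> - block_value A' \<alpha>' \<beta>' \<xi>' s j \<omega>) \<partial>lborel)"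
    by (rule ito_isometry_diff[OF adm])
  also have "\<dots> \<le> (\<integral>\<^sup>+ s. 2 * (?D s * indicator {a..b} s) + 2 * (?D' s * indicator {a..b} s) \<partial>lborel)"
  proof (intro nn_integral_mono)
    fix s
    show "coeff_norm2 (\<lambda>j \<omega>. block_value A \<alpha> \<beta> \<xi> s j \<omega> - block_value A' \<alpha>' \<beta>' \<xi>' s j \<omega>)
      \<le> 2 * (?D s * indicator {a..b} s) + 2 * (?D' s * indicator {a..b} s)"
    proof (cases "s \<in> {a..b}")
      case True
      then show ?thesis
        using coeff_norm2_diff_le[OF block_value_measurable[OF adm(1)] block_value_measurable[OF adm(2)] x[OF True]]
        by simp
    next
      case False
      have "block_value A \<alpha> \<beta> \<xi> s j \<omega> = 0" "block_value A' \<alpha>' \<beta>' \<xi>' s j \<omega> = 0" for j \<omega>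
        using block_value_outside False ab by blast+
      then show ?thesis by (simp add: coeff_norm2_def)
    qed
  qed
  also have "\<dots> = 2 * (\<integral>\<^sup>+ s\<in>{a..b}. ?D s \<partial>lborel) + 2 * (\<integral>\<^sup>+ s\<in>{a..b}. ?D' s \<partial>lborel)"
    by (subst nn_integral_add) (auto simp: nn_integral_cmult)
  finally show ?thesis .
qed

text \<open>As \<open>I\<close> is an arbitrary version, this determines the integral almost surely, once the block values
  approximate \<open>X\<close>.\<close>

lemma stoch_integral_dist_le:
  fixes \<xi> :: "'k \<Rightarrow> 'j \<Rightarrow> 'a \<Rightarrow> 'h::{real_inner, banach, second_countable_topology}"
  assumes a: "0 \<le> a" "a \<le> b" and I: "is_SI a b X I"
    and hom: "\<And>s \<omega>. homogeneous (X s \<omega>)"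
    and adm: "admissible A \<alpha> \<beta> \<xi>" and ab: "\<And>k. k \<in> A \<Longrightarrow> a \<le> \<alpha> k \<and> \<beta> k \<le> b"
    and D: "(\<lambda>s. coeff_norm2 (\<lambda>j \<omega>. X s \<omega> (e j) - block_value A \<alpha> \<beta> \<xi> s j \<omega>)) \<in> borel_measurable (restrict_space borel {a..b})"
  shows "mean_sq M (\<lambda>\<omega>. I \<omega> - block_integral A \<alpha> \<beta> \<xi> \<omega>)
    \<le> 4 * (\<integral>\<^sup>+ s\<in>{a..b}. coeff_norm2 (\<lambda>j \<omega>. X s \<omega> (e j) - block_value A \<alpha> \<beta> \<xi> s j \<omega>) \<partial>lborel)"
    (is "?lhs \<le> 4 * ?d")
proof -
  have [measurable]: "I \<in> borel_measurable M"
    using I a measurable_from_subalg subalg unfolding is_stoch_integral_def by (meson order_trans)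
  have Xm: "(\<lambda>\<omega>. X s \<omega> (e j)) \<in> borel_measurable M" if "s \<in> {a..b}" "j \<in> K" for s j
  proof -
    have "(\<lambda>\<omega>. X s \<omega> (op_sqrt cov ((1 / sqrt (\<eta> j)) *\<^sub>R e j))) \<in> borel_measurable (F s)"
      using I that unfolding is_stoch_integral_def by blast
    then show ?thesis using that a measurable_from_subalg[OF subalg[of s]] by (simp add: op_sqrt_cov_preimage)
  qed
  obtain n \<tau> and L :: "nat \<Rightarrow> nat \<Rightarrow> 'a \<Rightarrow> ('u \<Rightarrow>\<^sub>L 'h)" where
    el: "\<And>k. elementary_integrand F a b (n k) (\<tau> k) (L k)"
    and meas: "\<And>k. elem_dist X (elementary_value (n k) (\<tau> k) (L k))
               \<in> borel_measurable (restrict_space borel {a..b})"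
    and lim: "(\<lambda>k. \<integral>\<^sup>+ s\<in>{a..b}. elem_dist X (elementary_value (n k) (\<tau> k) (L k)) s
               \<partial>lborel) \<longlonglongrightarrow> 0"
    and limI: "(\<lambda>k. \<integral>\<^sup>+ \<omega>. ennreal ((norm (elementary_integral WK (n k) (\<tau> k) (L k) \<omega> - I \<omega>))\<^sup>2) \<partial>M)
          \<longlonglongrightarrow> 0"
    using I unfolding is_stoch_integral_def by blast
  let ?d' = "\<lambda>k. \<integral>\<^sup>+ s\<in>{a..b}. elem_dist X (elementary_value (n k) (\<tau> k) (L k)) s \<partial>lborel"
  let ?E = "\<lambda>k. elementary_integral WK (n k) (\<tau> k) (L k)"
  let ?i = "\<lambda>k. \<integral>\<^sup>+ \<omega>. ennreal ((norm (?E k \<omega> - I \<omega>))\<^sup>2) \<partial>M"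
  \<comment> \<open>The 4 of the conclusion is 2 for inserting the elementary integral
    \<open>?E k\<close> times 2 from \<open>block_diff_le\<close>; the terms that depend on
    \<open>k\<close> tend to 0.\<close>
  have "?lhs \<le> 2 * ?i k + 2 * (2 * ?d' k + 2 * ?d)" for k
  proof -
    note adk = elementary_admissible[OF el[of k] a(1)]
    have [measurable]: "?E k \<in> borel_measurable M" "block_integral A \<alpha> \<beta> \<xi> \<in> borel_measurable M"
      using ito_isometry(1)[OF adk(1)] ito_isometry(1)[OF adm] by (simp_all add: elementary_integral_eq L2_on_def)
    have "?lhs \<le> 2 * mean_sq M (\<lambda>\<omega>. I \<omega> - ?E k \<omega>)
        + 2 * mean_sq M (\<lambda>\<omega>. ?E k \<omega> - block_integral A \<alpha> \<beta> \<xi> \<omega>)"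
      using nn_integral_norm_sq_add_le[of "\<lambda>\<omega>. I \<omega> - ?E k \<omega>" "\<lambda>\<omega>. ?E k \<omega> - block_integral A \<alpha> \<beta> \<xi> \<omega>"]
      by simp
    also have "mean_sq M (\<lambda>\<omega>. ?E k \<omega> - block_integral A \<alpha> \<beta> \<xi> \<omega>) \<le> 2 * ?d' k + 2 * ?d"
      unfolding elementary_integral_eq hs_dist_eq[OF hom]
      by (rule block_diff_le[OF adk(1) adm _ ab Xm _ D])
        (use adk(2) meas[of k] in \<open>auto simp: hs_dist_eq[OF hom] cong: measurable_cong_simp\<close>)
    finally show ?thesis by (simp add: norm_minus_commute mult_left_mono add_left_mono)
  qed
  moreover have "(\<lambda>k. 2 * ?i k + 2 * (2 * ?d' k + 2 * ?d)) \<longlonglongrightarrow> 2 * 0 + 2 * (2 * 0 + 2 * ?d)"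
    by (intro tendsto_add ennreal_tendsto_cmult tendsto_const lim limI) auto
  ultimately have "?lhs \<le> 2 * 0 + 2 * (2 * 0 + 2 * ?d)"
    by (intro LIMSEQ_le_const) auto
  then show ?thesis by (simp add: mult.assoc[symmetric])
qed

text \<open>Cells are open on the left, so a single block over the whole interval misses exactly the
  point \<open>a\<close>, a Lebesgue null set.\<close>

lemma const_dist:
  assumes s: "s \<in> {a..b}"
  shows "coeff_norm2 (\<lambda>j \<omega>. \<Phi> (e j) - block_value {0::nat} (\<lambda>_. a) (\<lambda>_. b) (\<lambda>k j \<omega>. \<Phi> (e j)) s j \<omega>)
    = (if s = a then coeff_norm2 (\<lambda>j \<omega>. \<Phi> (e j)) else 0)"
  using s by (cases "s = a") (simp_all add: coeff_norm2_def block_value_def del: sum_indicator_scaleR)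

definition const_integral :: "('u \<Rightarrow> 'h::real_vector) \<Rightarrow> real \<Rightarrow> real \<Rightarrow> 'a \<Rightarrow> 'h" where
  "const_integral \<Phi> a b \<omega> = (\<Sum>j\<in>K. (incr a b \<omega> \<bullet> e j) *\<^sub>R \<Phi> (e j))"

lemma nn_integral_at_point:
  fixes a b :: real and c :: ennreal
  shows "(\<integral>\<^sup>+ s\<in>{a..b}. (if s = a then c else 0) \<partial>lborel) = 0"
proof -
  have "AE s in lborel. (if s = a then c else 0) * indicator {a..b} s = (0 :: ennreal)"
    using AE_lborel_singleton[of a] by eventually_elim auto
  then show ?thesis by (subst nn_integral_0_iff_AE) auto
qed

lemma measurable_at_point:
  fixes a :: real
  assumes "\<And>s. s \<in> A \<Longrightarrow> f s = (if s = a then c else (0 :: ennreal))"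
  shows "f \<in> borel_measurable (restrict_space borel A)"
proof -
  have "(\<lambda>s. if s = a then c else (0 :: ennreal)) \<in> borel_measurable (restrict_space borel A)"
    by (rule measurable_restrict_space1) measurable
  then show ?thesis
    by (rule measurable_cong[THEN iffD1, rotated]) (use assms in \<open>auto simp: space_restrict_space\<close>)
qed

lemma const_stoch_integral_exists:
  fixes \<Phi> :: "'u \<Rightarrow> 'h::{real_inner, banach, second_countable_topology}"
  assumes ab: "0 \<le> a" "a \<le> b" and hom: "homogeneous \<Phi>" and L: "\<And>j. j \<in> K \<Longrightarrow> blinfun_apply L (e j) = \<Phi> (e j)"
  shows "is_SI a b (\<lambda>_ _. \<Phi>) (const_integral \<Phi> a b)"
proof -
  \<comment> \<open>For \<open>a = b\<close> the requirement of strictly increasing partition points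
    leaves only the empty partition, hence \<open>n = 0\<close>. This case arises as the inner
    integral at \<open>s = t\<close>.\<close>
  define n :: nat where "n = (if a < b then 1 else 0)"
  define \<tau> :: "nat \<Rightarrow> real" where "\<tau> m = (if m = 0 then a else b)" for m
  let ?L = "\<lambda>(m::nat) (\<omega>::'a). L"
  have el: "elementary_integrand F a b n \<tau> ?L"
    using ab unfolding elementary_integrand_def n_def \<tau>_def by (auto intro: simple_function_const)
  have int: "elementary_integral WK n \<tau> ?L \<omega> = const_integral \<Phi> a b \<omega>" for \<omega>
    using ab L by (cases "a = b")
      (auto simp: elementary_integral_eq block_integral_def const_integral_def n_def \<tau>_def eval_coeff_def incr_self)
  have dist: "elem_dist (\<lambda>_ _. \<Phi>) (elementary_value n \<tau> ?L) s
      = (if s = a then coeff_norm2 (\<lambda>j \<omega>. \<Phi> (e j)) else 0)" if s: "s \<in> {a..b}" for s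
    unfolding hs_dist_eq[of "\<lambda>_ _. \<Phi>", OF hom] using s L
    by (auto simp: coeff_norm2_def block_value_def n_def \<tau>_def eval_coeff_def simp del: sum_indicator_scaleR)
  have zero: "(\<integral>\<^sup>+ s\<in>{a..b}. elem_dist (\<lambda>_ _. \<Phi>) (elementary_value n \<tau> ?L) s \<partial>lborel) = 0"
    by (subst nn_integral_at_point[where a = a and b = b and c = "coeff_norm2 (\<lambda>j \<omega>. \<Phi> (e j))", symmetric],
        intro nn_integral_cong) (auto simp: dist indicator_def)
  show ?thesis
    unfolding is_stoch_integral_def
  proof (intro conjI exI[of _ "\<lambda>_. n"] exI[of _ "\<lambda>_. \<tau>"] exI[of _ "\<lambda>_. ?L"] allI)
    have [measurable]: "incr a b \<in> borel_measurable (F b)" using ab by (rule incr_measurable_F)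
    show "const_integral \<Phi> a b \<in> borel_measurable (F b)"
      unfolding const_integral_def by measurable
    show "elem_dist (\<lambda>_ _. \<Phi>) (elementary_value n \<tau> ?L) \<in> borel_measurable (restrict_space borel {a..b})"
      by (rule measurable_at_point) (rule dist)
  qed (use el int zero in auto)
qed

lemma stoch_integral_is:
  assumes "is_SI a b X I"
  shows "is_SI a b X (SI a b X)"
  unfolding stoch_integral_def using assms by (rule someI[of "is_SI a b X"])

text \<open>A constant integrand differs from one block only at the point \<open>a\<close>, so
  \<open>stoch_integral_dist_le\<close> makes the mean square distance 0. As the version is chosen
  by \<open>SOME\<close>, equality can be expected only almost surely.\<close>

lemma const_stoch_integral:
  fixes \<Phi> :: "'u \<Rightarrow> 'h::{real_inner, banach, second_countable_topology}"
  assumes ab: "0 \<le> a" "a \<le> b" and hom: "homogeneous \<Phi>" and L: "\<And>j. j \<in> K \<Longrightarrow> blinfun_apply L (e j) = \<Phi> (e j)"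
  shows "SI a b (\<lambda>_ _. \<Phi>) \<in> borel_measurable (F b)"
    and "AE \<omega> in M. SI a b (\<lambda>_ _. \<Phi>) \<omega> = const_integral \<Phi> a b \<omega>"
proof -
  let ?I = "SI a b (\<lambda>_ _. \<Phi>)"
  let ?\<xi> = "\<lambda>(k::nat) j (\<omega>::'a). \<Phi> (e j)"
  have I: "is_SI a b (\<lambda>_ _. \<Phi>) ?I"
    by (rule stoch_integral_is[OF const_stoch_integral_exists[OF assms]])
  then show meas: "?I \<in> borel_measurable (F b)" by (simp add: is_stoch_integral_def)
  then have [measurable]: "?I \<in> borel_measurable M" using measurable_from_subalg subalg ab by (meson order_trans)
  have adm: "admissible {0::nat} (\<lambda>_. a) (\<lambda>_. b) ?\<xi>"
    using ab by (simp add: admissible_def L2_on_def)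
  have dist: "coeff_norm2 (\<lambda>j \<omega>. \<Phi> (e j) - block_value {0::nat} (\<lambda>_. a) (\<lambda>_. b) ?\<xi> s j \<omega>)
    = (if s = a then coeff_norm2 (\<lambda>j \<omega>. \<Phi> (e j)) else 0)" if "s \<in> {a..b}" for s
    using that by (rule const_dist)
  have bi: "block_integral {0::nat} (\<lambda>_. a) (\<lambda>_. b) ?\<xi> = const_integral \<Phi> a b"
    by (simp add: block_integral_def const_integral_def fun_eq_iff)
  have [measurable]: "const_integral \<Phi> a b \<in> borel_measurable M"
    using ito_isometry(1)[OF adm] by (simp add: bi L2_on_def)
  have "mean_sq M (\<lambda>\<omega>. ?I \<omega> - const_integral \<Phi> a b \<omega>)
    \<le> 4 * (\<integral>\<^sup>+ s\<in>{a..b}. coeff_norm2 (\<lambda>j \<omega>. \<Phi> (e j) - block_value {0::nat} (\<lambda>_. a) (\<lambda>_. b) ?\<xi> s j \<omega>) \<partial>lborel)"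
    unfolding bi[symmetric]
    by (rule stoch_integral_dist_le[OF ab I hom adm]) (use ab in \<open>auto intro!: measurable_at_point dist\<close>)
  also have "(\<integral>\<^sup>+ s\<in>{a..b}. coeff_norm2 (\<lambda>j \<omega>. \<Phi> (e j) - block_value {0::nat} (\<lambda>_. a) (\<lambda>_. b) ?\<xi> s j \<omega>) \<partial>lborel) = 0"
    by (subst nn_integral_at_point[where a = a and b = b and c = "coeff_norm2 (\<lambda>j \<omega>. \<Phi> (e j))", symmetric],
        intro nn_integral_cong) (auto simp: dist indicator_def)
  finally have "mean_sq M (\<lambda>\<omega>. ?I \<omega> - const_integral \<Phi> a b \<omega>) = 0" by simp
  then have "AE \<omega> in M. ennreal ((norm (?I \<omega> - const_integral \<Phi> a b \<omega>))\<^sup>2) = 0"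
    by (subst (asm) nn_integral_0_iff_AE) auto
  then show "AE \<omega> in M. ?I \<omega> = const_integral \<Phi> a b \<omega>"
    by eventually_elim (simp add: ennreal_eq_0_iff)
qed

text \<open>The geometric rate gives summable expected increments, hence almost sure convergence.
  Taking \<open>lim\<close> pathwise, with its default value where the sequence diverges, yields a
  limit measurable for \<open>G\<close> itself, although \<open>G\<close> need not contain the null
  sets.\<close>

lemma fast_Cauchy_limit:
  fixes E :: "nat \<Rightarrow> 'a \<Rightarrow> 'h::{real_normed_vector, banach, second_countable_topology}"
  assumes G: "subalgebra M G" and E: "\<And>k. E k \<in> borel_measurable G"
    and cauchy: "\<And>k l. k \<le> l \<Longrightarrow> mean_sq M (\<lambda>\<omega>. E k \<omega> - E l \<omega>) \<le> ennreal (4 * (1/4) ^ k)"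
  shows "\<exists>I\<in>borel_measurable G. (\<lambda>k. \<integral>\<^sup>+ \<omega>. ennreal ((norm (E k \<omega> - I \<omega>))\<^sup>2) \<partial>M) \<longlonglongrightarrow> 0"
proof
  define I where "I \<omega> = lim (\<lambda>k. E k \<omega>)" for \<omega>
  show IG: "I \<in> borel_measurable G" unfolding I_def using E by (rule borel_measurable_lim_metric)
  have [measurable]: "I \<in> borel_measurable M" "\<And>k. E k \<in> borel_measurable M"
    using IG E measurable_from_subalg[OF G] by blast+
  have step: "(\<integral>\<^sup>+ \<omega>. ennreal (norm (E (Suc k) \<omega> - E k \<omega>)) \<partial>M) \<le> ennreal (5 * (1/2) ^ k)" for k
  proof -
    \<comment> \<open>The weight \<open>2 ^ k\<close> balances both terms: the second moment is of
      order \<open>(1/4) ^ k\<close>, so each contributes order \<open>(1/2) ^ k\<close>.\<close>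
    have am: "ennreal (norm x) \<le> ennreal (2 ^ k) * ennreal ((norm x)\<^sup>2) + ennreal ((1/2) ^ k)" for x :: 'h
    proof -
      have "2 ^ k * norm x \<le> (2 ^ k * norm x)\<^sup>2 + 1"
        using zero_le_power2[of "2 ^ k * norm x - 1"] zero_le_power2[of "2 ^ k * norm x"]
        unfolding power2_diff by (smt (verit) one_power2)
      then have "norm x \<le> 2 ^ k * (norm x)\<^sup>2 + (1/2) ^ k"
        by (simp add: power2_eq_square power_divide field_simps)
      then show ?thesis
        by (simp add: ennreal_mult[symmetric] ennreal_plus[symmetric] del: ennreal_plus)
    qed
    have "(\<integral>\<^sup>+ \<omega>. ennreal (norm (E (Suc k) \<omega> - E k \<omega>)) \<partial>M)
      \<le> (\<integral>\<^sup>+ \<omega>. ennreal (2 ^ k) * ennreal ((norm (E k \<omega> - E (Suc k) \<omega>))\<^sup>2) + ennreal ((1/2) ^ k) \<partial>M)"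
      using am by (intro nn_integral_mono) (metis norm_minus_commute)
    also have "\<dots> = ennreal (2 ^ k) * mean_sq M (\<lambda>\<omega>. E k \<omega> - E (Suc k) \<omega>) + ennreal ((1/2) ^ k)"
      by (subst nn_integral_add) (auto simp: nn_integral_cmult emeasure_space_1)
    also have "\<dots> \<le> ennreal (2 ^ k) * ennreal (4 * (1/4) ^ k) + ennreal ((1/2) ^ k)"
      by (intro add_mono mult_left_mono cauchy) auto
    also have "\<dots> = ennreal (5 * (1/2) ^ k)"
    proof -
      have "(2::real) ^ k * (4 * (1/4) ^ k) = 4 * (1/2) ^ k"
        by (simp add: power_mult_distrib[symmetric] mult.left_commute)
      then show ?thesis by (simp add: ennreal_mult[symmetric] ennreal_plus[symmetric] del: ennreal_plus)
    qed
    finally show ?thesis .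
  qed
  have "(\<integral>\<^sup>+ \<omega>. (\<Sum>k. ennreal (norm (E (Suc k) \<omega> - E k \<omega>))) \<partial>M) = (\<Sum>k. \<integral>\<^sup>+ \<omega>. ennreal (norm (E (Suc k) \<omega> - E k \<omega>)) \<partial>M)"
    by (rule nn_integral_suminf) measurable
  also have "\<dots> \<le> (\<Sum>k. ennreal (5 * (1/2) ^ k))" by (intro suminf_le step) auto
  also have "\<dots> < \<infinity>"
    by (subst suminf_ennreal2) (auto intro!: summable_mult summable_geometric)
  finally have "AE \<omega> in M. (\<Sum>k. ennreal (norm (E (Suc k) \<omega> - E k \<omega>))) \<noteq> \<infinity>"
    by (intro nn_integral_noteq_infinite) auto
  then have lim: "AE \<omega> in M. (\<lambda>k. E k \<omega>) \<longlonglongrightarrow> I \<omega>"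
  proof eventually_elim
    fix \<omega> assume "(\<Sum>k. ennreal (norm (E (Suc k) \<omega> - E k \<omega>))) \<noteq> \<infinity>"
    then have "summable (\<lambda>k. norm (E (Suc k) \<omega> - E k \<omega>))"
      by (intro summable_suminf_not_top) auto
    then have "summable (\<lambda>k. E (Suc k) \<omega> - E k \<omega>)" by (rule summable_norm_cancel)
    then have "convergent (\<lambda>n. (\<Sum>k<n. E (Suc k) \<omega> - E k \<omega>) + E 0 \<omega>)"
      by (intro convergent_add convergent_const) (simp add: summable_iff_convergent)
    then have "convergent (\<lambda>n. E n \<omega>)" using sum_lessThan_telescope[of "\<lambda>k. E k \<omega>"] by simp
    then show "(\<lambda>k. E k \<omega>) \<longlonglongrightarrow> I \<omega>" unfolding I_def by (simp add: convergent_LIMSEQ_iff)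
  qed
  have bound: "mean_sq M (\<lambda>\<omega>. E k \<omega> - I \<omega>) \<le> ennreal (4 * (1/4) ^ k)" for k
  proof -
    \<comment> \<open>Fatou's lemma in the later index turns the Cauchy bound into a rate for the
      limit.\<close>
    have "mean_sq M (\<lambda>\<omega>. E k \<omega> - I \<omega>)
        = (\<integral>\<^sup>+ \<omega>. liminf (\<lambda>l. ennreal ((norm (E k \<omega> - E l \<omega>))\<^sup>2)) \<partial>M)"
      using lim by (intro nn_integral_cong_AE, eventually_elim)
        (auto intro!: lim_imp_Liminf[symmetric] tendsto_ennrealI tendsto_intros)
    also have "\<dots> \<le> liminf (\<lambda>l. \<integral>\<^sup>+ \<omega>. ennreal ((norm (E k \<omega> - E l \<omega>))\<^sup>2) \<partial>M)"
      by (rule nn_integral_liminf) measurable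
    also have "\<dots> \<le> ennreal (4 * (1/4) ^ k)"
      using cauchy[of k] by (intro Liminf_le eventually_sequentiallyI[of k]) auto
    finally show ?thesis .
  qed
  have "(\<lambda>k. ennreal (4 * (1/4) ^ k)) \<longlonglongrightarrow> ennreal (4 * 0)"
    by (intro tendsto_ennrealI tendsto_mult tendsto_const LIMSEQ_realpow_zero) auto
  then have z: "(\<lambda>k. ennreal (4 * (1/4) ^ k)) \<longlonglongrightarrow> 0" by simp
  show "(\<lambda>k. \<integral>\<^sup>+ \<omega>. ennreal ((norm (E k \<omega> - I \<omega>))\<^sup>2) \<partial>M) \<longlonglongrightarrow> 0"
    by (rule tendsto_sandwich[OF _ _ tendsto_const z]) (use bound in auto)
qed

lemma block_integral_measurable_F:
  fixes \<xi> :: "'k \<Rightarrow> 'j \<Rightarrow> 'a \<Rightarrow> 'h::{real_inner, banach, second_countable_topology}"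
  assumes "admissible A \<alpha> \<beta> \<xi>" "\<And>k. k \<in> A \<Longrightarrow> \<beta> k \<le> b"
  shows "block_integral A \<alpha> \<beta> \<xi> \<in> borel_measurable (F b)"
  unfolding block_integral_def
proof (intro borel_measurable_sum borel_measurable_scaleR borel_measurable_inner borel_measurable_const)
  fix k j assume k: "k \<in> A" and j: "j \<in> K"
  then have a: "0 \<le> \<alpha> k" "\<alpha> k \<le> \<beta> k" "\<beta> k \<le> b" "\<xi> k j \<in> borel_measurable (F (\<alpha> k))"
    using assms by (auto simp: admissible_def L2_on_def)
  show "incr (\<alpha> k) (\<beta> k) \<in> borel_measurable (F b)"
    using a by (intro measurable_from_subalg[OF subalg_F incr_measurable_F]) auto
  show "\<xi> k j \<in> borel_measurable (F b)"
    using a by (intro measurable_from_subalg[OF subalg_F a(4)]) auto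
qed

text \<open>Approximations of quality \<open>(1/4) ^ k\<close> have elementary integrals that
  satisfy the hypothesis of \<open>fast_Cauchy_limit\<close> by the isometry; their limit is a
  version.\<close>

lemma stoch_integral_existsI:
  fixes X :: "real \<Rightarrow> 'a \<Rightarrow> 'u \<Rightarrow> 'h::{real_inner, banach, second_countable_topology}"
  assumes ab: "0 \<le> a" "a \<le> b"
    and hom: "\<And>s \<omega>. homogeneous (X s \<omega>)"
    and Xm: "\<And>s u. s \<in> {a..b} \<Longrightarrow> (\<lambda>\<omega>. X s \<omega> (op_sqrt cov u)) \<in> borel_measurable (F s)"
    and approx: "\<And>\<epsilon>. 0 < \<epsilon> \<Longrightarrow> \<exists>n \<tau> L. elementary_integrand F a b n \<tau> L \<and>
        elem_dist X (elementary_value n \<tau> L) \<in> borel_measurable (restrict_space borel {a..b}) \<and>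
        (\<integral>\<^sup>+ s\<in>{a..b}. elem_dist X (elementary_value n \<tau> L) s \<partial>lborel) \<le> ennreal \<epsilon>"
  shows "\<exists>I. is_SI a b X I"
proof -
  obtain n \<tau> and L :: "nat \<Rightarrow> nat \<Rightarrow> 'a \<Rightarrow> ('u \<Rightarrow>\<^sub>L 'h)" where
    el: "\<And>k. elementary_integrand F a b (n k) (\<tau> k) (L k)"
    and meas: "\<And>k. elem_dist X (elementary_value (n k) (\<tau> k) (L k))
               \<in> borel_measurable (restrict_space borel {a..b})"
    and small: "\<And>k. (\<integral>\<^sup>+ s\<in>{a..b}. elem_dist X (elementary_value (n k) (\<tau> k) (L k)) s
               \<partial>lborel) \<le> ennreal ((1/4) ^ k)"
  proof -
    define P where "P \<epsilon> p = (case p of (n, \<tau>, L) \<Rightarrow> elementary_integrand F a b n \<tau> L \<and>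
        elem_dist X (elementary_value n \<tau> L) \<in> borel_measurable (restrict_space borel {a..b}) \<and>
        (\<integral>\<^sup>+ s\<in>{a..b}. elem_dist X (elementary_value n \<tau> L) s \<partial>lborel) \<le> ennreal \<epsilon>)"
      for \<epsilon> p
    have "\<exists>p. P ((1/4) ^ k) p" for k :: nat
      using approx[of "(1/4) ^ k"] by (auto simp: P_def)
    then obtain p where p: "\<And>k :: nat. P ((1/4) ^ k) (p k)" by metis
    show thesis
      by (rule that[of "\<lambda>k. fst (p k)" "\<lambda>k. fst (snd (p k))" "\<lambda>k. snd (snd (p k))"])
        (use p in \<open>simp_all add: P_def case_prod_beta\<close>)
  qed
  let ?d = "\<lambda>k. \<integral>\<^sup>+ s\<in>{a..b}. elem_dist X (elementary_value (n k) (\<tau> k) (L k)) s \<partial>lborel"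
  let ?E = "\<lambda>k. elementary_integral WK (n k) (\<tau> k) (L k)"
  note adm = elementary_admissible[OF el ab(1)]
  have XM: "(\<lambda>\<omega>. X s \<omega> (e j)) \<in> borel_measurable M" if "s \<in> {a..b}" "j \<in> K" for s j
    using Xm[OF that(1), of "(1 / sqrt (\<eta> j)) *\<^sub>R e j"] that ab measurable_from_subalg[OF subalg[of s]]
    by (simp add: op_sqrt_cov_preimage)
  have "mean_sq M (\<lambda>\<omega>. ?E k \<omega> - ?E l \<omega>) \<le> ennreal (4 * (1/4) ^ k)" if kl: "k \<le> l" for k l
  proof -
    have "mean_sq M (\<lambda>\<omega>. ?E k \<omega> - ?E l \<omega>) \<le> 2 * ?d k + 2 * ?d l"
      unfolding elementary_integral_eq hs_dist_eq[OF hom]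
      by (rule block_diff_le[OF adm(1) adm(1) _ _ XM])
        (use adm(2) meas in \<open>auto simp: hs_dist_eq[OF hom] cong: measurable_cong_simp\<close>)
    also have "\<dots> \<le> 2 * ennreal ((1/4) ^ k) + 2 * ennreal ((1/4) ^ l)"
      by (intro add_mono mult_left_mono small) auto
    also have "\<dots> \<le> 2 * ennreal ((1/4) ^ k) + 2 * ennreal ((1/4) ^ k)"
      using kl by (intro add_mono mult_left_mono ennreal_leI power_decreasing) auto
    also have "\<dots> = ennreal (4 * (1/4) ^ k)"
      by (simp add: ennreal_plus[symmetric] ennreal_mult'[symmetric] del: ennreal_plus flip: ennreal_numeral)
    finally show ?thesis .
  qed
  moreover have "?E k \<in> borel_measurable (F b)" for k
    unfolding elementary_integral_eq using adm(2) by (intro block_integral_measurable_F[OF adm(1)]) auto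
  ultimately obtain I where I: "I \<in> borel_measurable (F b)"
    "(\<lambda>k. \<integral>\<^sup>+ \<omega>. ennreal ((norm (?E k \<omega> - I \<omega>))\<^sup>2) \<partial>M) \<longlonglongrightarrow> 0"
    using fast_Cauchy_limit[OF subalg, of b ?E] ab by auto
  have z: "(\<lambda>k. ennreal ((1/4) ^ k)) \<longlonglongrightarrow> 0"
    using tendsto_ennrealI[OF LIMSEQ_realpow_zero[of "1/4"]] by simp
  have "?d \<longlonglongrightarrow> 0"
    by (rule tendsto_sandwich[OF _ _ tendsto_const z]) (use small in auto)
  then have "is_SI a b X I"
    unfolding is_stoch_integral_def using el meas I Xm by blast
  then show ?thesis by blast
qed

end

section \<open>Integrands that are linear in the increments\<close>

lemma partition_cell_exists:
  fixes \<tau> :: "nat \<Rightarrow> real"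
  shows "\<tau> 0 < s \<Longrightarrow> s \<le> \<tau> n \<Longrightarrow> \<exists>m<n. s \<in> {\<tau> m<..\<tau> (Suc m)}"
proof (induction n)
  case (Suc n)
  show ?case
  proof (cases "s \<le> \<tau> n")
    case True
    then show ?thesis using Suc less_Suc_eq by blast
  next
    case False
    then show ?thesis using Suc.prems by (intro exI[of _ n]) auto
  qed
qed simp

lemma partition_cell_unique:
  fixes \<tau> :: "nat \<Rightarrow> real"
  assumes "incseq \<tau>" "s \<in> {\<tau> m<..\<tau> (Suc m)}" "s \<in> {\<tau> l<..\<tau> (Suc l)}"
  shows "m = l"
proof (rule ccontr)
  assume "m \<noteq> l"
  then consider "Suc m \<le> l" | "Suc l \<le> m" by linarith
  then show False
  proof cases
    case 1 then show ?thesis using incseqD[OF assms(1) 1] assms(2,3) by simp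
  next
    case 2 then show ?thesis using incseqD[OF assms(1) 2] assms(2,3) by simp
  qed
qed

lemma sum_partition_cell:
  fixes \<tau> :: "nat \<Rightarrow> real" and f :: "nat \<Rightarrow> 'b::real_vector"
  assumes "incseq \<tau>" "s \<in> {\<tau> m<..\<tau> (Suc m)}" "m < n"
  shows "(\<Sum>l<n. indicator {\<tau> l<..\<tau> (Suc l)} s *\<^sub>R f l) = f m"
proof -
  have "(\<Sum>l<n. indicator {\<tau> l<..\<tau> (Suc l)} s *\<^sub>R f l) = (\<Sum>l<n. if l = m then f m else 0)"
  proof (intro sum.cong refl)
    fix l
    show "indicator {\<tau> l<..\<tau> (Suc l)} s *\<^sub>R f l = (if l = m then f m else 0)"
    proof (cases "l = m")
      case True
      then show ?thesis using assms(2) by simp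
    next
      case False
      then have "s \<notin> {\<tau> l<..\<tau> (Suc l)}" using partition_cell_unique[OF assms(1,2)] by blast
      then show ?thesis using False by (simp del: greaterThanAtMost_iff)
    qed
  qed
  then show ?thesis using assms(3) by simp
qed

context filtered_wiener_basis
begin

text \<open>Pythagoras: the increment after time \<open>a\<close> has mean zero and is independent
  of \<open>Y\<close>, which is known at time \<open>a\<close>, so the cross term vanishes.\<close>

lemma norm_sq_incr_add:
  fixes Y :: "'a \<Rightarrow> 'h::{real_inner, banach, second_countable_topology}"
  assumes as: "0 \<le> a" "a \<le> s" and Y: "L2_on M (F a) Y"
  shows "has_bochner_integral M (\<lambda>\<omega>. (norm ((\<Sum>i\<in>K. (incr a s \<omega> \<bullet> e i) *\<^sub>R v i) + Y \<omega>))\<^sup>2)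
    ((s - a) * (\<Sum>i\<in>K. \<eta> i * (norm (v i))\<^sup>2) + (\<integral>\<omega>. (norm (Y \<omega>))\<^sup>2 \<partial>M))"
proof -
  have "has_bochner_integral M (\<lambda>\<omega>. \<Sum>i\<in>K. \<Sum>l\<in>K. ((incr a s \<omega> \<bullet> e i) * (incr a s \<omega> \<bullet> e l)) * (v i \<bullet> v l))
     (\<Sum>i\<in>K. \<Sum>l\<in>K. ((s - a) * (Q (e i) \<bullet> e l)) * (v i \<bullet> v l))"
    by (intro has_bochner_integral_sum has_bochner_integral_mult_left incr_cov as)
  moreover have "(\<Sum>i\<in>K. \<Sum>l\<in>K. ((s - a) * (Q (e i) \<bullet> e l)) * (v i \<bullet> v l))
      = (\<Sum>i\<in>K. \<Sum>l\<in>K. if i = l then (s - a) * (\<eta> i * (norm (v i))\<^sup>2) else 0)"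
    by (intro sum.cong refl) (simp add: Q_basis power2_norm_eq_inner)
  moreover have "\<dots> = (s - a) * (\<Sum>i\<in>K. \<eta> i * (norm (v i))\<^sup>2)"
    using K by (simp add: sum_distrib_left)
  ultimately have 1: "has_bochner_integral M (\<lambda>\<omega>. \<Sum>i\<in>K. \<Sum>l\<in>K. ((incr a s \<omega> \<bullet> e i) * (incr a s \<omega> \<bullet> e l)) * (v i \<bullet> v l))
     ((s - a) * (\<Sum>i\<in>K. \<eta> i * (norm (v i))\<^sup>2))" by simp
  have cst: "L2_on M (F a) (\<lambda>\<omega>. v i)" for i by (simp add: L2_on_def)
  have [measurable]: "Y \<in> borel_measurable (F a)" using Y by (simp add: L2_on_def)
  have "has_bochner_integral M (\<lambda>\<omega>. \<Sum>i\<in>K. (v i \<bullet> Y \<omega>) * (incr a s \<omega> \<bullet> e i)) (\<Sum>i\<in>K. 0)"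
    by (intro has_bochner_integral_sum incr_orthogonal as L2_on_inner[OF subalg cst Y]) auto
  then have 2: "has_bochner_integral M (\<lambda>\<omega>. 2 * (\<Sum>i\<in>K. (v i \<bullet> Y \<omega>) * (incr a s \<omega> \<bullet> e i))) (2 * 0)"
    by (intro has_bochner_integral_mult_right) simp
  have 3: "has_bochner_integral M (\<lambda>\<omega>. (norm (Y \<omega>))\<^sup>2) (\<integral>\<omega>. (norm (Y \<omega>))\<^sup>2 \<partial>M)"
    using Y by (intro has_bochner_integral_integrable) (simp add: L2_on_def)
  have "(norm ((\<Sum>i\<in>K. (incr a s \<omega> \<bullet> e i) *\<^sub>R v i) + Y \<omega>))\<^sup>2
     = (\<Sum>i\<in>K. \<Sum>l\<in>K. ((incr a s \<omega> \<bullet> e i) * (incr a s \<omega> \<bullet> e l)) * (v i \<bullet> v l))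
      + 2 * (\<Sum>i\<in>K. (v i \<bullet> Y \<omega>) * (incr a s \<omega> \<bullet> e i)) + (norm (Y \<omega>))\<^sup>2" for \<omega>
  proof -
    let ?A = "\<Sum>i\<in>K. (incr a s \<omega> \<bullet> e i) *\<^sub>R v i"
    have "(norm (?A + Y \<omega>))\<^sup>2 = ?A \<bullet> ?A + 2 * (?A \<bullet> Y \<omega>) + (norm (Y \<omega>))\<^sup>2"
      by (simp add: power2_norm_eq_inner inner_add_left inner_add_right inner_commute)
    moreover have "?A \<bullet> Y \<omega> = (\<Sum>i\<in>K. (v i \<bullet> Y \<omega>) * (incr a s \<omega> \<bullet> e i))"
      by (simp add: inner_sum_left mult.commute)
    moreover have "?A \<bullet> ?A = (\<Sum>i\<in>K. \<Sum>l\<in>K. ((incr a s \<omega> \<bullet> e i) * (incr a s \<omega> \<bullet> e l)) * (v i \<bullet> v l))"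
      unfolding inner_sum_left inner_sum_right
      by (intro sum.cong refl) (simp only: inner_scaleR_left inner_scaleR_right mult_ac inner_commute)
    ultimately show ?thesis by simp
  qed
  then show ?thesis
    using has_bochner_integral_add[OF has_bochner_integral_add[OF 1 2] 3] by simp
qed

text \<open>With \<open>\<psi> i j = \<Psi> (\<Phi> (e i)) (e j)\<close> this is the outer integrand
  at time \<open>s\<close> in the direction \<open>e j\<close>, after the inner integral has been
  evaluated.\<close>

definition linear_path :: "('j \<Rightarrow> 'j \<Rightarrow> 'h::real_vector) \<Rightarrow> real \<Rightarrow> real \<Rightarrow> 'j \<Rightarrow> 'a \<Rightarrow> 'h" where
  "linear_path \<psi> t s j \<omega> = (\<Sum>i\<in>K. (incr t s \<omega> \<bullet> e i) *\<^sub>R \<psi> i j)"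

text \<open>The growth per unit of time of the second moment of \<open>linear_path\<close> in
  \<open>coeff_norm2\<close>. The same double sum later measures the antisymmetrised
  coefficients.\<close>

definition drift_const :: "('j \<Rightarrow> 'j \<Rightarrow> 'h::real_normed_vector) \<Rightarrow> real" where
  "drift_const \<psi> = (\<Sum>j\<in>K. \<eta> j * (\<Sum>i\<in>K. \<eta> i * (norm (\<psi> i j))\<^sup>2))"

definition grid :: "real \<Rightarrow> real \<Rightarrow> nat \<Rightarrow> nat \<Rightarrow> real" where
  "grid t h n m = t + real m * (h / real n)"

text \<open>The cost of replacing the exact increments up to the left endpoint \<open>a\<close> by
  \<open>g\<close>. It is used twice: with the exact increments, where it is 0, and with simple
  functions, as elementary integrands demand.\<close>

definition discretization_error :: "('j \<Rightarrow> 'j \<Rightarrow> 'h::real_normed_vector) \<Rightarrow> real \<Rightarrow> real \<Rightarrow> ('j \<Rightarrow> 'a \<Rightarrow> real) \<Rightarrow> real" where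
  "discretization_error \<psi> t a g =
     (\<Sum>j\<in>K. \<eta> j * (\<integral>\<omega>. (norm (\<Sum>i\<in>K. (incr t a \<omega> \<bullet> e i - g i \<omega>) *\<^sub>R \<psi> i j))\<^sup>2 \<partial>M))"

abbreviation "grid_integral t h n N \<equiv> block_integral {..<N} (grid t h n) (\<lambda>m. grid t h n (Suc m))"
abbreviation "grid_value t h n N \<equiv> block_value {..<N} (grid t h n) (\<lambda>m. grid t h n (Suc m))"

lemma grid_simps: "grid t h n 0 = t" "n > 0 \<Longrightarrow> grid t h n n = t + h"
  by (auto simp: grid_def)

lemma grid_Suc: "grid t h n (Suc m) = grid t h n m + h / real n"
  by (simp add: grid_def algebra_simps add_divide_distrib)

lemma grid_mono: "h > 0 \<Longrightarrow> incseq (grid t h n)"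
  by (auto simp: incseq_def grid_def intro!: divide_right_mono mult_right_mono)

lemma grid_ge: "h > 0 \<Longrightarrow> t \<le> grid t h n m"
  by (simp add: grid_def)

lemma grid_le:
  assumes "h > 0" "m \<le> n" "0 < n"
  shows "grid t h n m \<le> t + h"
proof -
  have "grid t h n m \<le> grid t h n n" by (rule incseqD[OF grid_mono]) (use assms in auto)
  then show ?thesis using assms(3) by (simp add: grid_simps)
qed

lemma drift_const_nonneg: "0 \<le> drift_const \<psi>"
  unfolding drift_const_def by (intro sum_nonneg mult_nonneg_nonneg) (auto simp: eta_nonneg)

section \<open>Step approximations of a linear path\<close>

context
  fixes \<psi> :: "'j \<Rightarrow> 'j \<Rightarrow> 'h::{real_inner, banach, second_countable_topology}"
    and X :: "real \<Rightarrow> 'a \<Rightarrow> 'u \<Rightarrow> 'h" and t h :: real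
  assumes th: "0 \<le> t" "0 < h"
    and X: "\<And>s j. s \<in> {t..t + h} \<Longrightarrow> j \<in> K \<Longrightarrow> AE \<omega> in M. X s \<omega> (e j) = linear_path \<psi> t s j \<omega>"
begin

lemma L2_on_linear_path:
  assumes "t \<le> s"
  shows "L2_on M (F s) (linear_path \<psi> t s j)"
  unfolding linear_path_def using th assms
  by (intro L2_on_sum[OF subalg] L2_on_scaleR_left[OF subalg] L2_on_incr) auto

lemma admissible_step:
  assumes "0 < n" and g: "\<And>m i. m < n \<Longrightarrow> i \<in> K \<Longrightarrow> L2_on M (F (grid t h n m)) (g m i)"
  shows "admissible {..<n} (grid t h n) (\<lambda>m. grid t h n (Suc m)) (\<lambda>m j \<omega>. \<Sum>i\<in>K. g m i \<omega> *\<^sub>R \<psi> i j)"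
  unfolding admissible_def
proof (intro conjI ballI)
  fix m assume m: "m \<in> {..<n}"
  show ge: "0 \<le> grid t h n m" using grid_ge[OF th(2)] th(1) order_trans by blast
  show "grid t h n m \<le> grid t h n (Suc m)" using th by (simp add: grid_Suc)
  show "L2_on M (F (grid t h n m)) (\<lambda>\<omega>. \<Sum>i\<in>K. g m i \<omega> *\<^sub>R \<psi> i j)" if "j \<in> K" for j
    using m g by (intro L2_on_sum[OF subalg[OF ge]] L2_on_scaleR_left[OF subalg[OF ge]]) auto
qed simp

text \<open>In the cell of \<open>s\<close> the difference is the increment since the left endpoint
  plus an error known at that endpoint, to which \<open>norm_sq_incr_add\<close> applies.\<close>

lemma step_dist:
  assumes n: "0 < n" and g: "\<And>m i. m < n \<Longrightarrow> i \<in> K \<Longrightarrow> L2_on M (F (grid t h n m)) (g m i)"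
    and s: "s \<in> {t..t + h}"
  shows "coeff_norm2 (\<lambda>j \<omega>. X s \<omega> (e j)
      - grid_value t h n n (\<lambda>m j \<omega>. \<Sum>i\<in>K. g m i \<omega> *\<^sub>R \<psi> i j) s j \<omega>)
    = ennreal (\<Sum>m<n. indicator {grid t h n m<..grid t h n (Suc m)} s *\<^sub>R
        ((s - grid t h n m) * drift_const \<psi> + discretization_error \<psi> t (grid t h n m) (g m)))"
    (is "coeff_norm2 (\<lambda>j \<omega>. X s \<omega> (e j) - ?V s j \<omega>) = _")
proof -
  \<comment> \<open>The exceptional set may depend on \<open>s\<close>. That is harmless because
    \<open>coeff_norm2\<close> takes the expectation at fixed \<open>s\<close>, and \<open>K\<close>
    is finite.\<close>
  have "AE \<omega> in M. \<forall>j\<in>K. X s \<omega> (e j) = linear_path \<psi> t s j \<omega>"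
    using X[OF s] K(1) by (subst AE_finite_all) auto
  then have X': "coeff_norm2 (\<lambda>j \<omega>. X s \<omega> (e j) - ?V s j \<omega>) = coeff_norm2 (\<lambda>j \<omega>. linear_path \<psi> t s j \<omega> - ?V s j \<omega>)"
    unfolding coeff_norm2_def by (intro nn_integral_cong_AE) (auto elim!: eventually_mono)
  show ?thesis
  proof (cases "s = t")
    case True
    \<comment> \<open>The left end \<open>s = t\<close> lies in no cell; the step process and the
      path both vanish there.\<close>
    have out: "s \<notin> {grid t h n m<..grid t h n (Suc m)}" for m using grid_ge[OF th(2), of t n m] True by auto
    have "linear_path \<psi> t s j \<omega> - ?V s j \<omega> = 0" for j \<omega>
      using out True by (simp add: linear_path_def incr_self block_value_def del: greaterThanAtMost_iff)
    then show ?thesis unfolding X' using out by (simp add: coeff_norm2_def del: greaterThanAtMost_iff)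
  next
    case False
    then obtain m where m: "m < n" "s \<in> {grid t h n m<..grid t h n (Suc m)}"
      using partition_cell_exists[of "grid t h n" s n] s n by (auto simp: grid_simps)
    let ?a = "grid t h n m"
    note cell = sum_partition_cell[OF grid_mono[OF th(2)] m(2,1)]
    have a: "0 \<le> ?a" "?a \<le> s" "t \<le> ?a" using grid_ge[OF th(2), of t n m] th m by auto
    let ?Y = "\<lambda>j \<omega>. \<Sum>i\<in>K. (incr t ?a \<omega> \<bullet> e i - g m i \<omega>) *\<^sub>R \<psi> i j"
    have Y: "L2_on M (F ?a) (?Y j)" for j
      using th a m g by (intro L2_on_sum[OF subalg] L2_on_scaleR_left[OF subalg] L2_on_diff[OF subalg] L2_on_incr) auto
    have eq: "linear_path \<psi> t s j \<omega> - ?V s j \<omega> = (\<Sum>i\<in>K. (incr ?a s \<omega> \<bullet> e i) *\<^sub>R \<psi> i j) + ?Y j \<omega>" for j \<omega>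
    proof -
      have "?V s j \<omega> = (\<Sum>i\<in>K. g m i \<omega> *\<^sub>R \<psi> i j)" unfolding block_value_def by (rule cell)
      moreover have "linear_path \<psi> t s j \<omega> = (\<Sum>i\<in>K. (incr ?a s \<omega> \<bullet> e i) *\<^sub>R \<psi> i j) + (\<Sum>i\<in>K. (incr t ?a \<omega> \<bullet> e i) *\<^sub>R \<psi> i j)"
        unfolding linear_path_def sum.distrib[symmetric] incr_add[of t ?a \<omega> s, symmetric]
        by (intro sum.cong refl) (simp add: inner_add_left scaleR_left_distrib)
      ultimately show ?thesis by (simp add: scaleR_left_diff_distrib sum_subtractf)
    qed
    have L2: "L2_on M M (\<lambda>\<omega>. linear_path \<psi> t s j \<omega> - ?V s j \<omega>)" if "j \<in> K" for j
    proof (intro L2_on_diff[OF subalg_refl])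
      show "L2_on M M (linear_path \<psi> t s j)" using L2_on_M[OF _ L2_on_linear_path] th s by auto
      have "L2_on M M (\<lambda>\<omega>. \<Sum>i\<in>K. g m i \<omega> *\<^sub>R \<psi> i j)"
        using g[OF m(1)] a
        by (intro L2_on_sum[OF subalg_refl] L2_on_scaleR_left[OF subalg_refl] L2_on_M[OF a(1)]) auto
      then show "L2_on M M (?V s j)" unfolding block_value_def[abs_def] cell .
    qed
    have "coeff_norm2 (\<lambda>j \<omega>. linear_path \<psi> t s j \<omega> - ?V s j \<omega>)
      = ennreal (\<Sum>j\<in>K. \<eta> j * (\<integral>\<omega>. (norm (linear_path \<psi> t s j \<omega> - ?V s j \<omega>))\<^sup>2 \<partial>M))"
      using L2 by (rule coeff_norm2_integral)
    also have "(\<Sum>j\<in>K. \<eta> j * (\<integral>\<omega>. (norm (linear_path \<psi> t s j \<omega> - ?V s j \<omega>))\<^sup>2 \<partial>M))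
      = (\<Sum>j\<in>K. \<eta> j * ((s - ?a) * (\<Sum>i\<in>K. \<eta> i * (norm (\<psi> i j))\<^sup>2) + (\<integral>\<omega>. (norm (?Y j \<omega>))\<^sup>2 \<partial>M)))"
      unfolding eq using norm_sq_incr_add[OF a(1,2) Y] by (simp add: has_bochner_integral_iff)
    also have "\<dots> = (s - ?a) * drift_const \<psi> + discretization_error \<psi> t ?a (g m)"
      by (simp add: drift_const_def discretization_error_def sum_distrib_left sum.distrib distrib_left mult.left_commute)
    finally show ?thesis unfolding X' cell .
  qed
qed

lemma step_dist_measurable:
  assumes n: "0 < n" and g: "\<And>m i. m < n \<Longrightarrow> i \<in> K \<Longrightarrow> L2_on M (F (grid t h n m)) (g m i)"
  shows "(\<lambda>s. coeff_norm2 (\<lambda>j \<omega>. X s \<omega> (e j)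
      - grid_value t h n n (\<lambda>m j \<omega>. \<Sum>i\<in>K. g m i \<omega> *\<^sub>R \<psi> i j) s j \<omega>))
    \<in> borel_measurable (restrict_space borel {t..t + h})" (is "?f \<in> _")
proof -
  have "(\<lambda>s. ennreal (\<Sum>m<n. indicator {grid t h n m<..grid t h n (Suc m)} s *\<^sub>R
        ((s - grid t h n m) * drift_const \<psi> + discretization_error \<psi> t (grid t h n m) (g m))))
      \<in> borel_measurable (restrict_space borel {t..t + h})"
    by (rule measurable_restrict_space1) measurable
  then show ?thesis
    by (rule measurable_cong[THEN iffD1, rotated]) (use step_dist[OF assms] in \<open>auto simp: space_restrict_space\<close>)
qed

lemma step_dist_integral_le:
  assumes n: "0 < n" and g: "\<And>m i. m < n \<Longrightarrow> i \<in> K \<Longrightarrow> L2_on M (F (grid t h n m)) (g m i)"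
    and \<delta>: "\<And>m. m < n \<Longrightarrow> discretization_error \<psi> t (grid t h n m) (g m) \<le> \<delta>" "0 \<le> \<delta>"
  shows "(\<integral>\<^sup>+ s\<in>{t..t + h}. coeff_norm2 (\<lambda>j \<omega>. X s \<omega> (e j)
      - grid_value t h n n (\<lambda>m j \<omega>. \<Sum>i\<in>K. g m i \<omega> *\<^sub>R \<psi> i j) s j \<omega>) \<partial>lborel)
    \<le> ennreal (h * (h / real n * drift_const \<psi> + \<delta>))" (is "(\<integral>\<^sup>+ s\<in>_. ?D s \<partial>_) \<le> _")
proof -
  let ?B = "h / real n * drift_const \<psi> + \<delta>"
  have B0: "0 \<le> ?B" using th \<delta>(2) by (intro add_nonneg_nonneg mult_nonneg_nonneg drift_const_nonneg) auto
  have "?D s \<le> ennreal ?B" if s: "s \<in> {t..t + h}" for s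
  proof -
    have "(\<Sum>m<n. indicator {grid t h n m<..grid t h n (Suc m)} s *\<^sub>R
        ((s - grid t h n m) * drift_const \<psi> + discretization_error \<psi> t (grid t h n m) (g m))) \<le> ?B"
      (is "?S \<le> _")
    proof (cases "s = t")
      case True
      have "s \<notin> {grid t h n m<..grid t h n (Suc m)}" for m using grid_ge[OF th(2), of t n m] True by auto
      then show ?thesis using B0 by (simp del: greaterThanAtMost_iff)
    next
      case False
      then obtain m where m: "m < n" "s \<in> {grid t h n m<..grid t h n (Suc m)}"
        using partition_cell_exists[of "grid t h n" s n] s n by (auto simp: grid_simps)
      have "?S = (s - grid t h n m) * drift_const \<psi> + discretization_error \<psi> t (grid t h n m) (g m)"
        by (rule sum_partition_cell[OF grid_mono[OF th(2)] m(2,1)])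
      also have "\<dots> \<le> ?B"
        using m \<delta>(1)[OF m(1)] by (intro add_mono mult_right_mono drift_const_nonneg) (auto simp: grid_Suc)
      finally show ?thesis .
    qed
    moreover have "?D s = ennreal ?S" by (rule step_dist) (use n g s in auto)
    ultimately show ?thesis by (simp only: ennreal_leI)
  qed
  then have "(\<integral>\<^sup>+ s\<in>{t..t + h}. ?D s \<partial>lborel) \<le> (\<integral>\<^sup>+ s\<in>{t..t + h}. ennreal ?B \<partial>lborel)"
    by (intro nn_integral_mono) (auto simp: indicator_def)
  also have "\<dots> = ennreal ?B * ennreal h"
    using th by (simp add: nn_integral_cmult_indicator)
  also have "\<dots> = ennreal (h * ?B)"
    using th B0 by (simp add: ennreal_mult[symmetric] mult.commute)
  finally show ?thesis .
qed

text \<open>With exact left endpoint increments only the oscillation within a cell of length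
  \<open>h / real n\<close> is left, so every version is within order \<open>1 / real n\<close> of
  the grid sum in mean square.\<close>

lemma stoch_integral_step_dist:
  assumes n: "0 < n" and hom: "\<And>s \<omega>. homogeneous (X s \<omega>)" and I: "is_SI t (t + h) X I"
  shows "mean_sq M (\<lambda>\<omega>. I \<omega> - grid_integral t h n n
        (\<lambda>m. linear_path \<psi> t (grid t h n m)) \<omega>)
    \<le> ennreal (4 * (h * (h / real n * drift_const \<psi>)))"
proof -
  let ?g = "\<lambda>m i \<omega>. incr t (grid t h n m) \<omega> \<bullet> e i"
  have g: "L2_on M (F (grid t h n m)) (?g m i)" for m i
    using th grid_ge[OF th(2)] by (intro L2_on_incr) auto
  have lp: "(\<lambda>m. linear_path \<psi> t (grid t h n m)) = (\<lambda>m j \<omega>. \<Sum>i\<in>K. ?g m i \<omega> *\<^sub>R \<psi> i j)"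
    by (simp add: linear_path_def fun_eq_iff)
  have err: "discretization_error \<psi> t (grid t h n m) (?g m) = 0" for m
    by (simp add: discretization_error_def)
  have "mean_sq M (\<lambda>\<omega>. I \<omega> - grid_integral t h n n
        (\<lambda>m. linear_path \<psi> t (grid t h n m)) \<omega>)
    \<le> 4 * (\<integral>\<^sup>+ s\<in>{t..t + h}. coeff_norm2 (\<lambda>j \<omega>. X s \<omega> (e j)
      - grid_value t h n n (\<lambda>m j \<omega>. \<Sum>i\<in>K. ?g m i \<omega> *\<^sub>R \<psi> i j) s j \<omega>) \<partial>lborel)"
    unfolding lp
    by (rule stoch_integral_dist_le[OF th(1) _ I hom admissible_step[OF n g] _ step_dist_measurable[OF n g]])
      (use th grid_ge[OF th(2)] grid_le[OF th(2)] n in auto)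
  also have "\<dots> \<le> 4 * ennreal (h * (h / real n * drift_const \<psi> + 0))"
    by (intro mult_left_mono step_dist_integral_le n g) (auto simp: err)
  also have "\<dots> = ennreal (4 * (h * (h / real n * drift_const \<psi>)))"
    using th drift_const_nonneg by (simp add: ennreal_mult'[symmetric] flip: ennreal_numeral)
  finally show ?thesis .
qed

end

text \<open>Elementary integrands take finitely many values, which increments of the process need
  not do. The approximants satisfy
  \<open>\<bar>g i \<omega>\<bar> \<le> 2 * \<bar>f \<omega>\<bar>\<close>, so 9 times the square of
  \<open>f\<close> dominates the squared errors.\<close>

lemma simple_L2_approx:
  fixes f :: "'a \<Rightarrow> real"
  assumes s: "0 \<le> s" and f: "L2_on M (F s) f" and \<epsilon>: "0 < \<epsilon>"
  shows "\<exists>g. simple_function (F s) g \<and> (\<integral>\<omega>. (f \<omega> - g \<omega>)\<^sup>2 \<partial>M) \<le> \<epsilon>"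
proof -
  have fF: "f \<in> borel_measurable (F s)" using f by (simp add: L2_on_def)
  obtain g where g: "\<And>i. simple_function (F s) (g i)"
    "\<And>x. x \<in> space (F s) \<Longrightarrow> (\<lambda>i. g i x) \<longlonglongrightarrow> f x"
    "\<And>i x. x \<in> space (F s) \<Longrightarrow> dist (g i x) 0 \<le> 2 * dist (f x) 0"
    using borel_measurable_implies_sequence_metric[OF fF, of 0] by metis
  have [measurable]: "f \<in> borel_measurable M" "\<And>i. g i \<in> borel_measurable M"
    using fF borel_measurable_simple_function[OF g(1)] measurable_from_subalg[OF subalg[OF s]] by blast+
  have "(\<lambda>i. \<integral>\<omega>. (f \<omega> - g i \<omega>)\<^sup>2 \<partial>M) \<longlonglongrightarrow> (\<integral>\<omega>. 0 \<partial>M)"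
  proof (rule integral_dominated_convergence[where w = "\<lambda>\<omega>. 9 * (norm (f \<omega>))\<^sup>2"])
    show "integrable M (\<lambda>\<omega>. 9 * (norm (f \<omega>))\<^sup>2)" using f by (simp add: L2_on_def)
    show "AE \<omega> in M. (\<lambda>i. (f \<omega> - g i \<omega>)\<^sup>2) \<longlonglongrightarrow> 0"
    proof (intro AE_I2)
      fix \<omega> assume "\<omega> \<in> space M"
      then have "(\<lambda>i. g i \<omega>) \<longlonglongrightarrow> f \<omega>" using g(2) space_F[OF s] by simp
      then have "(\<lambda>i. (f \<omega> - g i \<omega>)\<^sup>2) \<longlonglongrightarrow> (f \<omega> - f \<omega>)\<^sup>2" by (intro tendsto_intros)
      then show "(\<lambda>i. (f \<omega> - g i \<omega>)\<^sup>2) \<longlonglongrightarrow> 0" by simp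
    qed
    show "AE \<omega> in M. norm ((f \<omega> - g i \<omega>)\<^sup>2) \<le> 9 * (norm (f \<omega>))\<^sup>2" for i
    proof (intro AE_I2)
      fix \<omega> assume "\<omega> \<in> space M"
      then have "\<bar>g i \<omega>\<bar> \<le> 2 * \<bar>f \<omega>\<bar>" using g(3)[of \<omega> i] space_F[OF s] by simp
      then have "\<bar>f \<omega> - g i \<omega>\<bar> \<le> 3 * \<bar>f \<omega>\<bar>" by linarith
      then have "\<bar>f \<omega> - g i \<omega>\<bar>\<^sup>2 \<le> (3 * \<bar>f \<omega>\<bar>)\<^sup>2" by (intro power_mono) auto
      then show "norm ((f \<omega> - g i \<omega>)\<^sup>2) \<le> 9 * (norm (f \<omega>))\<^sup>2" by (simp add: power_mult_distrib)
    qed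
  qed measurable
  then have "eventually (\<lambda>i. (\<integral>\<omega>. (f \<omega> - g i \<omega>)\<^sup>2 \<partial>M) < \<epsilon>) sequentially"
    using \<epsilon> by (intro order_tendstoD) auto
  then obtain i where "(\<integral>\<omega>. (f \<omega> - g i \<omega>)\<^sup>2 \<partial>M) < \<epsilon>" by (auto simp: eventually_sequentially)
  then show ?thesis using g(1) by (intro exI[of _ "g i"]) auto
qed

text \<open>Cauchy-Schwarz over \<open>K\<close>. The factor \<open>card K\<close> is harmless,
  since this estimate serves the existence of the integral and not the final bound.\<close>

lemma discretization_error_le:
  fixes \<psi> :: "'j \<Rightarrow> 'j \<Rightarrow> 'h::{real_inner, banach, second_countable_topology}"
  assumes ta: "0 \<le> t" "t \<le> a" and g: "\<And>i. i \<in> K \<Longrightarrow> L2_on M (F a) (g i)"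
    and d: "\<And>i. i \<in> K \<Longrightarrow> (\<integral>\<omega>. (incr t a \<omega> \<bullet> e i - g i \<omega>)\<^sup>2 \<partial>M) \<le> \<epsilon>"
  shows "discretization_error \<psi> t a g \<le> real (card K) * \<epsilon> * (\<Sum>j\<in>K. \<eta> j * (\<Sum>i\<in>K. (norm (\<psi> i j))\<^sup>2))"
proof -
  let ?d = "\<lambda>i \<omega>. incr t a \<omega> \<bullet> e i - g i \<omega>"
  have a: "0 \<le> a" using ta by simp
  have L2: "L2_on M (F a) (?d i)" if "i \<in> K" for i
    using ta g[OF that] by (intro L2_on_diff[OF subalg] L2_on_incr) auto
  have int: "integrable M (\<lambda>\<omega>. (?d i \<omega>)\<^sup>2)" if "i \<in> K" for i
    using L2[OF that] by (simp add: L2_on_def)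
  have "(\<integral>\<omega>. (norm (\<Sum>i\<in>K. ?d i \<omega> *\<^sub>R \<psi> i j))\<^sup>2 \<partial>M) \<le> real (card K) * \<epsilon> * (\<Sum>i\<in>K. (norm (\<psi> i j))\<^sup>2)" for j
  proof -
    have pt: "(norm (\<Sum>i\<in>K. ?d i \<omega> *\<^sub>R \<psi> i j))\<^sup>2 \<le> (\<Sum>i\<in>K. (?d i \<omega>)\<^sup>2) * (\<Sum>i\<in>K. (norm (\<psi> i j))\<^sup>2)" for \<omega>
    proof -
      have "norm (\<Sum>i\<in>K. ?d i \<omega> *\<^sub>R \<psi> i j) \<le> (\<Sum>i\<in>K. \<bar>?d i \<omega>\<bar> * \<bar>norm (\<psi> i j)\<bar>)"
        by (rule order_trans[OF norm_sum]) simp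
      also have "\<dots> \<le> sqrt (\<Sum>i\<in>K. (?d i \<omega>)\<^sup>2) * sqrt (\<Sum>i\<in>K. (norm (\<psi> i j))\<^sup>2)" by (rule sum_mult_le_sqrt)
      finally have "(norm (\<Sum>i\<in>K. ?d i \<omega> *\<^sub>R \<psi> i j))\<^sup>2 \<le> (sqrt (\<Sum>i\<in>K. (?d i \<omega>)\<^sup>2) * sqrt (\<Sum>i\<in>K. (norm (\<psi> i j))\<^sup>2))\<^sup>2"
        by (intro power_mono) auto
      then show ?thesis by (simp add: power_mult_distrib sum_nonneg)
    qed
    have "L2_on M (F a) (\<lambda>\<omega>. \<Sum>i\<in>K. ?d i \<omega> *\<^sub>R \<psi> i j)"
      using L2 a by (intro L2_on_sum[OF subalg] L2_on_scaleR_left[OF subalg]) auto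
    then have "(\<integral>\<omega>. (norm (\<Sum>i\<in>K. ?d i \<omega> *\<^sub>R \<psi> i j))\<^sup>2 \<partial>M)
        \<le> (\<integral>\<omega>. (\<Sum>i\<in>K. (?d i \<omega>)\<^sup>2) * (\<Sum>i\<in>K. (norm (\<psi> i j))\<^sup>2) \<partial>M)"
      using int pt by (intro integral_mono) (auto simp: L2_on_def)
    also have "\<dots> = (\<Sum>i\<in>K. \<integral>\<omega>. (?d i \<omega>)\<^sup>2 \<partial>M) * (\<Sum>i\<in>K. (norm (\<psi> i j))\<^sup>2)"
      using int by simp
    also have "\<dots> \<le> (real (card K) * \<epsilon>) * (\<Sum>i\<in>K. (norm (\<psi> i j))\<^sup>2)"
      using sum_bounded_above[of K, OF d] by (intro mult_right_mono sum_nonneg) auto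
    finally show ?thesis .
  qed
  then have "discretization_error \<psi> t a g \<le> (\<Sum>j\<in>K. \<eta> j * (real (card K) * \<epsilon> * (\<Sum>i\<in>K. (norm (\<psi> i j))\<^sup>2)))"
    unfolding discretization_error_def by (intro sum_mono mult_left_mono eta_nonneg)
  also have "\<dots> = real (card K) * \<epsilon> * (\<Sum>j\<in>K. \<eta> j * (\<Sum>i\<in>K. (norm (\<psi> i j))\<^sup>2))"
    by (simp add: sum_distrib_left mult_ac)
  finally show ?thesis .
qed

text \<open>Any values at finitely many orthonormal vectors are taken by an operator of finite rank.
  This supplies operator-valued coefficients for elementary integrands and a bounded representative
  of the restricted \<open>\<Phi>\<close> on the \<open>e j\<close>.\<close>

lemma coeff_blinfun_exists: "\<exists>L :: 'u \<Rightarrow>\<^sub>L 'h::real_normed_vector. \<forall>j\<in>K. blinfun_apply L (e j) = v j"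
proof -
  let ?f = "\<lambda>x. \<Sum>j\<in>K. (x \<bullet> e j) *\<^sub>R v j"
  have "bounded_linear ?f"
    by (intro bounded_linear_sum bounded_linear_compose[OF bounded_linear_scaleR_left] bounded_linear_inner_left)
  then have "blinfun_apply (Blinfun ?f) = ?f" by (rule bounded_linear_Blinfun_apply)
  moreover have "?f (e j) = v j" if "j \<in> K" for j
  proof -
    have "?f (e j) = (\<Sum>i\<in>K. if j = i then v j else 0)"
      using that by (intro sum.cong refl) (auto simp: orthonormal)
    then show ?thesis using that K(1) by simp
  qed
  ultimately show ?thesis by (intro exI[of _ "Blinfun ?f"]) simp
qed

lemma linear_path_stoch_integral_exists:
  fixes \<psi> :: "'j \<Rightarrow> 'j \<Rightarrow> 'h::{real_inner, banach, second_countable_topology}"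
    and X :: "real \<Rightarrow> 'a \<Rightarrow> 'u \<Rightarrow> 'h" and t h :: real
  assumes th: "0 \<le> t" "0 < h"
    and hom: "\<And>s \<omega>. homogeneous (X s \<omega>)"
    and Xm: "\<And>s u. s \<in> {t..t + h} \<Longrightarrow> (\<lambda>\<omega>. X s \<omega> (op_sqrt cov u)) \<in> borel_measurable (F s)"
    and X: "\<And>s j. s \<in> {t..t + h} \<Longrightarrow> j \<in> K \<Longrightarrow> AE \<omega> in M. X s \<omega> (e j) = linear_path \<psi> t s j \<omega>"
  shows "\<exists>I. is_SI t (t + h) X I"
proof (rule stoch_integral_existsI[OF th(1) _ hom Xm])
  show "t \<le> t + h" using th by simp
  fix \<epsilon> :: real assume \<epsilon>: "0 < \<epsilon>"
  define C where "C = (\<Sum>j\<in>K. \<eta> j * (\<Sum>i\<in>K. (norm (\<psi> i j))\<^sup>2))"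
  have C0: "0 \<le> C" unfolding C_def by (intro sum_nonneg mult_nonneg_nonneg) (auto simp: eta_nonneg)
  \<comment> \<open>The budget is halved: the mesh and the rounding to simple functions may each
    cost \<open>\<delta>\<close> per unit of time, on an interval of length
    \<open>h\<close>.\<close>
  define \<delta> where "\<delta> = \<epsilon> / (2 * h)"
  have \<delta>: "0 < \<delta>" using \<epsilon> th by (simp add: \<delta>_def)
  define \<epsilon>' where "\<epsilon>' = \<delta> / (real (card K) * C + 1)"
  have den: "0 < real (card K) * C + 1" using C0 by (simp add: add_nonneg_pos)
  have \<epsilon>': "0 < \<epsilon>'" using \<delta> den by (simp add: \<epsilon>'_def)
  have \<epsilon>'C: "real (card K) * \<epsilon>' * C \<le> \<delta>"
  proof -
    have "\<epsilon>' * (real (card K) * C) \<le> \<epsilon>' * (real (card K) * C + 1)" using \<epsilon>' by simp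
    also have "\<dots> = \<delta>" using den by (simp add: \<epsilon>'_def)
    finally show ?thesis by (simp add: mult_ac)
  qed
  obtain N where N: "1 / real (Suc N) < \<delta> / (h * drift_const \<psi> + 1)"
  proof -
    have "0 < \<delta> / (h * drift_const \<psi> + 1)" using \<delta> th drift_const_nonneg[of \<psi>] by (simp add: add_nonneg_pos)
    then show thesis using that nat_approx_posE by blast
  qed
  define n where "n = Suc N"
  have n: "0 < n" by (simp add: n_def)
  have fine: "h / real n * drift_const \<psi> \<le> \<delta>"
  proof -
    have pos: "0 < h * drift_const \<psi> + 1" using th drift_const_nonneg[of \<psi>] by (simp add: add_nonneg_pos)
    have "h / real n * drift_const \<psi> \<le> (1 / real n) * (h * drift_const \<psi> + 1)"
      by (simp add: divide_right_mono)
    also have "\<dots> \<le> \<delta> / (h * drift_const \<psi> + 1) * (h * drift_const \<psi> + 1)"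
      using N pos by (intro mult_right_mono) (auto simp: n_def)
    also have "\<dots> = \<delta>" using pos by simp
    finally show ?thesis .
  qed
  let ?\<tau> = "grid t h n"
  have ge: "0 \<le> ?\<tau> m" "t \<le> ?\<tau> m" for m using grid_ge[OF th(2)] th(1) order_trans by blast+
  have "\<exists>g. simple_function (F (?\<tau> m)) g \<and> (\<integral>\<omega>. (incr t (?\<tau> m) \<omega> \<bullet> e i - g \<omega>)\<^sup>2 \<partial>M) \<le> \<epsilon>'" for m i
    using th ge by (intro simple_L2_approx L2_on_incr \<epsilon>') auto
  then obtain g where g: "\<And>m i. simple_function (F (?\<tau> m)) (g m i)"
    "\<And>m i. (\<integral>\<omega>. (incr t (?\<tau> m) \<omega> \<bullet> e i - g m i \<omega>)\<^sup>2 \<partial>M) \<le> \<epsilon>'" by metis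
  have gL2: "L2_on M (F (?\<tau> m)) (g m i)" for m i by (rule L2_on_simple[OF ge(1) g(1)])
  obtain \<Lambda> :: "'j \<Rightarrow> 'u \<Rightarrow>\<^sub>L 'h" where \<Lambda>: "\<And>i j. j \<in> K \<Longrightarrow> blinfun_apply (\<Lambda> i) (e j) = \<psi> i j"
  proof -
    have "\<forall>i. \<exists>L :: 'u \<Rightarrow>\<^sub>L 'h. \<forall>j\<in>K. blinfun_apply L (e j) = \<psi> i j"
      by (intro allI coeff_blinfun_exists)
    then show thesis using that by metis
  qed
  define L where "L m \<omega> = (\<Sum>i\<in>K. g m i \<omega> *\<^sub>R \<Lambda> i)" for m \<omega>
  have Lj: "eval_coeff L m j \<omega> = (\<Sum>i\<in>K. g m i \<omega> *\<^sub>R \<psi> i j)" if "j \<in> K" for m j \<omega>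
    using that by (simp add: eval_coeff_def L_def blinfun.sum_left blinfun.scaleR_left \<Lambda>)
  have el: "elementary_integrand F t (t + h) n ?\<tau> L"
    unfolding elementary_integrand_def
  proof (intro conjI allI impI)
    show "?\<tau> 0 = t" "?\<tau> n = t + h" using n by (auto simp: grid_simps)
    show "?\<tau> m < ?\<tau> (Suc m)" for m using th n by (simp add: grid_Suc)
    show "simple_function (F (?\<tau> m)) (L m)" for m
      unfolding L_def by (intro simple_function_sum simple_function_compose1[OF g(1)])
  qed
  let ?V = "block_value {..<n} ?\<tau> (\<lambda>m. ?\<tau> (Suc m)) (\<lambda>m j \<omega>. \<Sum>i\<in>K. g m i \<omega> *\<^sub>R \<psi> i j)"
  have dist: "elem_dist X (elementary_value n ?\<tau> L) s
      = coeff_norm2 (\<lambda>j \<omega>. X s \<omega> (e j) - ?V s j \<omega>)" for s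
    unfolding hs_dist_eq[OF hom] coeff_norm2_def block_value_def
    by (intro nn_integral_cong sum.cong refl) (simp only: Lj)
  have "discretization_error \<psi> t (?\<tau> m) (g m) \<le> \<delta>" for m
  proof -
    have "discretization_error \<psi> t (?\<tau> m) (g m) \<le> real (card K) * \<epsilon>' * C"
      unfolding C_def by (rule discretization_error_le[OF th(1) ge(2) gL2 g(2)])
    then show ?thesis using \<epsilon>'C by simp
  qed
  then have "(\<integral>\<^sup>+ s\<in>{t..t + h}. coeff_norm2 (\<lambda>j \<omega>. X s \<omega> (e j) - ?V s j \<omega>) \<partial>lborel)
      \<le> ennreal (h * (h / real n * drift_const \<psi> + \<delta>))"
    using \<delta> by (intro step_dist_integral_le[OF th X] n gL2) auto
  also have "h * (h / real n * drift_const \<psi> + \<delta>) \<le> h * (\<delta> + \<delta>)"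
    using fine th by (intro mult_left_mono add_mono) auto
  then have "ennreal (h * (h / real n * drift_const \<psi> + \<delta>)) \<le> ennreal \<epsilon>"
    using th by (intro ennreal_leI) (simp add: \<delta>_def)
  finally have small: "(\<integral>\<^sup>+ s\<in>{t..t + h}. coeff_norm2 (\<lambda>j \<omega>. X s \<omega> (e j) - ?V s j \<omega>) \<partial>lborel) \<le> ennreal \<epsilon>" .
  have "(\<lambda>s. coeff_norm2 (\<lambda>j \<omega>. X s \<omega> (e j) - ?V s j \<omega>)) \<in> borel_measurable (restrict_space borel {t..t + h})"
    by (rule step_dist_measurable[OF th X n gL2])
  with el small show "\<exists>n \<tau> L. elementary_integrand F t (t + h) n \<tau> L \<and>
        elem_dist X (elementary_value n \<tau> L) \<in> borel_measurable (restrict_space borel {t..t + h}) \<and>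
        (\<integral>\<^sup>+ s\<in>{t..t + h}. elem_dist X (elementary_value n \<tau> L) s \<partial>lborel) \<le> ennreal \<epsilon>"
    by (intro exI[of _ n] exI[of _ ?\<tau>] exI[of _ L]) (simp add: dist[abs_def])
qed auto

end

section \<open>Fourier coefficients and the kernel of the truncated area\<close>

lemma set_integral_rescale:
  fixes f :: "real \<Rightarrow> real"
  assumes h: "0 < h" and f: "continuous_on {0..h} f"
  shows "(LINT u:{0..h}|lborel. f u) = h * integral {0..1} (\<lambda>x. f (h * x))"
proof -
  have "set_integrable lborel {0..h} f" by (rule borel_integrable_atLeastAtMost'[OF f])
  then have "(LINT u:{0..h}|lborel. f u) = integral {0..h} f" by (rule set_borel_integral_eq_integral)
  moreover have "((\<lambda>x. f (h *\<^sub>R x + 0)) has_integral integral {0..h} f /\<^sub>R h ^ DIM(real)) (cbox ((0 - 0) /\<^sub>R h) ((h - 0) /\<^sub>R h))"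
    by (rule has_integral_affinity'[OF _ h]) (use integrable_integral[OF integrable_continuous_real[OF f]] in simp)
  then have "((\<lambda>x. f (h * x)) has_integral integral {0..h} f / h) {0..1}"
    using h by (simp add: divide_inverse_commute)
  ultimately show ?thesis using h by (simp add: integral_unique)
qed

lemma real_trig_derivs:
  "((\<lambda>x. sin (2 * real r * pi * x)) has_real_derivative 2 * real r * pi * cos (2 * real r * pi * x)) (at x)"
  "((\<lambda>x. cos (2 * real r * pi * x)) has_real_derivative - (2 * real r * pi * sin (2 * real r * pi * x))) (at x)"
  by (auto intro!: derivative_eq_intros)

section \<open>Fourier coefficients of a continuous path\<close>

context
  fixes w :: "real \<Rightarrow> real" and h :: real and r :: nat
  assumes h: "0 < h" and r: "0 < r" and w: "continuous_on {0..h} w" and w0: "w 0 = 0"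
begin

lemma rescaled_continuous: "continuous_on {0..1} (\<lambda>x. w (h * x))"
  by (rule continuous_on_compose2[OF w]) (use h in \<open>auto intro!: continuous_intros mult_left_le\<close>)

text \<open>Separates the path from its linear interpolation, whose share depends on the test
  function only through the first moment \<open>c\<close>: 0 for the cosine,
  \<open>- 1 / (2 * real r * pi)\<close> for the sine.\<close>

lemma bridge_integral:
  assumes \<phi>: "continuous_on UNIV \<phi>" and I: "((\<lambda>x. x * \<phi> x) has_integral c) {0..1}"
  shows "2 / h * (LINT u:{0..h}|lborel. (w u - u / h * w h) * \<phi> (u / h))
    = 2 * integral {0..1} (\<lambda>x. w (h * x) * \<phi> x) - 2 * w h * c"
proof -
  have "(LINT u:{0..h}|lborel. (w u - u / h * w h) * \<phi> (u / h))
      = h * integral {0..1} (\<lambda>x. (w (h * x) - h * x / h * w h) * \<phi> (h * x / h))"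
    by (rule set_integral_rescale[OF h])
      (use h in \<open>intro continuous_intros w continuous_on_compose2[OF \<phi>], auto\<close>)
  also have "(\<lambda>x. (w (h * x) - h * x / h * w h) * \<phi> (h * x / h)) = (\<lambda>x. w (h * x) * \<phi> x - w h * (x * \<phi> x))"
    using h by (auto simp: algebra_simps)
  also have "integral {0..1} \<dots> = integral {0..1} (\<lambda>x. w (h * x) * \<phi> x) - w h * c"
  proof (rule integral_unique, intro has_integral_diff has_integral_mult_right I integrable_integral)
    show "(\<lambda>x. w (h * x) * \<phi> x) integrable_on {0..1}"
      by (intro integrable_continuous_real continuous_on_mult rescaled_continuous continuous_on_subset[OF \<phi>]) auto
  qed
  finally have "(LINT u:{0..h}|lborel. (w u - u / h * w h) * \<phi> (u / h))
      = h * (integral {0..1} (\<lambda>x. w (h * x) * \<phi> x) - w h * c)" .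
  then show ?thesis using h by (simp only: right_diff_distrib) simp
qed

text \<open>A merely continuous path need not have bounded variation, so the differences are shifted
  to the smooth factor \<open>f\<close>. Summation by parts then evaluates the path at the right end
  of each cell.\<close>

lemma parts_tendsto:
  fixes f f' :: "real \<Rightarrow> real"
  assumes f: "\<And>x. (f has_real_derivative f' x) (at x)" and f': "continuous_on UNIV f'"
  shows "(\<lambda>n. \<Sum>m<n. f (real m / real n) * (w (h * (real (Suc m) / real n)) - w (h * (real m / real n))))
    \<longlonglongrightarrow> f 1 * w h - integral {0..1} (\<lambda>x. w (h * x) * f' x)"
proof -
  have "(\<lambda>n. \<Sum>m<n. w (h * (real (Suc m) / real n)) * (f (real (Suc m) / real n) - f (real m / real n)))
      \<longlonglongrightarrow> integral {0..1} (\<lambda>x. w (h * x) * f' x)"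
    by (rule stieltjes_sum_tendsto[OF rescaled_continuous f f']) (auto intro: divide_right_mono)
  then have "(\<lambda>n. f 1 * w h - (\<Sum>m<n. w (h * (real (Suc m) / real n)) * (f (real (Suc m) / real n) - f (real m / real n))))
      \<longlonglongrightarrow> f 1 * w h - integral {0..1} (\<lambda>x. w (h * x) * f' x)"
    by (intro tendsto_intros)
  moreover have "eventually (\<lambda>n. f 1 * w h - (\<Sum>m<n. w (h * (real (Suc m) / real n)) * (f (real (Suc m) / real n) - f (real m / real n)))
     = (\<Sum>m<n. f (real m / real n) * (w (h * (real (Suc m) / real n)) - w (h * (real m / real n))))) sequentially"
    using eventually_gt_at_top[of 0]
  proof eventually_elim
    case (elim n)
    then show ?case
      using sum_by_parts[of "\<lambda>m. f (real m / real n)" "\<lambda>m. w (h * (real m / real n))" n] w0 by simp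
  qed
  ultimately show ?thesis by (rule Lim_transform_eventually)
qed

lemma fourier_cos_tendsto:
  "(\<lambda>n. - (1 / (pi * real r)) * (\<Sum>m<n. sin (2 * real r * pi * (real m / real n)) *
      (w (h * (real (Suc m) / real n)) - w (h * (real m / real n)))))
   \<longlonglongrightarrow> 2 / h * (LINT u:{0..h}|lborel. (w u - u / h * w h) * cos (2 * real r * pi * u / h))"
proof -
  let ?I = "integral {0..1} (\<lambda>x. w (h * x) * cos (2 * real r * pi * x))"
  have cont: "continuous_on UNIV (\<lambda>x. cos (2 * real r * pi * x))" by (intro continuous_intros)
  have scale: "integral {0..1} (\<lambda>x. w (h * x) * (2 * real r * pi * cos (2 * real r * pi * x))) = 2 * real r * pi * ?I"
    by (subst integral_mult_right[symmetric]) (simp add: mult_ac)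
  have "(\<lambda>n. - (1 / (pi * real r)) * (\<Sum>m<n. sin (2 * real r * pi * (real m / real n)) *
      (w (h * (real (Suc m) / real n)) - w (h * (real m / real n)))))
     \<longlonglongrightarrow> - (1 / (pi * real r)) * (sin (2 * real r * pi * 1) * w h
       - integral {0..1} (\<lambda>x. w (h * x) * (2 * real r * pi * cos (2 * real r * pi * x))))"
    by (intro tendsto_mult tendsto_const parts_tendsto real_trig_derivs continuous_intros)
  also have "- (1 / (pi * real r)) * (sin (2 * real r * pi * 1) * w h
       - integral {0..1} (\<lambda>x. w (h * x) * (2 * real r * pi * cos (2 * real r * pi * x)))) = 2 * ?I"
    unfolding scale using r by simp
  also have "\<dots> = 2 / h * (LINT u:{0..h}|lborel. (w u - u / h * w h) * cos (2 * real r * pi * u / h))"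
    using bridge_integral[OF cont integral_linear_sin(3)[OF r]] by simp
  finally show ?thesis .
qed

text \<open>Unlike the sine in \<open>fourier_cos_tendsto\<close>, the cosine leaves a boundary term
  \<open>w h / (pi * real r)\<close>. It agrees exactly with the share of the linear interpolation
  in \<open>bridge_integral\<close>.\<close>

lemma fourier_sin_tendsto:
  "(\<lambda>n. 1 / (pi * real r) * (\<Sum>m<n. cos (2 * real r * pi * (real m / real n)) *
      (w (h * (real (Suc m) / real n)) - w (h * (real m / real n)))))
   \<longlonglongrightarrow> 2 / h * (LINT u:{0..h}|lborel. (w u - u / h * w h) * sin (2 * real r * pi * u / h))"
proof -
  let ?I = "integral {0..1} (\<lambda>x. w (h * x) * sin (2 * real r * pi * x))"
  have cont: "continuous_on UNIV (\<lambda>x. sin (2 * real r * pi * x))" by (intro continuous_intros)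
  have scale: "integral {0..1} (\<lambda>x. w (h * x) * (- (2 * real r * pi * sin (2 * real r * pi * x)))) = - (2 * real r * pi) * ?I"
    by (subst integral_mult_right[symmetric]) (simp add: mult_ac)
  have "(\<lambda>n. 1 / (pi * real r) * (\<Sum>m<n. cos (2 * real r * pi * (real m / real n)) *
      (w (h * (real (Suc m) / real n)) - w (h * (real m / real n)))))
     \<longlonglongrightarrow> 1 / (pi * real r) * (cos (2 * real r * pi * 1) * w h
       - integral {0..1} (\<lambda>x. w (h * x) * (- (2 * real r * pi * sin (2 * real r * pi * x)))))"
    by (intro tendsto_mult tendsto_const parts_tendsto real_trig_derivs continuous_intros)
  also have "1 / (pi * real r) * (cos (2 * real r * pi * 1) * w h
       - integral {0..1} (\<lambda>x. w (h * x) * (- (2 * real r * pi * sin (2 * real r * pi * x)))))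
       = 2 * ?I + w h / (pi * real r)"
  proof -
    have c1: "cos (2 * real r * pi * 1) = 1" by simp
    show ?thesis unfolding scale c1 using r by (simp add: field_simps)
  qed
  also have "\<dots> = 2 / h * (LINT u:{0..h}|lborel. (w u - u / h * w h) * sin (2 * real r * pi * u / h))"
    using bridge_integral[OF cont integral_linear_sin(1)[OF r]] r by (simp add: field_simps)
  finally show ?thesis .
qed

end

text \<open>The coefficient of the product of the increments of the two paths over the cells \<open>l\<close> and
  \<open>m\<close>, after \<open>a\<^sub>r\<close> and \<open>b\<^sub>r\<close> in the truncated area are replaced by the sums that approximate
  \<open>- (1 / (\<pi> r)) \<integral> sin dw\<close> and \<open>(1 / (\<pi> r)) \<integral> cos dw\<close>.\<close>

definition levy_kernel :: "nat \<Rightarrow> nat \<Rightarrow> nat \<Rightarrow> nat \<Rightarrow> real" where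
  "levy_kernel D n l m = 1 / pi * (\<Sum>r=1..D. 1 / real r *
     (sin (2 * real r * pi * (real m / real n) - 2 * real r * pi * (real l / real n))
      + sin (2 * real r * pi * (real l / real n)) - sin (2 * real r * pi * (real m / real n))))"

text \<open>This lets sums over all pairs of cells be folded to \<open>l < m\<close>, with weight 0
  on the diagonal.\<close>

lemma levy_kernel_antisym: "levy_kernel D n m l = - levy_kernel D n l m"
proof -
  have neg: "sin (y - x) + sin x - sin y = - (sin (x - y) + sin y - sin x)" for x y :: real
    using sin_minus[of "x - y"] by simp
  show ?thesis
    unfolding levy_kernel_def mult_minus_right[symmetric] sum_negf[symmetric]
    by (intro arg_cong[where f = "(*) (1 / pi)"] sum.cong refl arg_cong[where f = "(*) (1 / real _)"] neg)
qed

text \<open>The sign function is a combination of three sawtooth functions: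
  \<open>1/2 = (1/2 - (v - u)) + (1/2 - u) - (1/2 - v)\<close> for \<open>u < v\<close>.\<close>

lemma half_minus_levy_kernel:
  "1/2 - levy_kernel D n l m
    = 1 / pi * (sawtooth_rem D ((real m - real l) / real n) + sawtooth_rem D (real l / real n) - sawtooth_rem D (real m / real n))"
proof -
  have S: "(\<Sum>r=1..D. sin (2 * real r * pi * x) / real r) = pi * (1/2 - x) - sawtooth_rem D x" for x
    by (simp add: sawtooth_rem_def)
  have arg: "2 * real r * pi * (real m / real n) - 2 * real r * pi * (real l / real n)
      = 2 * real r * pi * ((real m - real l) / real n)" for r
    by (simp add: diff_divide_distrib right_diff_distrib)
  have "levy_kernel D n l m = 1 / pi * ((\<Sum>r=1..D. sin (2 * real r * pi * ((real m - real l) / real n)) / real r)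
      + (\<Sum>r=1..D. sin (2 * real r * pi * (real l / real n)) / real r) - (\<Sum>r=1..D. sin (2 * real r * pi * (real m / real n)) / real r))"
    unfolding levy_kernel_def arg by (simp add: sum.distrib sum_subtractf add_divide_distrib diff_divide_distrib)
  moreover have "1/2 - 1 / pi * ((pi * (1/2 - z) - a) + (pi * (1/2 - x) - b) - (pi * (1/2 - y) - c)) = 1 / pi * (a + b - c)"
    if "z = y - x" for a b c x y z :: real
    unfolding that by (simp add: field_simps)
  ultimately show ?thesis unfolding S by (simp only: diff_divide_distrib)
qed

text \<open>The factor 9 is 3 for the square of a combination of three values times 3 for the three
  double sums, each at most \<open>real n\<close> times the sum over all grid points. Bounding the
  sums rather than single terms matters, as the remainder is not small near 0.\<close>

lemma levy_kernel_sum_le: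
  assumes n: "0 < n"
  shows "(\<Sum>m<n. \<Sum>l<m. (1/2 - levy_kernel D n l m)\<^sup>2) \<le> 9 / pi\<^sup>2 * (real n * (\<Sum>m<n. (sawtooth_rem D (real m / real n))\<^sup>2))"
proof -
  define \<rho> where "\<rho> m = (sawtooth_rem D (real m / real n))\<^sup>2" for m
  have \<rho>0: "0 \<le> \<rho> m" for m by (simp add: \<rho>_def)
  have pt: "(1/2 - levy_kernel D n l m)\<^sup>2 \<le> 3 / pi\<^sup>2 * (\<rho> (m - l) + \<rho> l + \<rho> m)" if "l < m" for l m
  proof -
    have sq: "(x + y - z)\<^sup>2 \<le> 3 * (x\<^sup>2 + y\<^sup>2 + z\<^sup>2)" for x y z :: real
    proof -
      have "3 * (x\<^sup>2 + y\<^sup>2 + z\<^sup>2) - (x + y - z)\<^sup>2 = (x - y)\<^sup>2 + (x + z)\<^sup>2 + (y + z)\<^sup>2"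
        by (simp add: power2_eq_square algebra_simps)
      then show ?thesis using zero_le_power2[of "x - y"] zero_le_power2[of "x + z"] zero_le_power2[of "y + z"] by linarith
    qed
    have "(1/2 - levy_kernel D n l m)\<^sup>2 = 1 / pi\<^sup>2 * (sawtooth_rem D ((real m - real l) / real n) + sawtooth_rem D (real l / real n) - sawtooth_rem D (real m / real n))\<^sup>2"
      unfolding half_minus_levy_kernel by (simp add: power_mult_distrib power_divide)
    also have "\<dots> \<le> 1 / pi\<^sup>2 * (3 * ((sawtooth_rem D ((real m - real l) / real n))\<^sup>2 + (sawtooth_rem D (real l / real n))\<^sup>2 + (sawtooth_rem D (real m / real n))\<^sup>2))"
      by (intro mult_left_mono sq) simp
    finally show ?thesis using that by (simp add: \<rho>_def of_nat_diff)
  qed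
  have "(\<Sum>m<n. \<Sum>l<m. (1/2 - levy_kernel D n l m)\<^sup>2) \<le> (\<Sum>m<n. \<Sum>l<m. 3 / pi\<^sup>2 * (\<rho> (m - l) + \<rho> l + \<rho> m))"
    by (intro sum_mono pt) auto
  also have "\<dots> = 3 / pi\<^sup>2 * ((\<Sum>m<n. \<Sum>l<m. \<rho> (m - l)) + (\<Sum>m<n. \<Sum>l<m. \<rho> l) + (\<Sum>m<n. \<Sum>l<m. \<rho> m))"
    unfolding sum.distrib[symmetric] sum_distrib_left by (rule refl)
  also have "\<dots> \<le> 3 / pi\<^sup>2 * (real n * (\<Sum>m<n. \<rho> m) + real n * (\<Sum>m<n. \<rho> m) + real n * (\<Sum>m<n. \<rho> m))"
  proof (intro mult_left_mono add_mono)
    have "(\<Sum>m<n. \<Sum>l<m. \<rho> (m - l)) \<le> (\<Sum>m<n. \<Sum>l<n. \<rho> l)"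
    proof (intro sum_mono)
      fix m assume m: "m \<in> {..<n}"
      \<comment> \<open>For \<open>l < m\<close> the differences \<open>m - l\<close> run through 1
        to \<open>m\<close> without repetition, and \<open>m < n\<close>.\<close>
      have "(\<Sum>l<m. \<rho> (m - l)) = sum \<rho> ((\<lambda>l. m - l) ` {..<m})"
        by (subst sum.reindex) (auto intro!: inj_onI)
      also have "\<dots> \<le> (\<Sum>l<n. \<rho> l)" using m \<rho>0 by (intro sum_mono2) auto
      finally show "(\<Sum>l<m. \<rho> (m - l)) \<le> (\<Sum>l<n. \<rho> l)" .
    qed
    then show "(\<Sum>m<n. \<Sum>l<m. \<rho> (m - l)) \<le> real n * (\<Sum>m<n. \<rho> m)" by simp
    have "(\<Sum>m<n. \<Sum>l<m. \<rho> l) \<le> (\<Sum>m<n. \<Sum>l<n. \<rho> l)" using \<rho>0 by (intro sum_mono sum_mono2) auto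
    then show "(\<Sum>m<n. \<Sum>l<m. \<rho> l) \<le> real n * (\<Sum>m<n. \<rho> m)" by simp
    show "(\<Sum>m<n. \<Sum>l<m. \<rho> m) \<le> real n * (\<Sum>m<n. \<rho> m)"
      using \<rho>0 by (simp add: sum_distrib_left) (intro sum_mono mult_right_mono, auto)
  qed simp
  finally show ?thesis by (simp add: \<rho>_def)
qed

lemma sawtooth_rem_mean_tendsto:
  "(\<lambda>n. 1 / real n * (\<Sum>m<n. (sawtooth_rem D (real m / real n))\<^sup>2)) \<longlonglongrightarrow> integral {0..1} (\<lambda>x. (sawtooth_rem D x)\<^sup>2)"
proof -
  have "(\<lambda>n. \<Sum>m<n. (sawtooth_rem D (real m / real n))\<^sup>2 * (real (Suc m) / real n - real m / real n))
      \<longlonglongrightarrow> integral {0..1} (\<lambda>x. (sawtooth_rem D x)\<^sup>2 * 1)"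
    by (rule stieltjes_sum_tendsto[where f = "\<lambda>x. x" and f' = "\<lambda>_. 1"])
      (auto intro!: continuous_intros sawtooth_rem_continuous divide_right_mono)
  moreover have "real (Suc m) / real n - real m / real n = 1 / real n" for m n
    by (simp add: diff_divide_distrib[symmetric])
  ultimately show ?thesis by (simp add: sum_divide_distrib mult.commute)
qed

lemma sum_square_split:
  fixes f :: "nat \<Rightarrow> nat \<Rightarrow> 'b::ab_group_add"
  shows "(\<Sum>l<n. \<Sum>m<n. f l m) = (\<Sum>m<n. \<Sum>l<m. f l m + f m l) + (\<Sum>m<n. f m m)"
proof (induction n)
  case (Suc n)
  have "(\<Sum>l<Suc n. \<Sum>m<Suc n. f l m) = (\<Sum>l<n. \<Sum>m<n. f l m) + (\<Sum>l<n. f l n) + (\<Sum>m<n. f n m) + f n n"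
    by (simp add: sum.distrib add_ac)
  then show ?case using Suc by (simp add: sum.distrib add_ac)
qed simp

section \<open>Discretisation of the iterated integral\<close>

lemma nn_integral_sum_cells:
  fixes \<tau> :: "nat \<Rightarrow> real" and c :: "nat \<Rightarrow> ennreal"
  assumes "\<And>m. \<tau> (Suc m) = \<tau> m + d" "0 \<le> d"
  shows "(\<integral>\<^sup>+ s. (\<Sum>m<n. indicator {\<tau> m<..\<tau> (Suc m)} s * c m) \<partial>lborel) = ennreal d * (\<Sum>m<n. c m)"
proof -
  have "(\<integral>\<^sup>+ s. (\<Sum>m<n. indicator {\<tau> m<..\<tau> (Suc m)} s * c m) \<partial>lborel)
      = (\<Sum>m<n. \<integral>\<^sup>+ s. indicator {\<tau> m<..\<tau> (Suc m)} s * c m \<partial>lborel)"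
    by (rule nn_integral_sum) measurable
  also have "\<dots> = (\<Sum>m<n. ennreal d * c m)"
    using assms by (intro sum.cong refl) (simp add: nn_integral_multc)
  finally show ?thesis by (simp add: sum_distrib_left)
qed

text \<open>The indicator of \<open>l < m\<close> is half of one, minus half of the indicator of
  \<open>l = m\<close>, plus half of the sign of \<open>m - l\<close>. The half sign is split into
  the kernel and a remainder; by antisymmetry the remainder below the diagonal reappears with
  \<open>x\<close> and \<open>y\<close> exchanged.\<close>

lemma iterated_sum_decomposition:
  fixes x y :: "nat \<Rightarrow> real"
  shows "(\<Sum>m<n. \<Sum>l<m. x l * y m)
     = (\<Sum>m<n. x m) * (\<Sum>m<n. y m) / 2 + (\<Sum>l<n. \<Sum>m<n. levy_kernel D n l m * (x l * y m))
       + ((\<Sum>m<n. \<Sum>l<m. (1/2 - levy_kernel D n l m) * (x l * y m))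
         - (\<Sum>m<n. \<Sum>l<m. (1/2 - levy_kernel D n l m) * (y l * x m))) - (\<Sum>m<n. x m * y m) / 2"
proof -
  let ?k = "levy_kernel D n"
  have prod: "(\<Sum>m<n. x m) * (\<Sum>m<n. y m) = (\<Sum>m<n. \<Sum>l<m. x l * y m + y l * x m) + (\<Sum>m<n. x m * y m)"
    unfolding sum_product by (subst sum_square_split) (simp only: mult.commute[of "x _" "y _"])
  have "?k m m = 0" for m using levy_kernel_antisym[of D n m m] by simp
  moreover have "?k l m * (x l * y m) + ?k m l * (x m * y l) = ?k l m * (x l * y m) - ?k l m * (y l * x m)" for l m
    by (simp add: levy_kernel_antisym[of D n m l])
  ultimately have kern: "(\<Sum>l<n. \<Sum>m<n. ?k l m * (x l * y m))
      = (\<Sum>m<n. \<Sum>l<m. ?k l m * (x l * y m) - ?k l m * (y l * x m))"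
    by (subst sum_square_split) simp
  have half: "(\<Sum>m<n. \<Sum>l<m. (1/2 - ?k l m) * f l m) = (\<Sum>m<n. \<Sum>l<m. f l m) / 2 - (\<Sum>m<n. \<Sum>l<m. ?k l m * f l m)" for f
    by (simp add: left_diff_distrib sum_subtractf sum_divide_distrib)
  show ?thesis
    unfolding prod kern half sum.distrib sum_subtractf by (simp add: add_divide_distrib)
qed

text \<open>The prefactors combine to \<open>1 / (pi * real r)\<close>, the addition theorem merges
  the products of sine and cosine into the sine of a difference, and the corrections by the total
  increments give the two single sines.\<close>

lemma levy_sum_eq_kernel:
  fixes x y :: "nat \<Rightarrow> real" and n D :: nat
  defines "s r m \<equiv> sin (2 * real r * pi * (real m / real n))" and "c r m \<equiv> cos (2 * real r * pi * (real m / real n))"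
  shows "pi * (\<Sum>r=1..D. real r *
       ((- (1 / (pi * real r)) * (\<Sum>m<n. s r m * x m)) * (1 / (pi * real r) * (\<Sum>m<n. c r m * y m) - 1 / (pi * real r) * (\<Sum>m<n. y m))
        - (1 / (pi * real r) * (\<Sum>m<n. c r m * x m) - 1 / (pi * real r) * (\<Sum>m<n. x m)) * (- (1 / (pi * real r)) * (\<Sum>m<n. s r m * y m))))
    = (\<Sum>l<n. \<Sum>m<n. levy_kernel D n l m * (x l * y m))"
proof -
  let ?A = "\<lambda>r. (- (1 / (pi * real r)) * (\<Sum>m<n. s r m * x m)) * (1 / (pi * real r) * (\<Sum>m<n. c r m * y m) - 1 / (pi * real r) * (\<Sum>m<n. y m))
        - (1 / (pi * real r) * (\<Sum>m<n. c r m * x m) - 1 / (pi * real r) * (\<Sum>m<n. x m)) * (- (1 / (pi * real r)) * (\<Sum>m<n. s r m * y m))"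
  let ?B = "\<lambda>r l m. 1 / real r * (sin (2 * real r * pi * (real m / real n) - 2 * real r * pi * (real l / real n))
      + s r l - s r m)"
  have "pi * (real r * ?A r)
      = (\<Sum>l<n. \<Sum>m<n. 1 / pi * ?B r l m * (x l * y m))" if r: "r \<in> {1..D}" for r
  proof -
    have r0: "real r \<noteq> 0" using r by simp
    let ?Sx = "\<Sum>m<n. s r m * x m" and ?Cy = "\<Sum>m<n. c r m * y m" and ?Y = "\<Sum>m<n. y m"
      and ?Cx = "\<Sum>m<n. c r m * x m" and ?X = "\<Sum>m<n. x m" and ?Sy = "\<Sum>m<n. s r m * y m"
    have alg: "pi * (real r * ((- (1 / (pi * real r)) * a) * (1 / (pi * real r) * b - 1 / (pi * real r) * d)
        - (1 / (pi * real r) * f - 1 / (pi * real r) * g) * (- (1 / (pi * real r)) * k)))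
        = 1 / (pi * real r) * (- (a * b) + a * d + f * k - g * k)" for a b d f g k :: real
      using r0 by (simp add: field_simps)
    have "- (?Sx * ?Cy) + ?Sx * ?Y + ?Cx * ?Sy - ?X * ?Sy
      = (\<Sum>l<n. \<Sum>m<n. (sin (2 * real r * pi * (real m / real n) - 2 * real r * pi * (real l / real n))
      + s r l - s r m) * (x l * y m))"
      unfolding sum_product sum_negf[symmetric] sum.distrib[symmetric] sum_subtractf[symmetric]
      by (intro sum.cong refl) (simp add: s_def c_def sin_diff algebra_simps)
    then show ?thesis unfolding alg by (simp add: sum_distrib_left mult.assoc)
  qed
  then have "pi * (\<Sum>r=1..D. real r * ?A r)
     = (\<Sum>r=1..D. \<Sum>l<n. \<Sum>m<n. 1 / pi * ?B r l m * (x l * y m))"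
    unfolding sum_distrib_left by (intro sum.cong refl)
  also have "\<dots> = (\<Sum>l<n. \<Sum>r=1..D. \<Sum>m<n. 1 / pi * ?B r l m * (x l * y m))" by (rule sum.swap)
  also have "\<dots> = (\<Sum>l<n. \<Sum>m<n. \<Sum>r=1..D. 1 / pi * ?B r l m * (x l * y m))" by (intro sum.cong refl sum.swap)
  also have "\<dots> = (\<Sum>l<n. \<Sum>m<n. levy_kernel D n l m * (x l * y m))"
    by (simp add: levy_kernel_def s_def sum_distrib_right sum_distrib_left)
  finally show ?thesis .
qed

context filtered_wiener_basis
begin

definition grid_incr :: "real \<Rightarrow> real \<Rightarrow> nat \<Rightarrow> nat \<Rightarrow> 'a \<Rightarrow> 'u" where
  "grid_incr t h n m \<omega> = incr (grid t h n m) (grid t h n (Suc m)) \<omega>"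

lemma incr_grid: "incr t (grid t h n m) \<omega> = (\<Sum>l<m. grid_incr t h n l \<omega>)"
proof (induction m)
  case 0 then show ?case by (simp add: grid_def incr_self)
next
  case (Suc m)
  then show ?case using incr_add[of t "grid t h n m" \<omega> "grid t h n (Suc m)"] by (simp add: grid_incr_def)
qed

lemma coeff_norm2_nn_integral:
  fixes f :: "'j \<Rightarrow> 'a \<Rightarrow> 'h::{real_normed_vector, second_countable_topology}"
  assumes "\<And>j. j \<in> K \<Longrightarrow> f j \<in> borel_measurable M"
  shows "coeff_norm2 f = (\<Sum>j\<in>K. ennreal (\<eta> j) * mean_sq M (f j))"
proof -
  note [measurable] = assms
  have "coeff_norm2 f = (\<Sum>j\<in>K. \<integral>\<^sup>+ \<omega>. ennreal (\<eta> j) * ennreal ((norm (f j \<omega>))\<^sup>2) \<partial>M)"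
    unfolding coeff_norm2_def
    by (subst nn_integral_sum) (auto intro!: sum.cong nn_integral_cong simp: ennreal_mult eta_nonneg)
  also have "\<dots> = (\<Sum>j\<in>K. ennreal (\<eta> j) * mean_sq M (f j))"
    by (intro sum.cong refl nn_integral_cmult) measurable
  finally show ?thesis .
qed

text \<open>The inner sum stops before cell \<open>m\<close>, so that the coefficient of that cell
  is known at its left endpoint and the isometry can be applied twice.\<close>

definition kernel_integral :: "real \<Rightarrow> real \<Rightarrow> nat \<Rightarrow> (nat \<Rightarrow> nat \<Rightarrow> real) \<Rightarrow> ('j \<Rightarrow> 'j \<Rightarrow> 'h::real_vector) \<Rightarrow> 'a \<Rightarrow> 'h" where
  "kernel_integral t h n k \<phi> = grid_integral t h n n
     (\<lambda>m j. grid_integral t h n m (\<lambda>l i \<omega>. k l m *\<^sub>R \<phi> i j))"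

definition quad_var_error :: "real \<Rightarrow> real \<Rightarrow> nat \<Rightarrow> 'u \<Rightarrow> 'a \<Rightarrow> real" where
  "quad_var_error t h n v \<omega> = (\<Sum>m<n. (grid_incr t h n m \<omega> \<bullet> v)\<^sup>2 - h / real n * (Q v \<bullet> v))"

definition cross_var_error :: "real \<Rightarrow> real \<Rightarrow> nat \<Rightarrow> 'j \<Rightarrow> 'j \<Rightarrow> 'a \<Rightarrow> real" where
  "cross_var_error t h n i j \<omega> = (\<Sum>m<n. (grid_incr t h n m \<omega> \<bullet> e i) * (grid_incr t h n m \<omega> \<bullet> e j)) - h * \<eta> i * (if i = j then 1 else 0)"

definition diagonal_error :: "real \<Rightarrow> real \<Rightarrow> nat \<Rightarrow> ('j \<Rightarrow> 'j \<Rightarrow> 'h::real_vector) \<Rightarrow> 'a \<Rightarrow> 'h" where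
  "diagonal_error t h n \<psi> \<omega> = (\<Sum>i\<in>K. \<Sum>j\<in>K. (cross_var_error t h n i j \<omega> / 2) *\<^sub>R \<psi> i j)"

text \<open>A crude constant that may depend on the index set: it is divided by the number of cells
  and disappears in the limit.\<close>

definition cross_var_const :: "real \<Rightarrow> ('j \<Rightarrow> 'j \<Rightarrow> 'h::real_normed_vector) \<Rightarrow> real" where
  "cross_var_const h \<psi> = (\<Sum>i\<in>K. \<Sum>j\<in>K. (norm (\<psi> i j))\<^sup>2) *
     (\<Sum>i\<in>K. \<Sum>j\<in>K. (h * (Q (e i + e j) \<bullet> (e i + e j)))\<^sup>2 + (h * (Q (e i - e j) \<bullet> (e i - e j)))\<^sup>2)"

text \<open>The approximation of Algorithm 1 with grid sums in place of the Fourier coefficients,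
  already in the kernel form of \<open>levy_sum_eq_kernel\<close>.\<close>

definition discrete_iter_approx :: "real \<Rightarrow> real \<Rightarrow> nat \<Rightarrow> nat \<Rightarrow> 'j \<Rightarrow> 'j \<Rightarrow> 'a \<Rightarrow> real" where
  "discrete_iter_approx t h n D i j \<omega> = ((\<Sum>m<n. grid_incr t h n m \<omega> \<bullet> e i) * (\<Sum>m<n. grid_incr t h n m \<omega> \<bullet> e j)
       - h * \<eta> i * (if i = j then 1 else 0)) / 2
     + (\<Sum>l<n. \<Sum>m<n. levy_kernel D n l m * ((grid_incr t h n l \<omega> \<bullet> e i) * (grid_incr t h n m \<omega> \<bullet> e j)))"

section \<open>Second moments on a uniform grid\<close>

context
  fixes t h :: real and n :: nat
  assumes t: "0 \<le> t" and h: "0 < h" and n: "0 < n"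
begin

lemma grid_nonneg: "0 \<le> grid t h n m"
  using grid_ge[OF h, of t n m] t by simp

lemma grid_step: "grid t h n m \<le> grid t h n (Suc m)"
  using h by (simp add: grid_Suc)

text \<open>Cells are disjoint, so the isometry becomes a sum over cells. The second claim qualifies
  a grid integral up to cell \<open>N\<close> as a coefficient of that cell in an outer
  integral.\<close>

lemma grid_isometry:
  fixes \<xi> :: "nat \<Rightarrow> 'j \<Rightarrow> 'a \<Rightarrow> 'h::{real_inner, banach, second_countable_topology}"
  assumes \<xi>: "\<And>m j. m < N \<Longrightarrow> j \<in> K \<Longrightarrow> L2_on M (F (grid t h n m)) (\<xi> m j)"
  shows "mean_sq M (\<lambda>\<omega>. grid_integral t h n N \<xi> \<omega>)
      = ennreal (h / real n) * (\<Sum>m<N. coeff_norm2 (\<xi> m))"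
    and "L2_on M (F (grid t h n N)) (grid_integral t h n N \<xi>)"
proof -
  let ?\<tau> = "grid t h n"
  have adm: "admissible {..<N} ?\<tau> (\<lambda>m. ?\<tau> (Suc m)) \<xi>"
    using \<xi> grid_nonneg grid_step by (simp add: admissible_def)
  have cv: "coeff_norm2 (block_value {..<N} ?\<tau> (\<lambda>m. ?\<tau> (Suc m)) \<xi> s)
      = (\<Sum>m<N. indicator {?\<tau> m<..?\<tau> (Suc m)} s * coeff_norm2 (\<xi> m))" for s
  proof (cases "\<exists>m<N. s \<in> {?\<tau> m<..?\<tau> (Suc m)}")
    case True
    then obtain m where m: "m < N" "s \<in> {?\<tau> m<..?\<tau> (Suc m)}" by blast
    have "block_value {..<N} ?\<tau> (\<lambda>m. ?\<tau> (Suc m)) \<xi> s = \<xi> m"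
      unfolding block_value_def[abs_def] sum_partition_cell[OF grid_mono[OF h] m(2,1)] ..
    moreover have "(\<Sum>l<N. indicator {?\<tau> l<..?\<tau> (Suc l)} s * coeff_norm2 (\<xi> l)) = (\<Sum>l<N. if l = m then coeff_norm2 (\<xi> m) else 0)"
    proof (intro sum.cong refl)
      fix l
      show "indicator {?\<tau> l<..?\<tau> (Suc l)} s * coeff_norm2 (\<xi> l) = (if l = m then coeff_norm2 (\<xi> m) else 0)"
      proof (cases "l = m")
        case True
        then show ?thesis using m(2) by simp
      next
        case False
        then have "s \<notin> {?\<tau> l<..?\<tau> (Suc l)}" using partition_cell_unique[OF grid_mono[OF h] m(2)] by blast
        then show ?thesis using False by (simp del: greaterThanAtMost_iff)
      qed
    qed
    ultimately show ?thesis using m(1) by simp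
  next
    case False
    then have out: "indicator {?\<tau> m<..?\<tau> (Suc m)} s = (0::real)" "indicator {?\<tau> m<..?\<tau> (Suc m)} s = (0::ennreal)" if "m < N" for m
      using that by (auto simp: indicator_def)
    have "block_value {..<N} ?\<tau> (\<lambda>m. ?\<tau> (Suc m)) \<xi> s j \<omega> = 0" for j \<omega>
      unfolding block_value_def by (intro sum.neutral ballI) (simp add: out)
    then show ?thesis using out by (simp add: coeff_norm2_def)
  qed
  show "mean_sq M (\<lambda>\<omega>. block_integral {..<N} ?\<tau> (\<lambda>m. ?\<tau> (Suc m)) \<xi> \<omega>)
      = ennreal (h / real n) * (\<Sum>m<N. coeff_norm2 (\<xi> m))"
    unfolding ito_isometry(2)[OF adm] cv by (rule nn_integral_sum_cells) (use h in \<open>auto simp: grid_Suc\<close>)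
  have "block_integral {..<N} ?\<tau> (\<lambda>m. ?\<tau> (Suc m)) \<xi> \<in> borel_measurable (F (?\<tau> N))"
    by (rule block_integral_measurable_F[OF adm]) (use incseqD[OF grid_mono[OF h]] in auto)
  then show "L2_on M (F (?\<tau> N)) (block_integral {..<N} ?\<tau> (\<lambda>m. ?\<tau> (Suc m)) \<xi>)"
    using ito_isometry(1)[OF adm] by (simp add: L2_on_def)
qed

text \<open>Each of the two isometries contributes one factor \<open>h / real n\<close> and one sum
  with the weights \<open>\<eta>\<close>.\<close>

lemma kernel_integral_norm:
  fixes \<phi> :: "'j \<Rightarrow> 'j \<Rightarrow> 'h::{real_inner, banach, second_countable_topology}"
  shows "mean_sq M (\<lambda>\<omega>. kernel_integral t h n k \<phi> \<omega>)
     = ennreal ((h / real n)\<^sup>2 * (drift_const \<phi> * (\<Sum>m<n. \<Sum>l<m. (k l m)\<^sup>2)))"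
    and "kernel_integral t h n k \<phi> \<in> borel_measurable M"
proof -
  have cst: "L2_on M G (\<lambda>\<omega>. v)" for v :: 'h and G by (simp add: L2_on_def)
  let ?\<xi> = "\<lambda>m j. grid_integral t h n m (\<lambda>l i \<omega>. k l m *\<^sub>R \<phi> i j)"
  have \<xi>: "L2_on M (F (grid t h n m)) (?\<xi> m j)" for m j
    by (rule grid_isometry(2)) (rule cst)
  have \<xi>M: "?\<xi> m j \<in> borel_measurable M" for m j
    using \<xi> L2_on_measurable_subalg[OF subalg[OF grid_nonneg]] by blast
  have inner: "mean_sq M (\<lambda>\<omega>. ?\<xi> m j \<omega>)
      = ennreal (h / real n * ((\<Sum>l<m. (k l m)\<^sup>2) * (\<Sum>i\<in>K. \<eta> i * (norm (\<phi> i j))\<^sup>2)))" for m j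
  proof -
    have "coeff_norm2 (\<lambda>i \<omega>. k l m *\<^sub>R \<phi> i j) = ennreal ((k l m)\<^sup>2 * (\<Sum>i\<in>K. \<eta> i * (norm (\<phi> i j))\<^sup>2))" for l
      by (subst coeff_norm2_integral) (auto simp: cst power_mult_distrib sum_distrib_left mult_ac prob_space)
    then show ?thesis
      using h by (subst grid_isometry(1)) (auto simp: cst sum_ennreal eta_nonneg sum_nonneg ennreal_mult[symmetric] sum_distrib_right)
  qed
  have outer: "coeff_norm2 (?\<xi> m) = ennreal (h / real n * ((\<Sum>l<m. (k l m)\<^sup>2) * drift_const \<phi>))" for m
  proof -
    have "coeff_norm2 (?\<xi> m) = (\<Sum>j\<in>K. ennreal (\<eta> j * (h / real n * ((\<Sum>l<m. (k l m)\<^sup>2) * (\<Sum>i\<in>K. \<eta> i * (norm (\<phi> i j))\<^sup>2)))))"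
      unfolding coeff_norm2_nn_integral[of "?\<xi> m", OF \<xi>M] inner
      using h by (intro sum.cong refl ennreal_mult[symmetric] mult_nonneg_nonneg sum_nonneg) (auto simp: eta_nonneg)
    also have "\<dots> = ennreal (\<Sum>j\<in>K. \<eta> j * (h / real n * ((\<Sum>l<m. (k l m)\<^sup>2) * (\<Sum>i\<in>K. \<eta> i * (norm (\<phi> i j))\<^sup>2))))"
      using h by (intro sum_ennreal mult_nonneg_nonneg sum_nonneg) (auto simp: eta_nonneg)
    finally show ?thesis by (simp add: drift_const_def sum_distrib_left mult_ac)
  qed
  have "mean_sq M (\<lambda>\<omega>. kernel_integral t h n k \<phi> \<omega>)
     = ennreal (h / real n) * (\<Sum>m<n. ennreal (h / real n * ((\<Sum>l<m. (k l m)\<^sup>2) * drift_const \<phi>)))"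
    unfolding kernel_integral_def by (subst grid_isometry(1)) (auto simp: \<xi> outer)
  also have "\<dots> = ennreal (h / real n * (\<Sum>m<n. h / real n * ((\<Sum>l<m. (k l m)\<^sup>2) * drift_const \<phi>)))"
    using h by (subst sum_ennreal, simp add: sum_nonneg drift_const_nonneg, subst ennreal_mult[symmetric])
      (auto intro!: sum_nonneg mult_nonneg_nonneg divide_nonneg_nonneg simp: drift_const_nonneg)
  also have "h / real n * (\<Sum>m<n. h / real n * ((\<Sum>l<m. (k l m)\<^sup>2) * drift_const \<phi>))
      = (h / real n)\<^sup>2 * (drift_const \<phi> * (\<Sum>m<n. \<Sum>l<m. (k l m)\<^sup>2))"
    by (simp add: sum_distrib_left sum_distrib_right power2_eq_square mult_ac)
  finally show "mean_sq M (\<lambda>\<omega>. kernel_integral t h n k \<phi> \<omega>)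
     = ennreal ((h / real n)\<^sup>2 * (drift_const \<phi> * (\<Sum>m<n. \<Sum>l<m. (k l m)\<^sup>2)))" .
  show "kernel_integral t h n k \<phi> \<in> borel_measurable M"
    unfolding kernel_integral_def
    by (rule L2_on_measurable_subalg[OF subalg[OF grid_nonneg] grid_isometry(2)]) (rule \<xi>)
qed

text \<open>The centred squared increments of different cells are orthogonal, since the later one is
  independent of the past. With \<open>c\<close> the variance of an increment, each has second
  moment \<open>3 * c\<^sup>2 - 2 * c\<^sup>2 + c\<^sup>2\<close>; the sum over \<open>n\<close>
  cells is of order \<open>1 / real n\<close>.\<close>

lemma quad_var_error_norm:
  "has_bochner_integral M (\<lambda>\<omega>. (quad_var_error t h n v \<omega>)\<^sup>2) (2 * (h * (Q v \<bullet> v))\<^sup>2 / real n)"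
proof -
  define c where "c = h / real n * (Q v \<bullet> v)"
  define X where "X m \<omega> = (grid_incr t h n m \<omega> \<bullet> v)\<^sup>2 - c" for m \<omega>
  have len: "grid t h n (Suc m) - grid t h n m = h / real n" for m by (simp add: grid_Suc)
  note mom = incr_moments[OF grid_nonneg grid_step, of _ v, unfolded len, folded c_def]
  have cst: "has_bochner_integral M (\<lambda>\<omega>. c) c" for c :: real
    by (simp add: has_bochner_integral_iff prob_space)
  have mean: "has_bochner_integral M (X m) 0" for m
    using has_bochner_integral_diff[OF mom(2)[of m] cst[of c]] by (simp add: X_def[abs_def] grid_incr_def)
  have var: "has_bochner_integral M (\<lambda>\<omega>. X m \<omega> * X m \<omega>) (2 * c\<^sup>2)" for m
  proof -
    have H: "has_bochner_integral M (\<lambda>\<omega>. (grid_incr t h n m \<omega> \<bullet> v) ^ 4 - 2 * c * (grid_incr t h n m \<omega> \<bullet> v)\<^sup>2 + c\<^sup>2)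
       (3 * c\<^sup>2 - 2 * c * c + c\<^sup>2)"
      unfolding grid_incr_def by (intro has_bochner_integral_add has_bochner_integral_diff has_bochner_integral_mult_right mom cst)
    have rhs: "3 * c\<^sup>2 - 2 * c * c + c\<^sup>2 = 2 * c\<^sup>2" by (simp add: power2_eq_square)
    have "x ^ 4 - 2 * c * x\<^sup>2 + c\<^sup>2 = (x\<^sup>2 - c) * (x\<^sup>2 - c)" for x :: real
      by (simp add: power2_eq_square power4_eq_xxxx algebra_simps)
    then show ?thesis using H unfolding X_def rhs by simp
  qed
  have cross: "has_bochner_integral M (\<lambda>\<omega>. X l \<omega> * X m \<omega>) 0" if "l < m" for l m
  proof -
    have le: "grid t h n (Suc l) \<le> grid t h n m"
      by (rule incseqD[OF grid_mono[OF h]]) (use that in simp)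
    have [measurable]: "incr (grid t h n l) (grid t h n (Suc l)) \<in> borel_measurable (F (grid t h n m))"
      by (rule measurable_from_subalg[OF subalg_F[OF grid_nonneg le] incr_measurable_F[OF grid_nonneg grid_step]])
    have "X l \<in> borel_measurable (F (grid t h n m))"
      unfolding X_def grid_incr_def by measurable
    from indep_mult[OF grid_nonneg grid_step this mean, of "\<lambda>x. (x \<bullet> v)\<^sup>2 - c" 0] mean[of m]
    show ?thesis by (simp add: X_def[abs_def] grid_incr_def)
  qed
  have "has_bochner_integral M (\<lambda>\<omega>. X l \<omega> * X m \<omega>) (if l = m then 2 * c\<^sup>2 else 0)" for l m
    using var[of m] cross[of l m] cross[of m l] by (cases l m rule: linorder_cases) (auto simp: mult.commute)
  then have "has_bochner_integral M (\<lambda>\<omega>. \<Sum>l<n. \<Sum>m<n. X l \<omega> * X m \<omega>) (\<Sum>l<n. \<Sum>m<n. if l = m then 2 * c\<^sup>2 else 0)"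
    by (intro has_bochner_integral_sum)
  moreover have "(\<Sum>l<n. \<Sum>m<n. if l = m then 2 * c\<^sup>2 else 0) = 2 * (h * (Q v \<bullet> v))\<^sup>2 / real n"
    using n by (simp add: c_def power2_eq_square)
  moreover have "(quad_var_error t h n v \<omega>)\<^sup>2 = (\<Sum>l<n. \<Sum>m<n. X l \<omega> * X m \<omega>)" for \<omega>
    by (simp add: quad_var_error_def X_def c_def power2_eq_square sum_product)
  ultimately show ?thesis by simp
qed

text \<open>Fourth moments are at hand for a single direction, so two directions are reduced to one
  by polarisation.\<close>

lemma cross_var_error_eq:
  assumes "i \<in> K" "j \<in> K"
  shows "cross_var_error t h n i j \<omega> = (quad_var_error t h n (e i + e j) \<omega> - quad_var_error t h n (e i - e j) \<omega>) / 4"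
proof -
  note Q = nonneg_symmetricD[OF nonneg]
  have lin: "linear Q" using Q(1) by (rule bounded_linear.linear)
  have pol: "(x \<bullet> (e i + e j))\<^sup>2 - (x \<bullet> (e i - e j))\<^sup>2 = 4 * ((x \<bullet> e i) * (x \<bullet> e j))" for x
    by (simp add: inner_add_right inner_diff_right power2_sum power2_diff)
  have Qpol: "Q (e i + e j) \<bullet> (e i + e j) - Q (e i - e j) \<bullet> (e i - e j) = 4 * (\<eta> i * (if i = j then 1 else 0))"
    using assms by (simp add: linear_add[OF lin] linear_diff[OF lin] inner_add_left inner_add_right
        inner_diff_left inner_diff_right Q_basis)
  have "quad_var_error t h n (e i + e j) \<omega> - quad_var_error t h n (e i - e j) \<omega>
     = (\<Sum>m<n. 4 * ((grid_incr t h n m \<omega> \<bullet> e i) * (grid_incr t h n m \<omega> \<bullet> e j)) - h / real n * (4 * (\<eta> i * (if i = j then 1 else 0))))"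
    unfolding quad_var_error_def sum_subtractf[symmetric] pol[symmetric] Qpol[symmetric]
    by (intro sum.cong refl) (simp add: algebra_simps)
  also have "\<dots> = 4 * cross_var_error t h n i j \<omega>"
    using n by (simp add: cross_var_error_def sum_subtractf sum_distrib_left[symmetric])
  finally show ?thesis by simp
qed

lemma diagonal_error_norm:
  fixes \<psi> :: "'j \<Rightarrow> 'j \<Rightarrow> 'h::{real_inner, banach, second_countable_topology}"
  shows "mean_sq M (\<lambda>\<omega>. diagonal_error t h n \<psi> \<omega>) \<le> ennreal (cross_var_const h \<psi> / real n)"
    and "diagonal_error t h n \<psi> \<in> borel_measurable M"
proof -
  have [measurable]: "grid_incr t h n m \<in> borel_measurable M" for m
    unfolding grid_incr_def by (rule incr_measurable[OF grid_nonneg grid_step])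
  show "diagonal_error t h n \<psi> \<in> borel_measurable M"
    unfolding diagonal_error_def cross_var_error_def by measurable
  let ?S = "\<Sum>i\<in>K. \<Sum>j\<in>K. (norm (\<psi> i j))\<^sup>2"
  have S0: "0 \<le> ?S" by (intro sum_nonneg) auto
  let ?B = "\<lambda>\<omega>. ?S * (\<Sum>i\<in>K. \<Sum>j\<in>K. ((quad_var_error t h n (e i + e j) \<omega>)\<^sup>2 + (quad_var_error t h n (e i - e j) \<omega>)\<^sup>2) * (1/2))"
  have pt: "(norm (diagonal_error t h n \<psi> \<omega>))\<^sup>2 \<le> ?B \<omega>" for \<omega>
  proof -
    let ?q = "\<lambda>p. cross_var_error t h n (fst p) (snd p) \<omega> / 2" and ?p = "\<lambda>p. norm (\<psi> (fst p) (snd p))"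
    have "norm (diagonal_error t h n \<psi> \<omega>) = norm (\<Sum>p\<in>K \<times> K. ?q p *\<^sub>R \<psi> (fst p) (snd p))"
      unfolding diagonal_error_def by (simp add: sum.cartesian_product split_def)
    also have "\<dots> \<le> (\<Sum>p\<in>K \<times> K. \<bar>?q p\<bar> * \<bar>?p p\<bar>)"
      by (rule order_trans[OF norm_sum]) simp
    also have "\<dots> \<le> sqrt (\<Sum>p\<in>K \<times> K. (?q p)\<^sup>2) * sqrt (\<Sum>p\<in>K \<times> K. (?p p)\<^sup>2)"
      by (rule sum_mult_le_sqrt)
    finally have "(norm (diagonal_error t h n \<psi> \<omega>))\<^sup>2 \<le> (sqrt (\<Sum>p\<in>K \<times> K. (?q p)\<^sup>2) * sqrt (\<Sum>p\<in>K \<times> K. (?p p)\<^sup>2))\<^sup>2"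
      by (intro power_mono) auto
    also have "\<dots> = (\<Sum>p\<in>K \<times> K. (?p p)\<^sup>2) * (\<Sum>p\<in>K \<times> K. (?q p)\<^sup>2)"
      by (simp add: power_mult_distrib sum_nonneg)
    also have "\<dots> = ?S * (\<Sum>i\<in>K. \<Sum>j\<in>K. (cross_var_error t h n i j \<omega> / 2)\<^sup>2)"
      by (simp add: sum.cartesian_product split_def)
    also have "\<dots> \<le> ?B \<omega>"
    proof (intro mult_left_mono sum_mono S0)
      fix i j assume ij: "i \<in> K" "j \<in> K"
      have "((a - b) / 4 / 2)\<^sup>2 \<le> (a\<^sup>2 + b\<^sup>2) * (1/2)" for a b :: real
      proof -
        have "(a - b)\<^sup>2 \<le> 2 * a\<^sup>2 + 2 * b\<^sup>2"
          using zero_le_power2[of "a + b"] unfolding power2_diff power2_sum by linarith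
        then have "(a - b)\<^sup>2 / 64 \<le> (2 * a\<^sup>2 + 2 * b\<^sup>2) / 64" by (rule divide_right_mono) simp
        also have "\<dots> \<le> (a\<^sup>2 + b\<^sup>2) * (1/2)" by simp
        finally show ?thesis by (simp add: power_divide)
      qed
      then show "(cross_var_error t h n i j \<omega> / 2)\<^sup>2 \<le> ((quad_var_error t h n (e i + e j) \<omega>)\<^sup>2 + (quad_var_error t h n (e i - e j) \<omega>)\<^sup>2) * (1/2)"
        unfolding cross_var_error_eq[OF ij] .
    qed
    finally show ?thesis .
  qed
  have int: "has_bochner_integral M ?B (?S * (\<Sum>i\<in>K. \<Sum>j\<in>K. (2 * (h * (Q (e i + e j) \<bullet> (e i + e j)))\<^sup>2 / real n
       + 2 * (h * (Q (e i - e j) \<bullet> (e i - e j)))\<^sup>2 / real n) * (1/2)))"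
    by (intro has_bochner_integral_mult_right has_bochner_integral_sum has_bochner_integral_mult_left
        has_bochner_integral_add quad_var_error_norm)
  have eq: "?S * (\<Sum>i\<in>K. \<Sum>j\<in>K. (2 * (h * (Q (e i + e j) \<bullet> (e i + e j)))\<^sup>2 / real n
       + 2 * (h * (Q (e i - e j) \<bullet> (e i - e j)))\<^sup>2 / real n) * (1/2)) = cross_var_const h \<psi> / real n"
    unfolding cross_var_const_def times_divide_eq_right[symmetric] sum_divide_distrib
    by (intro arg_cong2[where f = "(*)"] sum.cong refl) (simp add: add_divide_distrib)
  have "mean_sq M (\<lambda>\<omega>. diagonal_error t h n \<psi> \<omega>) \<le> (\<integral>\<^sup>+ \<omega>. ennreal (?B \<omega>) \<partial>M)"
    using pt by (intro nn_integral_mono ennreal_leI) auto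
  also have "\<dots> = ennreal (integral\<^sup>L M ?B)"
    using int S0 by (intro nn_integral_eq_integral AE_I2 mult_nonneg_nonneg sum_nonneg) (auto simp: has_bochner_integral_iff)
  also have "integral\<^sup>L M ?B = cross_var_const h \<psi> / real n"
    using has_bochner_integral_integral_eq[OF int] eq by (simp only:)
  finally show "mean_sq M (\<lambda>\<omega>. diagonal_error t h n \<psi> \<omega>) \<le> ennreal (cross_var_const h \<psi> / real n)" .
qed

text \<open>\<open>iterated_sum_decomposition\<close> is applied to each pair of directions. Half
  the product of the totals and the kernel sum cancel against the approximation; the term
  \<open>h * \<eta> i\<close> joins the diagonal sum to form the quadratic variation error.\<close>

lemma discrete_decomposition:
  fixes \<psi> :: "'j \<Rightarrow> 'j \<Rightarrow> 'h::{real_inner, banach, second_countable_topology}"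
  shows "grid_integral t h n n (\<lambda>m. linear_path \<psi> t (grid t h n m)) \<omega>
      - (\<Sum>i\<in>K. \<Sum>j\<in>K. discrete_iter_approx t h n D i j \<omega> *\<^sub>R \<psi> i j)
    = kernel_integral t h n (\<lambda>l m. 1/2 - levy_kernel D n l m) (\<lambda>i j. \<psi> i j - \<psi> j i) \<omega> - diagonal_error t h n \<psi> \<omega>"
proof -
  define x where "x i m = grid_incr t h n m \<omega> \<bullet> e i" for i m
  define B where "B k i j = (\<Sum>m<n. \<Sum>l<m. k l m * (x i l * x j m))" for k :: "nat \<Rightarrow> nat \<Rightarrow> real" and i j
  let ?k = "\<lambda>l m. 1/2 - levy_kernel D n l m"
  have inc: "incr (grid t h n m) (grid t h n (Suc m)) \<omega> \<bullet> e i = x i m" for i m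
    by (simp add: x_def grid_incr_def)
  have rearrange: "(\<Sum>m<n. \<Sum>j\<in>K. x j m *\<^sub>R (\<Sum>l<m. \<Sum>i\<in>K. x i l *\<^sub>R (k l m *\<^sub>R \<phi> i j))) = (\<Sum>i\<in>K. \<Sum>j\<in>K. B k i j *\<^sub>R \<phi> i j)"
    for k and \<phi> :: "'j \<Rightarrow> 'j \<Rightarrow> 'h"
  proof -
    have "(\<Sum>m<n. \<Sum>j\<in>K. x j m *\<^sub>R (\<Sum>l<m. \<Sum>i\<in>K. x i l *\<^sub>R (k l m *\<^sub>R \<phi> i j)))
        = (\<Sum>m<n. \<Sum>j\<in>K. \<Sum>l<m. \<Sum>i\<in>K. (k l m * (x i l * x j m)) *\<^sub>R \<phi> i j)"
      by (simp add: scaleR_sum_right mult_ac)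
    also have "\<dots> = (\<Sum>m<n. \<Sum>j\<in>K. \<Sum>i\<in>K. \<Sum>l<m. (k l m * (x i l * x j m)) *\<^sub>R \<phi> i j)"
      by (intro sum.cong refl sum.swap)
    also have "\<dots> = (\<Sum>m<n. \<Sum>i\<in>K. \<Sum>j\<in>K. \<Sum>l<m. (k l m * (x i l * x j m)) *\<^sub>R \<phi> i j)"
      by (intro sum.cong refl sum.swap)
    also have "\<dots> = (\<Sum>i\<in>K. \<Sum>m<n. \<Sum>j\<in>K. \<Sum>l<m. (k l m * (x i l * x j m)) *\<^sub>R \<phi> i j)"
      by (rule sum.swap)
    also have "\<dots> = (\<Sum>i\<in>K. \<Sum>j\<in>K. \<Sum>m<n. \<Sum>l<m. (k l m * (x i l * x j m)) *\<^sub>R \<phi> i j)"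
      by (intro sum.cong refl sum.swap)
    finally show ?thesis by (simp add: B_def scaleR_sum_left)
  qed
  have Z: "grid_integral t h n n (\<lambda>m. linear_path \<psi> t (grid t h n m)) \<omega>
      = (\<Sum>i\<in>K. \<Sum>j\<in>K. B (\<lambda>_ _. 1) i j *\<^sub>R \<psi> i j)"
  proof -
    have "linear_path \<psi> t (grid t h n m) j \<omega> = (\<Sum>l<m. \<Sum>i\<in>K. x i l *\<^sub>R (1 *\<^sub>R \<psi> i j))" for m j
      unfolding linear_path_def incr_grid inner_sum_left x_def[symmetric] scaleR_sum_left
      by (subst sum.swap) simp
    then show ?thesis unfolding block_integral_def inc rearrange[symmetric] by simp
  qed
  have R: "kernel_integral t h n ?k (\<lambda>i j. \<psi> i j - \<psi> j i) \<omega> = (\<Sum>i\<in>K. \<Sum>j\<in>K. (B ?k i j - B ?k j i) *\<^sub>R \<psi> i j)"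
  proof -
    have "kernel_integral t h n ?k (\<lambda>i j. \<psi> i j - \<psi> j i) \<omega> = (\<Sum>i\<in>K. \<Sum>j\<in>K. B ?k i j *\<^sub>R (\<psi> i j - \<psi> j i))"
      unfolding kernel_integral_def block_integral_def inc rearrange[symmetric] ..
    also have "\<dots> = (\<Sum>i\<in>K. \<Sum>j\<in>K. B ?k i j *\<^sub>R \<psi> i j) - (\<Sum>i\<in>K. \<Sum>j\<in>K. B ?k i j *\<^sub>R \<psi> j i)"
      by (simp add: scaleR_right_diff_distrib sum_subtractf)
    \<comment> \<open>Exchanging the names of \<open>i\<close> and \<open>j\<close> trades
      antisymmetry of the coefficients for antisymmetry of the double sums.\<close>
    also have "(\<Sum>i\<in>K. \<Sum>j\<in>K. B ?k i j *\<^sub>R \<psi> j i) = (\<Sum>i\<in>K. \<Sum>j\<in>K. B ?k j i *\<^sub>R \<psi> i j)"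
      by (rule sum.swap)
    finally show ?thesis by (simp add: scaleR_left_diff_distrib sum_subtractf)
  qed
  have "B (\<lambda>_ _. 1) i j - discrete_iter_approx t h n D i j \<omega> = (B ?k i j - B ?k j i) - cross_var_error t h n i j \<omega> / 2" for i j
    using iterated_sum_decomposition[of "x i" "x j" n D]
    unfolding B_def discrete_iter_approx_def cross_var_error_def x_def[symmetric]
    by (simp add: diff_divide_distrib)
  then show ?thesis
    unfolding Z R diagonal_error_def sum_subtractf[symmetric] scaleR_left_diff_distrib[symmetric] by simp
qed

end

text \<open>The kernel form is turned back into the sums for \<open>a\<^sub>r\<close> and
  \<open>b\<^sub>r\<close>, which converge along each continuous path; for fixed \<open>D\<close>
  only finitely many of them occur.\<close>

lemma discrete_iter_approx_tendsto:
  assumes h: "0 < h" and t: "0 \<le> t" and cont: "continuous_on {0..} (\<lambda>s. W s \<omega>)"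
  shows "(\<lambda>n. discrete_iter_approx t h n D i j \<omega>) \<longlonglongrightarrow> iter_integral_approx W e \<eta> t h D i j \<omega>"
proof -
  define w where "w j u = increment_coord W e t j u \<omega>" for j u
  have w0: "w j 0 = 0" for j by (simp add: w_def increment_coord_def)
  have wc: "continuous_on {0..h} (w j)" for j
    unfolding w_def[abs_def] increment_coord_def
    by (intro continuous_intros continuous_on_compose2[OF cont]) (use t in auto)
  have inc: "grid_incr t h n m \<omega> \<bullet> e j = w j (h * (real (Suc m) / real n)) - w j (h * (real m / real n))" for n m j
    by (simp add: grid_incr_def incr_def w_def increment_coord_def grid_def inner_diff_left mult.commute)
  define x where "x j n m = w j (h * (real (Suc m) / real n)) - w j (h * (real m / real n))" for j n m
  have tot: "(\<lambda>n. \<Sum>m<n. x j n m) \<longlonglongrightarrow> w j h" for j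
  proof (rule tendsto_eventually)
    show "eventually (\<lambda>n. (\<Sum>m<n. x j n m) = w j h) sequentially"
      using eventually_gt_at_top[of 0]
    proof eventually_elim
      case (elim n)
      then show ?case
        using sum_lessThan_telescope[of "\<lambda>m. w j (h * (real m / real n))" n] by (simp add: x_def w0)
    qed
  qed
  let ?a = "\<lambda>j n r. - (1 / (pi * real r)) * (\<Sum>m<n. sin (2 * real r * pi * (real m / real n)) * x j n m)"
  let ?b = "\<lambda>j n r. 1 / (pi * real r) * (\<Sum>m<n. cos (2 * real r * pi * (real m / real n)) * x j n m)"
  have fa: "(\<lambda>n. ?a j n r) \<longlonglongrightarrow> fourier_a (increment_coord W e t j) h r \<omega>" if "r \<in> {1..D}" for j r
    using fourier_cos_tendsto[OF h _ wc w0, of r j] that unfolding x_def fourier_a_def w_def by simp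
  have fb: "(\<lambda>n. ?b j n r) \<longlonglongrightarrow> fourier_b (increment_coord W e t j) h r \<omega>" if "r \<in> {1..D}" for j r
    using fourier_sin_tendsto[OF h _ wc w0, of r j] that unfolding x_def fourier_b_def w_def by simp
  have "(\<lambda>n. ((\<Sum>m<n. x i n m) * (\<Sum>m<n. x j n m) - h * \<eta> i * (if i = j then 1 else 0)) / 2
      + pi * (\<Sum>r=1..D. real r * (?a i n r * (?b j n r - 1 / (pi * real r) * (\<Sum>m<n. x j n m))
         - (?b i n r - 1 / (pi * real r) * (\<Sum>m<n. x i n m)) * ?a j n r)))
    \<longlonglongrightarrow> iter_integral_approx W e \<eta> t h D i j \<omega>"
    unfolding iter_integral_approx_def levy_area_trunc_def w_def[symmetric]
    by (intro tendsto_intros tot fa fb) auto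
  then show ?thesis
    unfolding discrete_iter_approx_def inc x_def[symmetric] levy_sum_eq_kernel .
qed

text \<open>Summable second moments make the series of squared norms finite almost surely, so its
  terms tend to 0. Without a summable rate, mean square convergence would give this only along a
  subsequence.\<close>

lemma geometric_AE_tendsto:
  fixes u :: "nat \<Rightarrow> 'a \<Rightarrow> 'h::{real_normed_vector, second_countable_topology}"
  assumes [measurable]: "\<And>k. u k \<in> borel_measurable M"
    and le: "\<And>k. mean_sq M (u k) \<le> ennreal (c * (1/2) ^ k)" and c: "0 \<le> c"
  shows "AE \<omega> in M. (\<lambda>k. u k \<omega>) \<longlonglongrightarrow> 0"
proof -
  have "(\<integral>\<^sup>+ \<omega>. (\<Sum>k. ennreal ((norm (u k \<omega>))\<^sup>2)) \<partial>M) = (\<Sum>k. \<integral>\<^sup>+ \<omega>. ennreal ((norm (u k \<omega>))\<^sup>2) \<partial>M)"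
    by (rule nn_integral_suminf) measurable
  also have "\<dots> \<le> (\<Sum>k. ennreal (c * (1/2) ^ k))" by (intro suminf_le le) auto
  also have "\<dots> < \<infinity>"
    using c by (subst suminf_ennreal2) (auto intro!: summable_mult summable_geometric)
  finally have "AE \<omega> in M. (\<Sum>k. ennreal ((norm (u k \<omega>))\<^sup>2)) \<noteq> \<infinity>"
    by (intro nn_integral_noteq_infinite) auto
  then show ?thesis
  proof eventually_elim
    fix \<omega> assume "(\<Sum>k. ennreal ((norm (u k \<omega>))\<^sup>2)) \<noteq> \<infinity>"
    then have "summable (\<lambda>k. (norm (u k \<omega>))\<^sup>2)" by (intro summable_suminf_not_top) auto
    then have "(\<lambda>k. sqrt ((norm (u k \<omega>))\<^sup>2)) \<longlonglongrightarrow> sqrt 0"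
      by (intro tendsto_real_sqrt summable_LIMSEQ_zero)
    then show "(\<lambda>k. u k \<omega>) \<longlonglongrightarrow> 0" by (simp add: tendsto_norm_zero_iff)
  qed
qed

lemma discrete_error_norm:
  fixes \<psi> :: "'j \<Rightarrow> 'j \<Rightarrow> 'h::{real_inner, banach, second_countable_topology}"
  assumes t: "0 \<le> t" and h: "0 < h" and n: "0 < n"
  shows "mean_sq M (\<lambda>\<omega>. grid_integral t h n n (\<lambda>m. linear_path \<psi> t (grid t h n m)) \<omega>
      - (\<Sum>i\<in>K. \<Sum>j\<in>K. discrete_iter_approx t h n D i j \<omega> *\<^sub>R \<psi> i j))
    \<le> ennreal (18 * h\<^sup>2 * drift_const (\<lambda>i j. \<psi> i j - \<psi> j i) / pi\<^sup>2 * (1 / real n * (\<Sum>m<n. (sawtooth_rem D (real m / real n))\<^sup>2))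
        + 2 * cross_var_const h \<psi> / real n)" (is "?lhs \<le> _")
    and "(\<lambda>\<omega>. grid_integral t h n n (\<lambda>m. linear_path \<psi> t (grid t h n m)) \<omega>
      - (\<Sum>i\<in>K. \<Sum>j\<in>K. discrete_iter_approx t h n D i j \<omega> *\<^sub>R \<psi> i j)) \<in> borel_measurable M"
proof -
  let ?k = "\<lambda>l m. 1/2 - levy_kernel D n l m" and ?\<phi> = "\<lambda>i j. \<psi> i j - \<psi> j i"
  note decomp = discrete_decomposition[OF t h n]
  note meas = kernel_integral_norm(2)[OF t h n, of ?k ?\<phi>] diagonal_error_norm(2)[OF t h n, of \<psi>]
  show "(\<lambda>\<omega>. grid_integral t h n n (\<lambda>m. linear_path \<psi> t (grid t h n m)) \<omega>
      - (\<Sum>i\<in>K. \<Sum>j\<in>K. discrete_iter_approx t h n D i j \<omega> *\<^sub>R \<psi> i j)) \<in> borel_measurable M"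
    unfolding decomp by (intro borel_measurable_diff meas)
  let ?S = "\<Sum>m<n. (sawtooth_rem D (real m / real n))\<^sup>2"
  have S0: "0 \<le> ?S" by (intro sum_nonneg) auto
  have cv0: "0 \<le> cross_var_const h \<psi>"
    unfolding cross_var_const_def by (intro mult_nonneg_nonneg sum_nonneg add_nonneg_nonneg) auto
  \<comment> \<open>The 2 for splitting off the diagonal and the 9 of
    \<open>levy_kernel_sum_le\<close> make the 18 of the bound.\<close>
  have "?lhs \<le> 2 * mean_sq M (\<lambda>\<omega>. kernel_integral t h n ?k ?\<phi> \<omega>)
      + 2 * mean_sq M (\<lambda>\<omega>. - diagonal_error t h n \<psi> \<omega>)"
    unfolding decomp
    using nn_integral_norm_sq_add_le[OF meas(1), of "\<lambda>\<omega>. - diagonal_error t h n \<psi> \<omega>"] meas(2) by simp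
  also have "\<dots> \<le> 2 * ennreal ((h / real n)\<^sup>2 * (drift_const ?\<phi> * (9 / pi\<^sup>2 * (real n * ?S)))) + 2 * ennreal (cross_var_const h \<psi> / real n)"
  proof (intro add_mono mult_left_mono)
    show "mean_sq M (\<lambda>\<omega>. kernel_integral t h n ?k ?\<phi> \<omega>)
        \<le> ennreal ((h / real n)\<^sup>2 * (drift_const ?\<phi> * (9 / pi\<^sup>2 * (real n * ?S))))"
      unfolding kernel_integral_norm(1)[OF t h n]
      by (intro ennreal_leI mult_left_mono levy_kernel_sum_le n drift_const_nonneg) auto
    show "mean_sq M (\<lambda>\<omega>. - diagonal_error t h n \<psi> \<omega>) \<le> ennreal (cross_var_const h \<psi> / real n)"
      using diagonal_error_norm(1)[OF t h n] by simp
  qed auto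
  also have "\<dots> = ennreal (2 * ((h / real n)\<^sup>2 * (drift_const ?\<phi> * (9 / pi\<^sup>2 * (real n * ?S)))) + 2 * (cross_var_const h \<psi> / real n))"
  proof -
    have "2 * ennreal a + 2 * ennreal b = ennreal (2 * a + 2 * b)" if "0 \<le> a" "0 \<le> b" for a b
      using that by (simp add: ennreal_plus[symmetric] ennreal_mult'[symmetric] del: ennreal_plus flip: ennreal_numeral)
    then show ?thesis
      using h S0 cv0 drift_const_nonneg[of ?\<phi>] by simp
  qed
  also have "2 * ((h / real n)\<^sup>2 * (drift_const ?\<phi> * (9 / pi\<^sup>2 * (real n * ?S)))) + 2 * (cross_var_const h \<psi> / real n)
      = 18 * h\<^sup>2 * drift_const ?\<phi> / pi\<^sup>2 * (1 / real n * ?S) + 2 * cross_var_const h \<psi> / real n"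
    using n by (simp add: power2_eq_square field_simps)
  finally show "?lhs \<le> ennreal (18 * h\<^sup>2 * drift_const ?\<phi> / pi\<^sup>2 * (1 / real n * ?S) + 2 * cross_var_const h \<psi> / real n)" .
qed

theorem iterated_integral_error:
  fixes \<psi> :: "'j \<Rightarrow> 'j \<Rightarrow> 'h::{real_inner, banach, second_countable_topology}"
    and X :: "real \<Rightarrow> 'a \<Rightarrow> 'u \<Rightarrow> 'h" and t h :: real
  assumes t: "0 \<le> t" and h: "0 < h" and D: "0 < D"
    and hom: "\<And>s \<omega>. homogeneous (X s \<omega>)"
    and X: "\<And>s j. s \<in> {t..t + h} \<Longrightarrow> j \<in> K \<Longrightarrow> AE \<omega> in M. X s \<omega> (e j) = linear_path \<psi> t s j \<omega>"
    and I: "is_SI t (t + h) X I"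
  shows "mean_sq M (\<lambda>\<omega>. I \<omega> - (\<Sum>i\<in>K. \<Sum>j\<in>K. iter_integral_approx W e \<eta> t h D i j \<omega> *\<^sub>R \<psi> i j))
    \<le> ennreal (9 * h\<^sup>2 * drift_const (\<lambda>i j. \<psi> i j - \<psi> j i) / (pi\<^sup>2 * real D))"
proof -
  \<comment> \<open>Along dyadic grids the mean square rate \<open>1 / real n\<close> becomes
    geometric, as \<open>geometric_AE_tendsto\<close> requires.\<close>
  define r :: "nat \<Rightarrow> nat" where "r k = 2 ^ k" for k
  have r: "0 < r k" for k by (simp add: r_def)
  have r_lim: "filterlim r at_top sequentially"
    by (rule filterlim_subseq) (simp add: r_def strict_mono_def)
  define Z where "Z k = block_integral {..<r k} (grid t h (r k)) (\<lambda>m. grid t h (r k) (Suc m)) (\<lambda>m. linear_path \<psi> t (grid t h (r k) m))" for k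
  define A where "A k \<omega> = (\<Sum>i\<in>K. \<Sum>j\<in>K. discrete_iter_approx t h (r k) D i j \<omega> *\<^sub>R \<psi> i j)" for k \<omega>
  let ?A = "\<lambda>\<omega>. \<Sum>i\<in>K. \<Sum>j\<in>K. iter_integral_approx W e \<eta> t h D i j \<omega> *\<^sub>R \<psi> i j"
  let ?d = "drift_const (\<lambda>i j. \<psi> i j - \<psi> j i)"
  have [measurable]: "I \<in> borel_measurable M"
    using I t h unfolding is_stoch_integral_def by (intro measurable_from_subalg[OF subalg[of "t + h"]]) auto
  have [measurable]: "Z k \<in> borel_measurable M" for k
  proof -
    have "L2_on M (F (grid t h (r k) m)) (linear_path \<psi> t (grid t h (r k) m) j)" for m j
      unfolding linear_path_def using t grid_ge[OF h] order_trans[OF t grid_ge[OF h]]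
      by (intro L2_on_sum[OF subalg] L2_on_scaleR_left[OF subalg] L2_on_incr) auto
    from L2_on_measurable_subalg[OF subalg[OF grid_nonneg[OF t h r]] grid_isometry(2)[OF t h r, OF this]]
    show ?thesis unfolding Z_def .
  qed
  have "AE \<omega> in M. (\<lambda>k. I \<omega> - Z k \<omega>) \<longlonglongrightarrow> 0"
  proof (rule geometric_AE_tendsto[where c = "4 * (h * (h * drift_const \<psi>))"])
    show "0 \<le> 4 * (h * (h * drift_const \<psi>))" using h by (intro mult_nonneg_nonneg drift_const_nonneg) auto
    show "mean_sq M (\<lambda>\<omega>. I \<omega> - Z k \<omega>) \<le> ennreal (4 * (h * (h * drift_const \<psi>)) * (1/2) ^ k)" for k
      using stoch_integral_step_dist[OF t h X r hom I, of k] unfolding Z_def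
      by (simp add: r_def power_divide)
  qed measurable
  moreover have "AE \<omega> in M. continuous_on {0..} (\<lambda>s. W s \<omega>)"
    using wiener by (simp add: Q_Wiener_process_wrt_def Q_Wiener_process_def)
  ultimately have lim: "AE \<omega> in M. (\<lambda>k. Z k \<omega> - A k \<omega>) \<longlonglongrightarrow> I \<omega> - ?A \<omega>"
  proof eventually_elim
    case (elim \<omega>)
    \<comment> \<open>One path is considered, outside the null sets: the grid sums tend to the
      chosen version and the discrete approximation to the actual one.\<close>
    have "(\<lambda>k. I \<omega> - (I \<omega> - Z k \<omega>)) \<longlonglongrightarrow> I \<omega> - 0" by (intro tendsto_intros elim)
    moreover have "(\<lambda>k. A k \<omega>) \<longlonglongrightarrow> ?A \<omega>"
      unfolding A_def
      by (intro tendsto_intros filterlim_compose[OF discrete_iter_approx_tendsto[OF h t elim(2)] r_lim])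
    ultimately show ?case by (intro tendsto_diff) simp_all
  qed
  let ?b = "\<lambda>n. 18 * h\<^sup>2 * ?d / pi\<^sup>2 * (1 / real n * (\<Sum>m<n. (sawtooth_rem D (real m / real n))\<^sup>2)) + 2 * cross_var_const h \<psi> / real n"
  have "?b \<longlonglongrightarrow> 18 * h\<^sup>2 * ?d / pi\<^sup>2 * integral {0..1} (\<lambda>x. (sawtooth_rem D x)\<^sup>2) + 0"
    by (intro tendsto_add tendsto_mult tendsto_const sawtooth_rem_mean_tendsto lim_const_over_n)
  then have "(\<lambda>k. ennreal (?b (r k))) \<longlonglongrightarrow> ennreal (18 * h\<^sup>2 * ?d / pi\<^sup>2 * integral {0..1} (\<lambda>x. (sawtooth_rem D x)\<^sup>2) + 0)"
    by (intro tendsto_ennrealI filterlim_compose[OF _ r_lim])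
  then have b_lim: "liminf (\<lambda>k. ennreal (?b (r k))) = ennreal (18 * h\<^sup>2 * ?d / pi\<^sup>2 * integral {0..1} (\<lambda>x. (sawtooth_rem D x)\<^sup>2))"
    by (intro lim_imp_Liminf) simp_all
  have meas: "(\<lambda>\<omega>. Z k \<omega> - A k \<omega>) \<in> borel_measurable M" for k
    unfolding Z_def A_def by (rule discrete_error_norm(2)[OF t h r])
  have "mean_sq M (\<lambda>\<omega>. I \<omega> - ?A \<omega>) = (\<integral>\<^sup>+ \<omega>. liminf (\<lambda>k. ennreal ((norm (Z k \<omega> - A k \<omega>))\<^sup>2)) \<partial>M)"
    using lim by (intro nn_integral_cong_AE, eventually_elim)
      (auto intro!: lim_imp_Liminf[symmetric] tendsto_ennrealI tendsto_intros)
  also have "\<dots> \<le> liminf (\<lambda>k. \<integral>\<^sup>+ \<omega>. ennreal ((norm (Z k \<omega> - A k \<omega>))\<^sup>2) \<partial>M)"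
    by (intro nn_integral_liminf measurable_compose[OF meas, of "\<lambda>x. ennreal ((norm x)\<^sup>2)"]) measurable
  also have "\<dots> \<le> liminf (\<lambda>k. ennreal (?b (r k)))"
    unfolding Z_def A_def by (intro Liminf_mono always_eventually allI discrete_error_norm(1) t h r)
  also have "\<dots> \<le> ennreal (18 * h\<^sup>2 * ?d / pi\<^sup>2 * (1 / (2 * real D)))"
    unfolding b_lim
    by (intro ennreal_leI mult_left_mono integral_sawtooth_rem_sq_le D divide_nonneg_nonneg mult_nonneg_nonneg
        drift_const_nonneg) auto
  also have "18 * h\<^sup>2 * ?d / pi\<^sup>2 * (1 / (2 * real D)) = 9 * h\<^sup>2 * ?d / (pi\<^sup>2 * real D)"
    by (simp add: mult_ac)
  finally show ?thesis .
qed

end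

section \<open>The error bound\<close>

text \<open>Evaluation at a fixed vector of \<open>V\<close> inherits linearity and the norm bound.
  It makes the outer integrand measurable and lets \<open>\<Psi>\<close> pass through the finite sum
  of the inner integral.\<close>

lemma bounded_linear_apply_restricted:
  assumes \<Psi>: "bounded_linear_into_restricted V \<Psi>" and v: "v \<in> V"
  shows "bounded_linear (\<lambda>x. \<Psi> x v)"
proof -
  obtain B where B: "\<And>x u. u \<in> V \<Longrightarrow> norm (\<Psi> x u) \<le> B * norm x * norm u"
    using \<Psi> unfolding bounded_linear_into_restricted_def by blast
  show ?thesis
    by (rule bounded_linear_intro[where K = "B * norm v"])
      (use \<Psi> v B[OF v] in \<open>auto simp: bounded_linear_into_restricted_def mult_ac\<close>)
qed

section \<open>Operators restricted to the range of the root\<close>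

context filtered_wiener_basis
begin

text \<open>Restricted operators are \<open>undefined\<close> off \<open>U0_space Q\<close>, so
  their values at \<open>e j\<close> make sense because \<open>\<eta> j > 0\<close> exhibits
  \<open>e j\<close> as an image under the root.\<close>

lemma basis_in_U0:
  assumes eig: "\<And>j. j \<in> J \<Longrightarrow> 0 \<le> \<eta> j \<and> Q (e j) = \<eta> j *\<^sub>R e j"
    and B: "\<And>K. finite K \<Longrightarrow> K \<subseteq> J \<Longrightarrow> (\<Sum>j\<in>K. \<eta> j) \<le> B"
  shows "subspace (U0_space Q)" and "j \<in> K \<Longrightarrow> e j \<in> U0_space Q"
proof -
  note R = op_sqrt_diagonal[OF nonneg_symmetricD(1)[OF nonneg] basis eig B]
  have lin: "linear (op_sqrt Q)" using nonneg_symmetricD(1)[OF R(1)] by (rule bounded_linear.linear)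
  show sub: "subspace (U0_space Q)"
    unfolding U0_space_def by (rule linear_subspace_image[OF lin subspace_UNIV])
  assume j: "j \<in> K"
  then have "op_sqrt Q ((1 / sqrt (\<eta> j)) *\<^sub>R e j) = e j"
    using R(3)[of j] K(2) eta_pos[OF j] by (auto simp: linear_scale[OF lin])
  then show "e j \<in> U0_space Q" unfolding U0_space_def by (metis rangeI)
qed

lemma restricted_homogeneous:
  assumes V: "subspace V" "\<And>j. j \<in> K \<Longrightarrow> e j \<in> V" and f: "f \<in> restricted_ops V"
  shows "homogeneous f"
proof -
  obtain S where S: "bounded_linear S" "f = restrict S V" using f by (auto simp: restricted_ops_def)
  have lin: "linear S" using S(1) by (rule bounded_linear.linear)
  show ?thesis
    using V subspace_0[OF V(1)] subspace_scale[OF V(1)]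
    by (auto simp: homogeneous_def S(2) linear_0[OF lin] linear_scale[OF lin])
qed

text \<open>The trace enters squared, once for each of the two integrations.\<close>

lemma drift_const_le:
  assumes \<phi>: "\<And>i j. i \<in> K \<Longrightarrow> j \<in> K \<Longrightarrow> norm (\<phi> i j) \<le> b" and tr: "(\<Sum>j\<in>K. \<eta> j) \<le> B"
  shows "drift_const \<phi> \<le> b\<^sup>2 * B\<^sup>2"
proof -
  have "drift_const \<phi> \<le> (\<Sum>j\<in>K. \<eta> j * (\<Sum>i\<in>K. \<eta> i * b\<^sup>2))"
    unfolding drift_const_def by (intro sum_mono mult_left_mono power_mono \<phi> eta_nonneg) auto
  also have "\<dots> = b\<^sup>2 * (\<Sum>j\<in>K. \<eta> j)\<^sup>2"
    by (simp add: power2_eq_square sum_distrib_left sum_distrib_right mult_ac)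
  also have "\<dots> \<le> b\<^sup>2 * B\<^sup>2"
    using tr by (intro mult_left_mono power_mono sum_nonneg) (auto simp: eta_nonneg)
  finally show ?thesis .
qed

theorem iterated_stoch_integral_error:
  fixes \<Phi> :: "'u \<Rightarrow> 'h::{real_inner, banach, second_countable_topology}" and \<Psi> :: "'h \<Rightarrow> 'u \<Rightarrow> 'h"
  assumes V: "subspace V" "\<And>j. j \<in> K \<Longrightarrow> e j \<in> V"
    and \<Phi>: "\<Phi> \<in> restricted_ops V" and \<Psi>: "bounded_linear_into_restricted V \<Psi>"
    and t: "0 \<le> t" and h: "0 < h" and D: "0 < D"
  shows "(\<integral>\<^sup>+ \<omega>. ennreal ((norm
        (SI t (t + h) (\<lambda>s \<omega>. \<Psi> (SI t s (\<lambda>r \<omega>. \<Phi>) \<omega>)) \<omega>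
         - (\<Sum>i\<in>K. \<Sum>j\<in>K. iter_integral_approx W e \<eta> t h D i j \<omega> *\<^sub>R \<Psi> (\<Phi> (e i)) (e j))))\<^sup>2) \<partial>M)
    \<le> ennreal (9 * h\<^sup>2 * drift_const (\<lambda>i j. \<Psi> (\<Phi> (e i)) (e j) - \<Psi> (\<Phi> (e j)) (e i)) / (pi\<^sup>2 * real D))"
proof -
  define X where "X s \<omega> = \<Psi> (SI t s (\<lambda>r \<omega>. \<Phi>) \<omega>)" for s \<omega>
  let ?\<psi> = "\<lambda>i j. \<Psi> (\<Phi> (e i)) (e j)"
  obtain L :: "'u \<Rightarrow>\<^sub>L 'h" where L: "\<forall>j\<in>K. blinfun_apply L (e j) = \<Phi> (e j)"
    using coeff_blinfun_exists[of "\<lambda>j. \<Phi> (e j)"] by blast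
  note inner = const_stoch_integral[OF t _ restricted_homogeneous[OF V \<Phi>], of _ L]
  have hom: "homogeneous (X s \<omega>)" for s \<omega>
    using \<Psi> unfolding X_def by (intro restricted_homogeneous[OF V]) (auto simp: bounded_linear_into_restricted_def)
  \<comment> \<open>The range of the projected root is spanned by the \<open>e j\<close> in
    \<open>K\<close>, hence lies in \<open>V\<close>, where evaluation of \<open>\<Psi>\<close> is
    continuous in its first argument.\<close>
  have Xm: "(\<lambda>\<omega>. X s \<omega> (op_sqrt cov u)) \<in> borel_measurable (F s)" if s: "s \<in> {t..t + h}" for s u
  proof -
    obtain c where c: "op_sqrt cov u = (\<Sum>j\<in>K. c j *\<^sub>R e j)" using op_sqrt_cov_in_span by blast
    have "op_sqrt cov u \<in> V" unfolding c by (intro subspace_sum subspace_scale V)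
    then have "(\<lambda>x. \<Psi> x (op_sqrt cov u)) \<in> borel_measurable borel"
      by (intro borel_measurable_continuous_onI linear_continuous_on bounded_linear_apply_restricted[OF \<Psi>])
    moreover have "SI t s (\<lambda>r \<omega>. \<Phi>) \<in> borel_measurable (F s)"
      using s L by (intro inner) auto
    ultimately show ?thesis unfolding X_def by (rule measurable_compose[rotated])
  qed
  \<comment> \<open>The inner version equals the explicit sum almost surely at this
    \<open>s\<close>, and linearity of \<open>\<Psi>\<close> in its first argument moves the sum
    outside.\<close>
  have X: "AE \<omega> in M. X s \<omega> (e j) = linear_path ?\<psi> t s j \<omega>" if s: "s \<in> {t..t + h}" and j: "j \<in> K" for s j
  proof -
    have lin: "linear (\<lambda>x. \<Psi> x (e j))"
      by (rule bounded_linear.linear[OF bounded_linear_apply_restricted[OF \<Psi> V(2)[OF j]]])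
    have "AE \<omega> in M. SI t s (\<lambda>r \<omega>. \<Phi>) \<omega> = const_integral \<Phi> t s \<omega>"
      using s L by (intro inner) auto
    then show ?thesis
      by eventually_elim (simp add: X_def const_integral_def linear_path_def linear_sum[OF lin] linear_scale[OF lin])
  qed
  obtain I where "is_SI t (t + h) X I"
    using linear_path_stoch_integral_exists[OF t h hom Xm X] by blast
  from iterated_integral_error[OF t h D hom X stoch_integral_is[OF this]]
  show ?thesis unfolding X_def .
qed

end

theorem corollary2p2:
  fixes Q :: "'u::{real_inner, banach, second_countable_topology} \<Rightarrow> 'u"
    and \<Phi> :: "'u \<Rightarrow> 'h::{real_inner, banach, second_countable_topology}"
    and \<Psi> :: "'h \<Rightarrow> 'u \<Rightarrow> 'h"
    and T :: real
  assumes "0 < T"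
    and "nonneg_symmetric Q" and "trace_class Q"
    and "\<Phi> \<in> restricted_ops (U0_space Q)"
    and "bounded_linear_into_restricted (U0_space Q) \<Psi>"
  shows "\<exists>C>0. \<forall>(M :: 'a measure) (F :: real \<Rightarrow> 'a measure) (W :: real \<Rightarrow> 'a \<Rightarrow> 'u)
           (J :: 'j set) (e :: 'j \<Rightarrow> 'u) (\<eta> :: 'j \<Rightarrow> real).
      filtered_prob_space M F \<and> Q_Wiener_process_wrt M F Q W \<and>
      countable J \<and> orthonormal_basis J e \<and> (\<forall>j\<in>J. 0 \<le> \<eta> j \<and> Q (e j) = \<eta> j *\<^sub>R e j)
      \<longrightarrow>
      (\<forall>(h::real) (t::real) (D::nat) (K::nat) (JK :: 'j set).
         0 < h \<and> t \<in> {0..T} \<and> t + h \<in> {0..T} \<and> 1 \<le> D \<and> 1 \<le> K \<and>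
         JK \<subseteq> J \<and> finite JK \<and> card JK = K \<and> (\<forall>j\<in>JK. \<eta> j \<noteq> 0)
         \<longrightarrow>
         (let WK = proj_process e JK W;
              SI = (\<lambda>a b X. stoch_integral M F (proj_cov e \<eta> JK) J e WK a b X);
              msq = (\<integral>\<^sup>+ \<omega>. ennreal ((norm
                       (SI t (t + h) (\<lambda>s \<omega>. \<Psi> (SI t s (\<lambda>r \<omega>. \<Phi>) \<omega>)) \<omega>
                        - (\<Sum>i\<in>JK. \<Sum>j\<in>JK.
                             iter_integral_approx W e \<eta> t h D i j \<omega> *\<^sub>R \<Psi> (\<Phi> (e i)) (e j))))\<^sup>2) \<partial>M)
          in msq < \<infinity> \<and> sqrt (enn2real msq) \<le> C * (h / (pi * sqrt (real D)))))"
proof -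
  obtain a b :: "nat \<Rightarrow> 'u" where ab: "summable (\<lambda>n. norm (a n) * norm (b n))"
    "\<And>x. (\<lambda>n. (b n \<bullet> x) *\<^sub>R a n) sums Q x"
    using assms(3) unfolding trace_class_def by blast
  \<comment> \<open>Taken from a representation of \<open>Q\<close> alone, before the probability
    space, the basis and the index set are introduced; so the constant depends on none of
    them.\<close>
  define tr where "tr = (\<Sum>n. norm (a n) * norm (b n))"
  have tr0: "0 \<le> tr" unfolding tr_def by (intro suminf_nonneg ab(1)) auto
  obtain S where S: "bounded_linear S" "\<Phi> = restrict S (U0_space Q)"
    using assms(4) by (auto simp: restricted_ops_def)
  obtain s where s: "0 \<le> s" "\<And>x. norm (S x) \<le> norm x * s"
    using bounded_linear.nonneg_bounded[OF S(1)] by blast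
  obtain B where B: "\<And>x u. u \<in> U0_space Q \<Longrightarrow> norm (\<Psi> x u) \<le> B * norm x * norm u"
    using assms(5) unfolding bounded_linear_into_restricted_def by blast
  \<comment> \<open>The antisymmetrised coefficients are at most
    \<open>2 * (\<bar>B\<bar> * s)\<close>, and 6 is the root of 9 times the square of 2. The
    absolute value is taken because the bound \<open>B\<close> need not be nonnegative.\<close>
  define G where "G = 6 * (\<bar>B\<bar> * s) * tr"
  have G0: "0 \<le> G" using s(1) tr0 by (simp add: G_def)
  show ?thesis
  \<comment> \<open>The added 1 secures strict positivity, since \<open>G\<close> can be 0.\<close>
  proof (intro exI[of _ "G + 1"] conjI allI impI; (elim conjE)?)
    show "0 < G + 1" using G0 by simp
    fix M :: "'a measure" and F :: "real \<Rightarrow> 'a measure" and W :: "real \<Rightarrow> 'a \<Rightarrow> 'u"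
      and J :: "'j set" and e :: "'j \<Rightarrow> 'u" and \<eta> :: "'j \<Rightarrow> real"
      and h t :: real and D K :: nat and JK :: "'j set"
    assume M: "filtered_prob_space M F" "Q_Wiener_process_wrt M F Q W" and e: "orthonormal_basis J e"
      and eig: "\<forall>j\<in>J. 0 \<le> \<eta> j \<and> Q (e j) = \<eta> j *\<^sub>R e j"
      and h: "0 < h" and t: "t \<in> {0..T}" and D: "1 \<le> D"
      and JK: "JK \<subseteq> J" "finite JK" "\<forall>j\<in>JK. \<eta> j \<noteq> 0"
    have "\<And>j. j \<in> JK \<Longrightarrow> 0 < \<eta> j \<and> Q (e j) = \<eta> j *\<^sub>R e j"
      using eig JK by (metis order_le_less subsetD)
    then interpret filtered_wiener_basis M F Q W J JK e \<eta>
      using M e JK assms(2) by unfold_locales auto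
    have trace: "(\<Sum>j\<in>K. \<eta> j) \<le> tr" if "finite K" "K \<subseteq> J" for K
      unfolding tr_def
    proof (rule trace_bound[OF that(1) _ ab])
      show "e i \<bullet> e j = (if i = j then 1 else 0)" if "i \<in> K" "j \<in> K" for i j
        using e \<open>K \<subseteq> J\<close> that unfolding orthonormal_basis_def by (meson subsetD)
      show "Q (e j) = \<eta> j *\<^sub>R e j" if "j \<in> K" for j using eig \<open>K \<subseteq> J\<close> that by blast
    qed
    have U0: "subspace (U0_space Q)" "\<And>j. j \<in> JK \<Longrightarrow> e j \<in> U0_space Q"
      using basis_in_U0[of tr] eig trace by blast+
    have \<psi>: "norm (\<Psi> (\<Phi> (e i)) (e j)) \<le> \<bar>B\<bar> * s" if "i \<in> JK" "j \<in> JK" for i j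
    proof -
      have e1: "norm (e i) = 1" "norm (e j) = 1" using orthonormal that by (simp_all add: norm_eq_sqrt_inner)
      have "norm (\<Psi> (\<Phi> (e i)) (e j)) \<le> B * norm (\<Phi> (e i)) * norm (e j)" by (rule B[OF U0(2)[OF that(2)]])
      also have "\<dots> \<le> \<bar>B\<bar> * norm (\<Phi> (e i))" using e1 by (simp add: mult_right_mono)
      also have "\<dots> \<le> \<bar>B\<bar> * s" using s(2)[of "e i"] e1 U0(2)[OF that(1)] by (intro mult_left_mono) (simp_all add: S(2))
      finally show ?thesis .
    qed
    have "drift_const (\<lambda>i j. \<Psi> (\<Phi> (e i)) (e j) - \<Psi> (\<Phi> (e j)) (e i)) \<le> (2 * (\<bar>B\<bar> * s))\<^sup>2 * tr\<^sup>2"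
    proof (rule drift_const_le[OF _ trace[OF JK(2,1)]])
      fix i j assume "i \<in> JK" "j \<in> JK"
      then show "norm (\<Psi> (\<Phi> (e i)) (e j) - \<Psi> (\<Phi> (e j)) (e i)) \<le> 2 * (\<bar>B\<bar> * s)"
        using norm_triangle_ineq4[of "\<Psi> (\<Phi> (e i)) (e j)" "\<Psi> (\<Phi> (e j)) (e i)"] \<psi>[of i j] \<psi>[of j i] by linarith
    qed
    then have "9 * h\<^sup>2 * drift_const (\<lambda>i j. \<Psi> (\<Phi> (e i)) (e j) - \<Psi> (\<Phi> (e j)) (e i)) / (pi\<^sup>2 * real D)
        \<le> 9 * h\<^sup>2 * ((2 * (\<bar>B\<bar> * s))\<^sup>2 * tr\<^sup>2) / (pi\<^sup>2 * real D)"
      by (intro divide_right_mono mult_left_mono) auto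
    also have "\<dots> = (G * (h / (pi * sqrt (real D))))\<^sup>2"
      by (simp add: G_def power_mult_distrib power_divide)
    finally have bound: "9 * h\<^sup>2 * drift_const (\<lambda>i j. \<Psi> (\<Phi> (e i)) (e j) - \<Psi> (\<Phi> (e j)) (e i)) / (pi\<^sup>2 * real D)
        \<le> (G * (h / (pi * sqrt (real D))))\<^sup>2" .
    define msq where "msq = (\<integral>\<^sup>+ \<omega>. ennreal ((norm
        (SI t (t + h) (\<lambda>s \<omega>. \<Psi> (SI t s (\<lambda>r \<omega>. \<Phi>) \<omega>)) \<omega>
         - (\<Sum>i\<in>JK. \<Sum>j\<in>JK. iter_integral_approx W e \<eta> t h D i j \<omega> *\<^sub>R \<Psi> (\<Phi> (e i)) (e j))))\<^sup>2) \<partial>M)"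
    have "msq \<le> ennreal ((G * (h / (pi * sqrt (real D))))\<^sup>2)"
      using iterated_stoch_integral_error[OF U0 assms(4,5), of t h D] t h D ennreal_leI[OF bound]
      unfolding msq_def by (auto intro: order_trans)
    \<comment> \<open>Finiteness is kept as a separate claim: \<open>enn2real\<close> maps infinity
      to 0, so the bound on the root alone would say nothing about an infinite moment.\<close>
    then have fin: "msq < \<infinity>" and "enn2real msq \<le> (G * (h / (pi * sqrt (real D))))\<^sup>2"
      by (auto simp: le_less_trans enn2real_leI)
    then have "sqrt (enn2real msq) \<le> G * (h / (pi * sqrt (real D)))"
      using G0 h by (intro real_le_lsqrt) auto
    also have "\<dots> \<le> (G + 1) * (h / (pi * sqrt (real D)))"
      using h by (intro mult_right_mono) auto
    finally show "let WK = proj_process e JK W;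
              SI = (\<lambda>a b X. stoch_integral M F (proj_cov e \<eta> JK) J e WK a b X);
              msq = (\<integral>\<^sup>+ \<omega>. ennreal ((norm
                       (SI t (t + h) (\<lambda>s \<omega>. \<Psi> (SI t s (\<lambda>r \<omega>. \<Phi>) \<omega>)) \<omega>
                        - (\<Sum>i\<in>JK. \<Sum>j\<in>JK.
                             iter_integral_approx W e \<eta> t h D i j \<omega> *\<^sub>R \<Psi> (\<Phi> (e i)) (e j))))\<^sup>2) \<partial>M)
          in msq < \<infinity> \<and> sqrt (enn2real msq) \<le> (G + 1) * (h / (pi * sqrt (real D)))"
      using fin unfolding Let_def msq_def by blast
  qed
qed

end
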